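(* Given any proof $\Pi$ of a formula $\alpha$ in system $\mathsf{SKS}$, one can construct a proof of $\alpha$ in $\mathsf{SKS}\setminus\{\mathsf{ai}{\uparrow}\}$ (i.e. a cut-free proof) in time quasipolynomial in the size of $\Pi$.
   Context: Formulae are built from the units $\mathsf f,\mathsf t$ and atoms $a,b,\dots$ (with a non-identical involution $a\mapsto\bar a$; negation exists only on atoms) by disjunction $[\alpha\vee\beta]$ and conjunction $(\alpha\wedge\beta)$. A context $\xi\{\ \}$ is a formula with one hole. A rule with premiss $\alpha$ and conclusion $\beta$ generates inference steps from $\xi\{\gamma\}$ to $\xi\{\delta\}$ for any instance $\gamma,\delta$ of $\alpha,\beta$ and any context $\xi$ (deep inference). A derivation is a finite chain of inference steps; a proof is a derivation with premiss $\mathsf t$. System $\mathsf{SKS}$ consists of: atomic identity $\mathsf{ai}{\downarrow}$: $\mathsf t\to[a\vee\bar a]$; atomic weakening $\mathsf{aw}{\downarrow}$: $\mathsf f\to a$; atomic contraction $\mathsf{ac}{\downarrow}$: $[a\vee a]\to a$; atomic cut $\mathsf{ai}{\uparrow}$: $(a\wedge\bar a)\to\mathsf f$; atomic coweakening $\mathsf{aw}{\uparrow}$: $a\to\mathsf t$; atomic cocontraction $\mathsf{ac}{\uparrow}$: $a\to(a\wedge a)$; switch $\mathsf s$: $(\alpha\wedge[\beta\vee\gamma])\to[(\alpha\wedge\beta)\vee\gamma]$; medial $\mathsf m$: $[(\alpha\wedge\beta)\vee(\gamma\wedge\delta)]\to([\alpha\vee\gamma]\wedge[\beta\vee\delta])$;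 and the equality rule $=$ (replace a formula by one equal modulo associativity and commutativity of $\vee,\wedge$ and $[\alpha\vee\mathsf f]=\alpha$, $(\alpha\wedge\mathsf t)=\alpha$, $[\mathsf t\vee\mathsf t]=\mathsf t$, $(\mathsf f\wedge\mathsf f)=\mathsf f$, closed under contexts), which is present in every subsystem. The size of a proof is the number of unit and atom occurrences in it. Quasipolynomial time means time $n^{O(\log n)}$-type bounds, i.e. $2^{(\log n)^{O(1)}}$, in the input size $n$. *)

theory Defs
  imports Complex_Main
begin

section \<open>Formulae and system SKS\<close>

datatype 'a fm =
    FF
  | TT
  | Atom 'a
  | Or "'a fm" "'a fm"
  | And "'a fm" "'a fm"

datatype 'a ctx =
    Hole
  | OrL "'a ctx" "'a fm"
  | OrR "'a fm" "'a ctx"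
  | AndL "'a ctx" "'a fm"
  | AndR "'a fm" "'a ctx"

fun fill :: "'a ctx \<Rightarrow> 'a fm \<Rightarrow> 'a fm" where
  "fill Hole A = A"
| "fill (OrL X B) A = Or (fill X A) B"
| "fill (OrR B X) A = Or B (fill X A)"
| "fill (AndL X B) A = And (fill X A) B"
| "fill (AndR B X) A = And B (fill X A)"

inductive feq :: "'a fm \<Rightarrow> 'a fm \<Rightarrow> bool" where
  feq_refl: "feq A A"
| feq_sym: "feq A B \<Longrightarrow> feq B A"
| feq_trans: "feq A B \<Longrightarrow> feq B C \<Longrightarrow> feq A C"
| feq_ctx: "feq A B \<Longrightarrow> feq (fill X A) (fill X B)"
| or_comm: "feq (Or A B) (Or B A)"
| and_comm: "feq (And A B) (And B A)"
| or_assoc: "feq (Or (Or A B) C) (Or A (Or B C))"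
| and_assoc: "feq (And (And A B) C) (And A (And B C))"
| or_unit: "feq (Or A FF) A"
| and_unit: "feq (And A TT) A"
| or_TT: "feq (Or TT TT) TT"
| and_FF: "feq (And FF FF) FF"

datatype rule =
  AiDown | AwDown | AcDown | AiUp | AwUp | AcUp | Switch | Medial | Equality

text \<open>
  The function \<open>bar\<close> is the involution on atoms. Negation exists on atoms only, so the dual of
  an atom is again an atom.
\<close>

inductive rule_instance :: "('a \<Rightarrow> 'a) \<Rightarrow> rule \<Rightarrow> 'a fm \<Rightarrow> 'a fm \<Rightarrow> bool"
  for bar :: "'a \<Rightarrow> 'a" where
  ai_down: "rule_instance bar AiDown TT (Or (Atom a) (Atom (bar a)))"
| aw_down: "rule_instance bar AwDown FF (Atom a)"
| ac_down: "rule_instance bar AcDown (Or (Atom a) (Atom a)) (Atom a)"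
| ai_up: "rule_instance bar AiUp (And (Atom a) (Atom (bar a))) FF"
| aw_up: "rule_instance bar AwUp (Atom a) TT"
| ac_up: "rule_instance bar AcUp (Atom a) (And (Atom a) (Atom a))"
| switch: "rule_instance bar Switch (And A (Or B C)) (Or (And A B) C)"
| medial: "rule_instance bar Medial (Or (And A B) (And C D)) (And (Or A C) (Or B D))"
| equality: "feq A B \<Longrightarrow> rule_instance bar Equality A B"

definition SKS :: "rule set" where
  "SKS = UNIV"

definition inference_step :: "('a \<Rightarrow> 'a) \<Rightarrow> rule set \<Rightarrow> 'a fm \<Rightarrow> 'a fm \<Rightarrow> bool" where
  "inference_step bar S A B \<longleftrightarrow>
     (\<exists>r\<in>S. \<exists>X C D. rule_instance bar r C D \<and> A = fill X C \<and> B = fill X D)"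

text \<open>
  A derivation is given by the nonempty list of the formulae it passes through, from its premiss
  to its conclusion.
\<close>

definition derivation ::
  "('a \<Rightarrow> 'a) \<Rightarrow> rule set \<Rightarrow> 'a fm list \<Rightarrow> 'a fm \<Rightarrow> 'a fm \<Rightarrow> bool" where
  "derivation bar S As A B \<longleftrightarrow>
     As \<noteq> [] \<and> hd As = A \<and> last As = B \<and> successively (inference_step bar S) As"

definition is_proof :: "('a \<Rightarrow> 'a) \<Rightarrow> rule set \<Rightarrow> 'a fm list \<Rightarrow> 'a fm \<Rightarrow> bool" where
  "is_proof bar S As A \<longleftrightarrow> derivation bar S As TT A"

fun fm_size :: "'a fm \<Rightarrow> nat" where
  "fm_size FF = 1"
| "fm_size TT = 1"
| "fm_size (Atom a) = 1"
| "fm_size (Or A B) = fm_size A + fm_size B"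
| "fm_size (And A B) = fm_size A + fm_size B"

definition proof_size :: "'a fm list \<Rightarrow> nat" where
  "proof_size As = (\<Sum>A\<leftarrow>As. fm_size A)"


section \<open>Running time\<close>

text \<open>
  The model of computation is a first-order functional language with general recursion and
  call-by-value evaluation on binary trees, in the manner of the languages of N. D. Jones,
  \<^emph>\<open>Computability and Complexity from a Programming Perspective\<close> (1997). A program
  is a finite list of mutually recursive unary functions, the first of which is its entry point.

  Atoms are indivisible leaves of the trees, which is what makes the number of unit and
  atom occurrences an adequate measure of the input: a program can compare two atoms and pass
  from an atom to its dual, but it has no access to names of atoms and contains none itself.
\<close>

datatype 'a data = DNil | DAtom 'a | DCons "'a data" "'a data"

fun data_size :: "'a data \<Rightarrow> nat" where
  "data_size DNil = 1"
| "data_size (DAtom a) = 1"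
| "data_size (DCons u v) = 1 + data_size u + data_size v"

text \<open>
  Variables are de Bruijn indices: a function body is evaluated with its argument as variable 0,
  and \<open>Let e d\<close> evaluates \<open>d\<close> with the value of \<open>e\<close> pushed as the new variable 0.
\<close>

datatype exp =
    Var nat
  | Nl
  | Cns exp exp
  | Hd exp
  | Tl exp
  | Dual exp
  | IsAtom exp
  | IsEq exp exp
  | If exp exp exp
  | Let exp exp
  | Call nat exp

type_synonym program = "exp list"

fun data_hd :: "'a data \<Rightarrow> 'a data" where
  "data_hd (DCons u v) = u"
| "data_hd _ = DNil"

fun data_tl :: "'a data \<Rightarrow> 'a data" where
  "data_tl (DCons u v) = v"
| "data_tl _ = DNil"

fun data_dual :: "('a \<Rightarrow> 'a) \<Rightarrow> 'a data \<Rightarrow> 'a data" where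
  "data_dual bar (DAtom a) = DAtom (bar a)"
| "data_dual bar _ = DNil"

fun is_DAtom :: "'a data \<Rightarrow> bool" where
  "is_DAtom (DAtom a) = True"
| "is_DAtom _ = False"

definition data_bool :: "bool \<Rightarrow> 'a data" where
  "data_bool b = (if b then DCons DNil DNil else DNil)"

text \<open>
  \<open>eval bar P env e v t\<close>: in the environment \<open>env\<close>, expression \<open>e\<close> of program \<open>P\<close> evaluates
  to \<open>v\<close> in time \<open>t\<close>. Every construct costs one unit of time, except that reading a variable costs
  the size of the value it copies. Hence the size of a value is at most twice its cost
  (lemma \<open>eval_data_size\<close> below), so that repeated doubling of a tree is not cheap and the comparison
  of two trees is paid for by their evaluation. Once the atoms of the input
  are numbered, time in this model and time on Turing machines are thus polynomially related, and quasipolynomial time is the same notion for both.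
\<close>

inductive eval ::
  "('a \<Rightarrow> 'a) \<Rightarrow> program \<Rightarrow> 'a data list \<Rightarrow> exp \<Rightarrow> 'a data \<Rightarrow> nat \<Rightarrow> bool"
  for bar :: "'a \<Rightarrow> 'a" and P :: program where
  eval_Var: "i < length env \<Longrightarrow> eval bar P env (Var i) (env ! i) (data_size (env ! i))"
| eval_Nl: "eval bar P env Nl DNil 1"
| eval_Cns: "eval bar P env e u s \<Longrightarrow> eval bar P env d v t \<Longrightarrow>
    eval bar P env (Cns e d) (DCons u v) (s + t + 1)"
| eval_Hd: "eval bar P env e v t \<Longrightarrow> eval bar P env (Hd e) (data_hd v) (t + 1)"
| eval_Tl: "eval bar P env e v t \<Longrightarrow> eval bar P env (Tl e) (data_tl v) (t + 1)"
| eval_Dual: "eval bar P env e v t \<Longrightarrow> eval bar P env (Dual e) (data_dual bar v) (t + 1)"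
| eval_IsAtom: "eval bar P env e v t \<Longrightarrow>
    eval bar P env (IsAtom e) (data_bool (is_DAtom v)) (t + 1)"
| eval_IsEq: "eval bar P env e u s \<Longrightarrow> eval bar P env d v t \<Longrightarrow>
    eval bar P env (IsEq e d) (data_bool (u = v)) (s + t + 1)"
| eval_If_true: "eval bar P env c u s \<Longrightarrow> u \<noteq> DNil \<Longrightarrow> eval bar P env e v t \<Longrightarrow>
    eval bar P env (If c e d) v (s + t + 1)"
| eval_If_false: "eval bar P env c DNil s \<Longrightarrow> eval bar P env d v t \<Longrightarrow>
    eval bar P env (If c e d) v (s + t + 1)"
| eval_Let: "eval bar P env e u s \<Longrightarrow> eval bar P (u # env) d v t \<Longrightarrow>
    eval bar P env (Let e d) v (s + t + 1)"
| eval_Call: "f < length P \<Longrightarrow> eval bar P env e u s \<Longrightarrow> eval bar P [u] (P ! f) v t \<Longrightarrow>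
    eval bar P env (Call f e) v (s + t + 1)"

lemma data_size_pos: "1 \<le> data_size v"
  by (cases v) auto

lemma data_size_hd: "data_size (data_hd v) \<le> data_size v"
  by (cases v) auto

lemma data_size_tl: "data_size (data_tl v) \<le> data_size v"
  by (cases v) auto

lemma data_size_dual: "data_size (data_dual bar v) = 1"
  by (cases v) auto

lemma eval_data_size: "eval bar P env e v t \<Longrightarrow> data_size v \<le> 2 * t"
proof (induction rule: eval.induct)
  case (eval_Hd env e v t)
  then show ?case using data_size_hd[of v] by simp
next
  case (eval_Tl env e v t)
  then show ?case using data_size_tl[of v] by simp
next
  case (eval_Dual env e v t)
  then show ?case using data_size_dual[of bar v] data_size_pos[of v] by auto
next
  case (eval_IsAtom env e v t)
  then show ?case using data_size_pos[of v] by (auto simp: data_bool_def)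
next
  case (eval_IsEq env e u s d v t)
  then show ?case using data_size_pos[of u] data_size_pos[of v] by (auto simp: data_bool_def)
qed auto

lemma eval_deterministic:
  "eval bar P env e v t \<Longrightarrow> eval bar P env e v' t' \<Longrightarrow> v' = v \<and> t' = t"
proof (induction arbitrary: v' t' rule: eval.induct)
  case (eval_Var i env)
  from eval_Var.prems show ?case
    by cases simp_all
next
  case (eval_Nl env)
  from eval_Nl.prems show ?case
    by cases simp_all
next
  case (eval_Cns env e u s d v t)
  from eval_Cns.prems show ?case
    by cases (use eval_Cns.IH eval_Cns.hyps in \<open>blast\<close>)+
next
  case (eval_Hd env e v t)
  from eval_Hd.prems show ?case
    by cases (use eval_Hd.IH eval_Hd.hyps in \<open>blast\<close>)+
next
  case (eval_Tl env e v t)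
  from eval_Tl.prems show ?case
    by cases (use eval_Tl.IH eval_Tl.hyps in \<open>blast\<close>)+
next
  case (eval_Dual env e v t)
  from eval_Dual.prems show ?case
    by cases (use eval_Dual.IH eval_Dual.hyps in \<open>blast\<close>)+
next
  case (eval_IsAtom env e v t)
  from eval_IsAtom.prems show ?case
    by cases (use eval_IsAtom.IH eval_IsAtom.hyps in \<open>blast\<close>)+
next
  case (eval_IsEq env e u s d v t)
  from eval_IsEq.prems show ?case
    by cases (use eval_IsEq.IH eval_IsEq.hyps in \<open>blast\<close>)+
next
  case (eval_If_true env c u s e v t d)
  from eval_If_true.prems show ?case
    by cases (use eval_If_true.IH eval_If_true.hyps in \<open>blast\<close>)+
next
  case (eval_If_false env c s d v t e)
  from eval_If_false.prems show ?case
    by cases (use eval_If_false.IH eval_If_false.hyps in \<open>blast\<close>)+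
next
  case (eval_Let env e u s d v t)
  from eval_Let.prems show ?case
    by cases (use eval_Let.IH eval_Let.hyps in \<open>blast\<close>)+
next
  case (eval_Call f env e u s v t)
  from eval_Call.prems show ?case
    by cases (use eval_Call.IH eval_Call.hyps in \<open>blast\<close>)+
qed

definition computes ::
  "('a \<Rightarrow> 'a) \<Rightarrow> program \<Rightarrow> 'a data \<Rightarrow> 'a data \<Rightarrow> nat \<Rightarrow> bool" where
  "computes bar P u v t \<longleftrightarrow> P \<noteq> [] \<and> eval bar P [u] (hd P) v t"

definition quasipolynomial :: "(nat \<Rightarrow> nat) \<Rightarrow> bool" where
  "quasipolynomial T \<longleftrightarrow>
     (\<exists>k::nat. eventually (\<lambda>n. real (T n) \<le> 2 powr (log 2 (real n) ^ k)) at_top)"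

text \<open>The tree that represents a proof is linear in the size of the proof.\<close>

fun encode_fm :: "'a fm \<Rightarrow> 'a data" where
  "encode_fm FF = DNil"
| "encode_fm TT = DCons DNil DNil"
| "encode_fm (Atom a) = DAtom a"
| "encode_fm (Or A B) = DCons DNil (DCons (encode_fm A) (encode_fm B))"
| "encode_fm (And A B) = DCons (DCons DNil DNil) (DCons (encode_fm A) (encode_fm B))"

fun encode :: "'a fm list \<Rightarrow> 'a data" where
  "encode [] = DNil"
| "encode (A # As) = DCons (encode_fm A) (encode As)"

lemma encode_fm_inject: "encode_fm A = encode_fm B \<Longrightarrow> A = B"
proof (induction A arbitrary: B)
  case FF then show ?case by (cases B) auto
next
  case TT then show ?case by (cases B) auto
next
  case (Atom a) then show ?case by (cases B) auto
next
  case (Or A1 A2) then show ?case by (cases B) auto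
next
  case (And A1 A2) then show ?case by (cases B) auto
qed

lemma encode_inject: "encode As = encode Bs \<Longrightarrow> As = Bs"
proof (induction As arbitrary: Bs)
  case Nil then show ?case by (cases Bs) auto
next
  case (Cons A As) then show ?case by (cases Bs) (auto dest: encode_fm_inject)
qed

lemma encode_fm_size: "data_size (encode_fm A) + 5 \<le> 8 * fm_size A"
  by (induction A) auto

lemma encode_size: "data_size (encode As) \<le> 8 * proof_size As + 1"
proof (induction As)
  case Nil then show ?case by (simp add: proof_size_def)
next
  case (Cons A As)
  then show ?case using encode_fm_size[of A] by (simp add: proof_size_def)
qed

end

theory Submission imports Defs "HOL-Real_Asymp.Real_Asymp" begin

text \<open>
  Orient every pair of dual atoms, so that one atom of the pair is positive and the other negative.
  Let \<open>\<theta> k\<close> be a monotone formula saying that at least \<open>k\<close> of the \<open>n\<close> positive atoms hold, and let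
  \<open>\<tau> k a\<close> be \<open>\<theta> k\<close> with \<open>FF\<close> in place of \<open>a\<close>. If exactly \<open>k\<close> positive atoms hold, then \<open>\<tau> k a\<close> is the
  negation of \<open>a\<close>. So let \<open>\<sigma> k\<close> replace each negative atom \<open>bar a\<close> by \<open>\<tau> k a\<close>. Without cut one derives
  \<open>\<theta> k \<rightarrow> \<tau> k a \<or> a\<close> and \<open>a \<and> \<tau> k a \<rightarrow> \<theta> (k + 1)\<close>, and from the latter, by an identity and a switch,
  \<open>\<tau> k a \<rightarrow> bar a \<or> \<theta> (k + 1)\<close>. The first derivation replaces the identities in the image of a proof of
  \<open>\<alpha>\<close> under \<open>\<sigma> k\<close>, the second one its cuts, and the third one leads from \<open>\<sigma> k\<close> of \<open>\<alpha>\<close> back to \<open>\<alpha>\<close>. The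
  result is a cut-free derivation of \<open>\<alpha> \<or> \<theta> (k + 1)\<close> from \<open>\<theta> k\<close>. These derivations compose for
  \<open>k = 0, \<dots>, n\<close> to a cut-free proof of \<open>\<alpha>\<close>, since \<open>\<theta> 0\<close> equals \<open>TT\<close> and \<open>FF\<close> is derivable from \<open>\<theta> (n + 1)\<close>.

  Divide and conquer along a balanced tree makes \<open>\<theta> k\<close> a formula of size \<open>n\<close> to the power \<open>O(log n)\<close>,
  and all the derivations are polynomial in the size of these formulae.
\<close>

section \<open>Derivations\<close>

text \<open>A step from \<open>C\<close> to \<open>D\<close> is simulated by a derivation from
  \<open>lhs k C\<close>, which is \<open>\<theta> k\<close> and the image of \<open>C\<close>, to
  \<open>rhs k D\<close>, which is the image of \<open>D\<close> or \<open>\<theta> (k + 1)\<close>.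
  An identity consumes the \<open>\<theta> k\<close>, a cut leaves the
  \<open>\<theta> (k + 1)\<close> behind, and every other step discards the one and weakens in the
  other. Since each line may need \<open>\<theta> k\<close>, it is cocontracted before every step,
  and the copies of \<open>\<theta> (k + 1)\<close> are contracted at once, so the cost of a level
  is additive in the number of lines. Atoms are counted with multiplicity: the tree has a leaf for
  every occurrence of a positive atom, which does not affect the derivations of the overview. The
  main obstacle is the running time: an explicit program has to produce the proof. A number
  \<open>Z\<close>, fixed in advance, bounds all derivations; hence \<open>W\<close> bounds all
  values, and only function calls have to be counted. They are charged to the size bound
  \<open>s\<close> of the computed derivation, at most \<open>20 * Z\<close> calls per unit of
  \<open>s\<close>, so that a single induction shows correctness, size and time together.\<close>

abbreviation mk :: "bool \<Rightarrow> 'a fm \<Rightarrow> 'a fm \<Rightarrow> 'a fm" where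
  "mk c A B \<equiv> (if c then And A B else Or A B)"

text \<open>
  The classes of \<open>feq\<close>, with operations on arbitrary sets so that associativity and commutativity
  hold unconditionally: this turns instances of the equality rule into goals for the simplifier.
\<close>

definition feq_class :: "'a fm \<Rightarrow> 'a fm set" where
  "feq_class A = {B. feq A B}"

definition class_op :: "bool \<Rightarrow> 'a fm set \<Rightarrow> 'a fm set \<Rightarrow> 'a fm set" where
  "class_op c X Y = {C. \<exists>A\<in>X. \<exists>B\<in>Y. feq (mk c A B) C}"

lemma feq_iff_class: "feq A B \<longleftrightarrow> feq_class A = feq_class B"
  unfolding feq_class_def by (auto intro: feq_refl feq_sym feq_trans)

lemma feq_mk: "feq A A' \<Longrightarrow> feq B B' \<Longrightarrow> feq (mk c A B) (mk c A' B')"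
proof -
  assume "feq A A'" "feq B B'"
  then have "feq (mk c A B) (mk c A' B)" "feq (mk c A' B) (mk c A' B')"
    using feq_ctx[of A A' "OrL Hole B"] feq_ctx[of A A' "AndL Hole B"]
      feq_ctx[of B B' "OrR A' Hole"] feq_ctx[of B B' "AndR A' Hole"] by auto
  then show ?thesis by (rule feq_trans)
qed

lemma mk_comm: "feq (mk c A B) (mk c B A)"
  by (simp add: or_comm and_comm)

lemma mk_assoc: "feq (mk c (mk c A B) C) (mk c A (mk c B C))"
  by (simp add: or_assoc and_assoc)

lemma class_mk: "feq_class (mk c A B) = class_op c (feq_class A) (feq_class B)"
  unfolding feq_class_def class_op_def
  by (blast intro: feq_refl feq_trans[OF feq_mk])

lemma class_Or [simp]: "feq_class (Or A B) = class_op False (feq_class A) (feq_class B)"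
  using class_mk[of False A B] by simp

lemma class_And [simp]: "feq_class (And A B) = class_op True (feq_class A) (feq_class B)"
  using class_mk[of True A B] by simp

lemma class_op_comm: "class_op c X Y = class_op c Y X"
  unfolding class_op_def using mk_comm by (metis (no_types, opaque_lifting) feq_trans)

lemma class_op_assoc: "class_op c (class_op c X Y) Z = class_op c X (class_op c Y Z)"
proof (intro equalityI subsetI)
  fix D assume "D \<in> class_op c (class_op c X Y) Z"
  then obtain A B C E where *: "A \<in> X" "B \<in> Y" "C \<in> Z" "feq (mk c A B) E" "feq (mk c E C) D"
    unfolding class_op_def by blast
  then have "feq (mk c (mk c A B) C) D"
    by (metis feq_mk feq_refl feq_trans)
  then have "feq (mk c A (mk c B C)) D"
    by (metis mk_assoc feq_sym feq_trans)
  with * show "D \<in> class_op c X (class_op c Y Z)"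
    unfolding class_op_def using feq_refl by blast
next
  fix D assume "D \<in> class_op c X (class_op c Y Z)"
  then obtain A B C E where *: "A \<in> X" "B \<in> Y" "C \<in> Z" "feq (mk c B C) E" "feq (mk c A E) D"
    unfolding class_op_def by blast
  then have "feq (mk c A (mk c B C)) D"
    by (metis feq_mk feq_refl feq_trans)
  then have "feq (mk c (mk c A B) C) D"
    by (metis mk_assoc feq_trans)
  with * show "D \<in> class_op c (class_op c X Y) Z"
    unfolding class_op_def using feq_refl by blast
qed

lemma class_op_left_comm: "class_op c X (class_op c Y Z) = class_op c Y (class_op c X Z)"
  by (metis class_op_assoc class_op_comm)

lemma class_units:
  "class_op False (feq_class A) (feq_class FF) = feq_class A"
  "class_op False (feq_class FF) (feq_class A) = feq_class A"
  "class_op True (feq_class A) (feq_class TT) = feq_class A"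
  "class_op True (feq_class TT) (feq_class A) = feq_class A"
  "class_op False (feq_class TT) (feq_class TT) = feq_class TT"
  "class_op True (feq_class FF) (feq_class FF) = feq_class FF"
  using or_unit and_unit or_TT and_FF class_op_comm
  by (metis feq_iff_class class_Or class_And)+

text \<open>\<open>class_units\<close> applies only to terms \<open>feq_class A\<close>. Once
  \<open>class_Or\<close> and \<open>class_And\<close> have rewritten a compound argument, it has
  the form \<open>class_op c X Y\<close>; there the unit laws hold for arbitrary sets, because
  \<open>class_op\<close> produces sets closed under \<open>feq\<close>.\<close>

lemma class_op_units [simp]:
  "class_op False (class_op c X Y) (feq_class FF) = class_op c X Y"
  "class_op False (feq_class FF) (class_op c X Y) = class_op c X Y"
  "class_op True (class_op c X Y) (feq_class TT) = class_op c X Y"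
  "class_op True (feq_class TT) (class_op c X Y) = class_op c X Y"
proof -
  have closed: "C \<in> class_op c X Y \<Longrightarrow> feq C D \<Longrightarrow> D \<in> class_op c X Y" for C D
    unfolding class_op_def by (blast intro: feq_trans)
  have 1: "class_op False (class_op c X Y) (feq_class FF) = class_op c X Y"
  proof (intro equalityI subsetI)
    fix D assume "D \<in> class_op False (class_op c X Y) (feq_class FF)"
    then obtain C U where "C \<in> class_op c X Y" "feq FF U" "feq (Or C U) D"
      unfolding class_op_def feq_class_def by auto
    then show "D \<in> class_op c X Y"
      using closed by (metis feq_mk[of C C FF U False] feq_refl feq_sym feq_trans or_unit)
  next
    fix D assume "D \<in> class_op c X Y"
    then show "D \<in> class_op False (class_op c X Y) (feq_class FF)"
      unfolding class_op_def[of False] feq_class_def using or_unit feq_refl by fastforce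
  qed
  have 2: "class_op True (class_op c X Y) (feq_class TT) = class_op c X Y"
  proof (intro equalityI subsetI)
    fix D assume "D \<in> class_op True (class_op c X Y) (feq_class TT)"
    then obtain C U where "C \<in> class_op c X Y" "feq TT U" "feq (And C U) D"
      unfolding class_op_def feq_class_def by auto
    then show "D \<in> class_op c X Y"
      using closed by (metis feq_mk[of C C TT U True] feq_refl feq_sym feq_trans and_unit)
  next
    fix D assume "D \<in> class_op c X Y"
    then show "D \<in> class_op True (class_op c X Y) (feq_class TT)"
      unfolding class_op_def[of True] feq_class_def using and_unit feq_refl by fastforce
  qed
  show "class_op False (class_op c X Y) (feq_class FF) = class_op c X Y"
    "class_op False (feq_class FF) (class_op c X Y) = class_op c X Y"
    "class_op True (class_op c X Y) (feq_class TT) = class_op c X Y"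
    "class_op True (feq_class TT) (class_op c X Y) = class_op c X Y"
    using 1 2 class_op_comm by metis+
qed

lemmas feq_simps = feq_iff_class class_units class_op_comm class_op_assoc class_op_left_comm

lemma fm_size_pos: "1 \<le> fm_size A"
  by (induction A) auto

section \<open>Cut-free derivations and their sequential and parallel composition\<close>

locale cut_free =
  fixes bar :: "'a \<Rightarrow> 'a"
  assumes bar_bar [simp]: "bar (bar a) = a"
begin

definition step :: "'a fm \<Rightarrow> 'a fm \<Rightarrow> bool" where
  "step = inference_step bar (SKS - {AiUp})"

lemma stepI: "rule_instance bar r C D \<Longrightarrow> r \<noteq> AiUp \<Longrightarrow> step (fill X C) (fill X D)"
  unfolding step_def inference_step_def SKS_def by auto

lemma step_rule: "rule_instance bar r C D \<Longrightarrow> r \<noteq> AiUp \<Longrightarrow> step C D"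
  using stepI[of r C D Hole] by simp

lemma step_feq: "feq A B \<Longrightarrow> step A B"
  by (auto intro: step_rule equality)

lemma step_refl: "step A A"
  by (intro step_feq feq_refl)

lemma step_mkL: "step A B \<Longrightarrow> step (mk c A Z) (mk c B Z)"
  unfolding step_def inference_step_def
  by (metis fill.simps(2) fill.simps(4))

lemma step_mkR: "step A B \<Longrightarrow> step (mk c Z A) (mk c Z B)"
  unfolding step_def inference_step_def
  by (metis fill.simps(3) fill.simps(5))

lemma step_ctx [intro]:
  "step A B \<Longrightarrow> step (Or A Z) (Or B Z)" "step A B \<Longrightarrow> step (Or Z A) (Or Z B)"
  "step A B \<Longrightarrow> step (And A Z) (And B Z)" "step A B \<Longrightarrow> step (And Z A) (And Z B)"
  using step_mkL[of A B False] step_mkR[of A B False] step_mkL[of A B True] step_mkR[of A B True]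
  by auto

lemma step_rules [intro]:
  "step TT (Or (Atom a) (Atom (bar a)))"
  "step FF (Atom a)"
  "step (Or (Atom a) (Atom a)) (Atom a)"
  "step (Atom a) TT"
  "step (Atom a) (And (Atom a) (Atom a))"
  "step (And A (Or B C)) (Or (And A B) C)"
  "step (Or (And A B) (And C D)) (And (Or A C) (Or B D))"
  by (auto intro: rule_instance.intros step_rule)

text \<open>
  A single number bounds both the length of a derivation and the sizes of its lines: it is
  additive under \<open>@\<close> as well as under \<open>par\<close>.
\<close>

definition der :: "nat \<Rightarrow> 'a fm list \<Rightarrow> 'a fm \<Rightarrow> 'a fm \<Rightarrow> bool" where
  "der s d A B \<longleftrightarrow> d \<noteq> [] \<and> hd d = A \<and> last d = B \<and> successively step d \<and>
     length d \<le> s \<and> (\<forall>x\<in>set d. fm_size x \<le> s)"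

lemma der_single: "fm_size A \<le> s \<Longrightarrow> der s [A] A A"
  using fm_size_pos[of A] by (auto simp: der_def)

lemma der_Cons: "der s d B C \<Longrightarrow> step A B \<Longrightarrow> der (fm_size A + s) (A # d) A C"
  using fm_size_pos[of A] by (cases d) (force simp: der_def)+

lemma der_append: "der s d A B \<Longrightarrow> der r e C D \<Longrightarrow> step B C \<Longrightarrow> der (s + r) (d @ e) A D"
  unfolding der_def successively_append_iff by force

lemma der_mono: "der s d A B \<Longrightarrow> s \<le> r \<Longrightarrow> der r d A B"
  by (force simp: der_def)

lemma der_sizes: assumes "der s d A B" shows "fm_size A \<le> s" "fm_size B \<le> s"
  using assms by (auto simp: der_def)

end

text \<open>Two derivations side by side, made sequential: \<open>d\<close> runs beside the premiss
  of \<open>e\<close>, then \<open>e\<close> runs beside the conclusion of \<open>d\<close>. They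
  share the line where they meet. An empty \<open>d\<close> is no derivation and has no conclusion,
  hence \<open>undefined\<close>.\<close>

fun par :: "bool \<Rightarrow> 'a fm list \<Rightarrow> 'a fm list \<Rightarrow> 'a fm list" where
  "par c [] e = map (mk c undefined) e"
| "par c [x] e = map (mk c x) e"
| "par c (x # y # d) e = mk c x (hd e) # par c (y # d) e"

context cut_free
begin

lemma successively_map_mk: "successively step e \<Longrightarrow> successively step (map (mk c x) e)"
  unfolding successively_map by (erule successively_mono) (rule step_mkR)

lemma hd_par: "d \<noteq> [] \<Longrightarrow> e \<noteq> [] \<Longrightarrow> hd (par c d e) = mk c (hd d) (hd e)"
  by (induction c d e rule: par.induct) (auto simp: hd_map)

lemma par_nonempty: "d \<noteq> [] \<Longrightarrow> e \<noteq> [] \<Longrightarrow> par c d e \<noteq> []"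
  by (induction c d e rule: par.induct) auto

lemma successively_par:
  "d \<noteq> [] \<Longrightarrow> e \<noteq> [] \<Longrightarrow> successively step d \<Longrightarrow> successively step e \<Longrightarrow>
    successively step (par c d e)"
proof (induction c d e rule: par.induct)
  case (3 c x y d e)
  have "successively step (par c (y # d) e)"
    using 3 by (simp add: successively_Cons)
  moreover have "step (mk c x (hd e)) (hd (par c (y # d) e))"
    using hd_par[of "y # d" e c] 3 step_mkL[of x y c "hd e"] by (auto simp: successively_Cons)
  ultimately show ?case using par_nonempty[of "y # d" e c] 3
    by (simp add: successively_Cons del: par.simps(3)) (simp add: successively_Cons)
qed (auto simp: successively_map_mk)

lemma der_par:
  assumes d: "der s d A B" and e: "der r e C D"
  shows "der (s + r) (par c d e) (mk c A C) (mk c B D)"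
proof -
  have ne: "d \<noteq> []" "e \<noteq> []" using d e by (auto simp: der_def)
  have 1: "last (par c d e) = mk c (last d) (last e)"
    using ne by (induction c d e rule: par.induct) (auto simp: last_map par_nonempty split: if_splits)
  have 2: "successively step (par c d e)"
    using ne successively_par d e by (auto simp: der_def)
  have 3: "length (par c d e) + 1 = length d + length e"
    using ne by (induction c d e rule: par.induct) auto
  have 4: "\<forall>x\<in>set (par c d e). fm_size x \<le> s + r"
  proof
    fix z assume "z \<in> set (par c d e)"
    then have "\<exists>x\<in>set d. \<exists>y\<in>set e. z = mk c x y"
      using ne by (induction c d e rule: par.induct) (auto split: if_splits)
    then show "fm_size z \<le> s + r" using d e by (force simp: der_def intro: add_mono)
  qed
  show ?thesis using 1 2 3 4 ne hd_par[OF ne] par_nonempty[OF ne] d e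
    by (auto simp: der_def)
qed

end

section \<open>Threshold formulae\<close>

fun subst :: "('a \<Rightarrow> 'a fm) \<Rightarrow> 'a fm \<Rightarrow> 'a fm" where
  "subst f FF = FF"
| "subst f TT = TT"
| "subst f (Atom a) = f a"
| "subst f (Or A B) = Or (subst f A) (subst f B)"
| "subst f (And A B) = And (subst f A) (subst f B)"

lemma subst_Atom [simp]: "subst Atom A = A"
  by (induction A) auto

fun subst_ctx :: "('a \<Rightarrow> 'a fm) \<Rightarrow> 'a ctx \<Rightarrow> 'a ctx" where
  "subst_ctx f Hole = Hole"
| "subst_ctx f (OrL X B) = OrL (subst_ctx f X) (subst f B)"
| "subst_ctx f (OrR B X) = OrR (subst f B) (subst_ctx f X)"
| "subst_ctx f (AndL X B) = AndL (subst_ctx f X) (subst f B)"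
| "subst_ctx f (AndR B X) = AndR (subst f B) (subst_ctx f X)"

lemma subst_fill: "subst f (fill X A) = fill (subst_ctx f X) (subst f A)"
  by (induction X) auto

lemma feq_subst: "feq A B \<Longrightarrow> feq (subst f A) (subst f B)"
  by (induction rule: feq.induct) (auto simp: subst_fill intro: feq.intros)

lemma fill_inject: "fill X A = fill X B \<Longrightarrow> A = B"
  by (induction X) auto

fun truth :: "'a fm \<Rightarrow> bool" where
  "truth FF = False"
| "truth TT = True"
| "truth (Atom a) = False"
| "truth (Or A B) = (truth A \<or> truth B)"
| "truth (And A B) = (truth A \<and> truth B)"

abbreviation all_true :: "'a fm \<Rightarrow> 'a fm" where
  "all_true \<equiv> subst (\<lambda>_. TT)"

lemma class_op_TT_FF [simp]:
  "class_op False (feq_class TT) (feq_class FF) = feq_class TT"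
  "class_op False (feq_class FF) (feq_class TT) = feq_class TT"
  "class_op True (feq_class TT) (feq_class FF) = feq_class FF"
  "class_op True (feq_class FF) (feq_class TT) = feq_class FF"
  by (simp_all only: class_units)

text \<open>On formulae without atoms the equations for the units are exactly the two-valued truth
  tables.\<close>

lemma feq_truth: "feq (all_true A) (if truth (all_true A) then TT else FF)"
  by (induction A) (auto simp: feq_iff_class class_units split: if_splits)

section \<open>Balanced trees of atoms and threshold formulae over them\<close>

datatype 'a tree = Leaf "'a option" | Node "'a tree" "'a tree"

fun leaf_fm :: "'a option \<Rightarrow> 'a fm" where
  "leaf_fm None = FF"
| "leaf_fm (Some a) = Atom a"

fun atoms :: "'a tree \<Rightarrow> 'a set" where
  "atoms (Leaf u) = set_option u"
| "atoms (Node l r) = atoms l \<union> atoms r"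

fun leaves :: "'a tree \<Rightarrow> nat" where
  "leaves (Leaf u) = 1"
| "leaves (Node l r) = leaves l + leaves r"

fun atom_leaves :: "'a tree \<Rightarrow> nat" where
  "atom_leaves (Leaf u) = (if u = None then 0 else 1)"
| "atom_leaves (Node l r) = atom_leaves l + atom_leaves r"

fun height :: "'a tree \<Rightarrow> nat" where
  "height (Leaf u) = 0"
| "height (Node l r) = Suc (max (height l) (height r))"

fun delete :: "'a \<Rightarrow> 'a tree \<Rightarrow> 'a tree" where
  "delete a (Leaf u) = Leaf (if u = Some a then None else u)"
| "delete a (Node l r) = Node (delete a l) (delete a r)"

text \<open>Insertion as in Braun trees: the right subtree grows and becomes the left one. So the
  left subtree always has zero or one leaf more than the right one, with no sizes stored and no
  rotations.\<close>

fun insert_leaf :: "'a \<Rightarrow> 'a tree \<Rightarrow> 'a tree" where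
  "insert_leaf a (Leaf u) = Node (Leaf u) (Leaf (Some a))"
| "insert_leaf a (Node l r) = Node (insert_leaf a r) l"

fun balanced :: "'a tree \<Rightarrow> bool" where
  "balanced (Leaf u) = True"
| "balanced (Node l r) =
    ((leaves l = leaves r \<or> leaves l = leaves r + 1) \<and> balanced l \<and> balanced r)"

lemma leaves_pos: "1 \<le> leaves T"
  by (induction T) auto

lemma leaves_insert [simp]: "leaves (insert_leaf a T) = Suc (leaves T)"
  by (induction T) auto

lemma atom_leaves_insert [simp]: "atom_leaves (insert_leaf a T) = Suc (atom_leaves T)"
  by (induction T) auto

lemma atoms_insert [simp]: "atoms (insert_leaf a T) = insert a (atoms T)"
  by (induction T) auto

lemma balanced_insert: "balanced T \<Longrightarrow> balanced (insert_leaf a T)"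
  by (induction T) auto

text \<open>The square absorbs the uneven splits. Twice the binary logarithm of the number of leaves
  then bounds the height, and this is where the logarithm in the exponent of the final bound comes
  from.\<close>

lemma balanced_height: "balanced T \<Longrightarrow> 2 ^ height T \<le> leaves T ^ 2"
proof (induction T)
  case (Node l r)
  have l: "2 ^ height l \<le> leaves l ^ 2" and r: "2 ^ height r \<le> leaves r ^ 2"
    and lr: "leaves r \<le> leaves l" "leaves l \<le> leaves r + 1" using Node by auto
  have "2 ^ height r \<le> leaves l ^ 2"
    using r lr(1) power_mono[of "leaves r" "leaves l" 2] by linarith
  then have "2 ^ height (Node l r) \<le> 2 * leaves l ^ 2"
    using l by (auto simp: max_def)
  also have "\<dots> \<le> (leaves l + leaves r) ^ 2"
  proof (cases "leaves l = 1")
    case True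
    then show ?thesis using leaves_pos[of r] lr by (simp add: power2_eq_square)
  next
    case False
    \<comment> \<open>The right subtree has at least \<open>n + 1\<close> leaves, so the total is at
      least \<open>2 * n + 3\<close>.\<close>
    then obtain n where n: "leaves l = n + 2"
      using leaves_pos[of l] by (metis add.commute le_Suc_ex One_nat_def Suc_1 le_antisym not_less_eq_eq)
    then have "(2 * n + 3) ^ 2 \<le> (leaves l + leaves r) ^ 2"
      using lr by (intro power_mono) auto
    moreover have "2 * leaves l ^ 2 \<le> (2 * n + 3) ^ 2"
      by (simp add: n power2_eq_square algebra_simps)
    ultimately show ?thesis by linarith
  qed
  finally show ?case by simp
qed simp

text \<open>The disjunction over \<open>n \<le> j\<close> of the conjunctions of
  \<open>f (i + n)\<close> and \<open>g (j - n)\<close>, a convolution of \<open>f\<close> and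
  \<open>g\<close>. The separate start \<open>i\<close> makes a shift of \<open>f\<close>
  expressible, and the final \<open>FF\<close> gives both equations the same shape: one summand and
  a rest.\<close>

fun conv :: "(nat \<Rightarrow> 'a fm) \<Rightarrow> (nat \<Rightarrow> 'a fm) \<Rightarrow> nat \<Rightarrow> nat \<Rightarrow> 'a fm" where
  "conv f g i 0 = Or (And (f i) (g 0)) FF"
| "conv f g i (Suc j) = Or (And (f i) (g (Suc j))) (conv f g (Suc i) j)"

fun threshold :: "'a tree \<Rightarrow> nat \<Rightarrow> 'a fm" where
  "threshold (Leaf u) k = (if k = 0 then TT else if k = 1 then leaf_fm u else FF)"
| "threshold (Node l r) k = conv (threshold l) (threshold r) 0 k"

text \<open>The equations of \<open>conv\<close> split off the summand with the least index of
  \<open>f\<close>. Commutativity needs the mirror image, which splits off the other end.\<close>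

lemma conv_last:
  "feq (conv f g i (Suc j)) (Or (And (f (Suc (i + j))) (g 0)) (conv f (\<lambda>n. g (Suc n)) i j))"
proof (induction j arbitrary: i)
  case 0
  then show ?case by (simp add: feq_simps)
next
  case (Suc j)
  have "feq (conv f g i (Suc (Suc j))) (Or (And (f i) (g (Suc (Suc j)))) (Or (And (f (Suc (i + Suc j))) (g 0)) (conv f (\<lambda>n. g (Suc n)) (Suc i) j)))"
    using Suc[of "Suc i"] feq_mk[of "And (f i) (g (Suc (Suc j)))" _ "conv f g (Suc i) (Suc j)" _ False]
    by (simp add: feq_refl)
  then show ?case
    by (simp add: feq_iff_class class_op_left_comm class_op_assoc)
qed

lemma conv_shift: "conv f g (Suc i) j = conv (\<lambda>n. f (Suc n)) g i j"
  by (induction j arbitrary: i) auto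

lemma conv_comm: "feq (conv f g 0 k) (conv g f 0 k)"
proof (induction k arbitrary: f g)
  case 0
  then show ?case by (simp add: feq_iff_class class_op_comm)
next
  case (Suc k)
  have "feq (conv g f 0 (Suc k)) (Or (And (g (Suc k)) (f 0)) (conv g (\<lambda>n. f (Suc n)) 0 k))"
    using conv_last[of g f 0 k] by simp
  moreover have "conv f g 0 (Suc k) = Or (And (f 0) (g (Suc k))) (conv (\<lambda>n. f (Suc n)) g 0 k)"
    by (simp add: conv_shift)
  moreover have "feq (conv (\<lambda>n. f (Suc n)) g 0 k) (conv g (\<lambda>n. f (Suc n)) 0 k)"
    by (rule Suc)
  ultimately show ?case
    by (simp add: feq_iff_class class_op_comm[of True])
qed

lemma threshold_swap: "feq (threshold (Node l r) k) (threshold (Node r l) k)"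
  by (simp add: conv_comm)

lemma threshold_0: "feq (threshold T 0) TT"
  by (induction T) (auto simp: feq_iff_class class_units)

lemma truth_conv:
  "truth (all_true (conv f g i j)) \<longleftrightarrow>
    (\<exists>n\<le>j. truth (all_true (f (i + n))) \<and> truth (all_true (g (j - n))))"
proof (induction j arbitrary: i)
  case (Suc j)
  show ?case (is "_ = ?R")
  proof -
    have "?R \<longleftrightarrow> (truth (all_true (f i)) \<and> truth (all_true (g (Suc j)))) \<or>
       (\<exists>n\<le>j. truth (all_true (f (i + Suc n))) \<and> truth (all_true (g (Suc j - Suc n))))"
      by (metis (no_types, lifting) Suc_le_mono add_0_right diff_zero le0 not0_implies_Suc)
    then show ?thesis using Suc[of "Suc i"] by simp
  qed
qed simp

text \<open>Replacing all atoms by \<open>TT\<close> leaves only the number of atom leaves to count.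
  A threshold above this number thereby becomes equal to \<open>FF\<close>, which disposes of the
  formula left over after the last level.\<close>

lemma truth_threshold: "truth (all_true (threshold T k)) \<longleftrightarrow> k \<le> atom_leaves T"
proof (induction T arbitrary: k)
  case (Leaf u)
  then show ?case by (cases u) auto
next
  case (Node l r)
  have "(\<exists>n\<le>k. n \<le> atom_leaves l \<and> k - n \<le> atom_leaves r) \<longleftrightarrow> k \<le> atom_leaves l + atom_leaves r"
    by (auto intro: exI[of _ "min k (atom_leaves l)"])
  then show ?case using Node by (simp add: truth_conv)
qed

section \<open>Counting function calls\<close>

text \<open>Relative to a bound on the values in the environment, \<open>out_factor\<close> bounds
  the size of the result and \<open>time_factor\<close> the time spent outside of calls. A call has
  factor 1, since its result is bounded by \<open>W\<close> anyway; \<open>Let\<close> multiplies,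
  since its body sees a value that may exceed the old bound.\<close>

fun out_factor :: "exp \<Rightarrow> nat" where
  "out_factor (Var i) = 1"
| "out_factor Nl = 1"
| "out_factor (Cns e d) = out_factor e + out_factor d + 1"
| "out_factor (Hd e) = out_factor e"
| "out_factor (Tl e) = out_factor e"
| "out_factor (Dual e) = 1"
| "out_factor (IsAtom e) = 3"
| "out_factor (IsEq e d) = 3"
| "out_factor (If c e d) = out_factor e + out_factor d"
| "out_factor (Let e d) = out_factor e * out_factor d"
| "out_factor (Call f e) = 1"

fun time_factor :: "exp \<Rightarrow> nat" where
  "time_factor (Var i) = 1"
| "time_factor Nl = 1"
| "time_factor (Cns e d) = time_factor e + time_factor d + 1"
| "time_factor (Hd e) = time_factor e + 1"
| "time_factor (Tl e) = time_factor e + 1"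
| "time_factor (Dual e) = time_factor e + 1"
| "time_factor (IsAtom e) = time_factor e + 1"
| "time_factor (IsEq e d) = time_factor e + time_factor d + 1"
| "time_factor (If c e d) = time_factor c + time_factor e + time_factor d + 1"
| "time_factor (Let e d) = time_factor e + out_factor e * time_factor d + 1"
| "time_factor (Call f e) = time_factor e + 1"

lemma out_factor_pos: "1 \<le> out_factor e"
  by (induction e) auto

definition time_unit :: "program \<Rightarrow> nat" where
  "time_unit P = (\<Sum>e\<leftarrow>P. time_factor e)"

lemma time_factor_le_unit: "f < length P \<Longrightarrow> time_factor (P ! f) \<le> time_unit P"
  unfolding time_unit_def by (intro member_le_sum_list) simp_all

locale execution =
  fixes bar :: "'a \<Rightarrow> 'a" and P :: program and W :: nat
begin

text \<open>
  If \<open>W\<close> bounds the arguments and results of all calls, then a call takes time \<open>O(W)\<close> by itself. So \<open>n\<close>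
  bounds the number of function calls, and the time is \<open>n\<close> times the time of a single call.
\<close>

definition calls :: "nat \<Rightarrow> 'a data \<Rightarrow> 'a data \<Rightarrow> nat \<Rightarrow> bool" where
  "calls f u v n \<longleftrightarrow> f < length P \<and> data_size u \<le> W \<and> data_size v \<le> W \<and>
     (\<exists>t \<le> n * (time_unit P * W). eval bar P [u] (P ! f) v t)"

definition halts :: "nat \<Rightarrow> 'a data \<Rightarrow> bool" where
  "halts f u \<longleftrightarrow> (\<exists>v n. calls f u v n)"

text \<open>Choosing a result and a least count turns the evaluation relation into functions. Thus
  \<open>ev\<close>, \<open>ok\<close> and \<open>cost\<close> are recursive, and the simplifier can
  execute a body symbolically once its calls are known.\<close>

definition result :: "nat \<Rightarrow> 'a data \<Rightarrow> 'a data" where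
  "result f u = (SOME v. \<exists>n. calls f u v n)"

definition count :: "nat \<Rightarrow> 'a data \<Rightarrow> nat" where
  "count f u = (LEAST n. calls f u (result f u) n)"

lemma calls_mono: "calls f u v n \<Longrightarrow> n \<le> m \<Longrightarrow> calls f u v m"
  unfolding calls_def by (meson le_trans mult_le_mono1)

lemma calls_unique: "calls f u v n \<Longrightarrow> calls f u v' m \<Longrightarrow> v = v'"
  unfolding calls_def by (meson eval_deterministic)

lemma calls_result: "halts f u \<Longrightarrow> calls f u (result f u) (count f u)"
proof -
  assume "halts f u"
  then have "\<exists>n. calls f u (result f u) n"
    unfolding halts_def result_def by (rule someI_ex)
  then show ?thesis unfolding count_def by (rule LeastI_ex)
qed

lemma callsD: 
  assumes "calls f u v n" shows "halts f u" "result f u = v" "count f u \<le> n"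
proof -
  show h: "halts f u" using assms unfolding halts_def by blast
  show r: "result f u = v" using calls_result[OF h] calls_unique assms by blast
  show "count f u \<le> n" unfolding count_def r by (rule Least_le) (rule assms)
qed

fun ev :: "'a data list \<Rightarrow> exp \<Rightarrow> 'a data" where
  "ev env (Var i) = env ! i"
| "ev env Nl = DNil"
| "ev env (Cns e d) = DCons (ev env e) (ev env d)"
| "ev env (Hd e) = data_hd (ev env e)"
| "ev env (Tl e) = data_tl (ev env e)"
| "ev env (Dual e) = data_dual bar (ev env e)"
| "ev env (IsAtom e) = data_bool (is_DAtom (ev env e))"
| "ev env (IsEq e d) = data_bool (ev env e = ev env d)"
| "ev env (If c e d) = (if ev env c \<noteq> DNil then ev env e else ev env d)"
| "ev env (Let e d) = ev (ev env e # env) d"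
| "ev env (Call f e) = result f (ev env e)"

fun ok :: "'a data list \<Rightarrow> exp \<Rightarrow> bool" where
  "ok env (Var i) = (i < length env)"
| "ok env Nl = True"
| "ok env (Cns e d) = (ok env e \<and> ok env d)"
| "ok env (Hd e) = ok env e"
| "ok env (Tl e) = ok env e"
| "ok env (Dual e) = ok env e"
| "ok env (IsAtom e) = ok env e"
| "ok env (IsEq e d) = (ok env e \<and> ok env d)"
| "ok env (If c e d) = (ok env c \<and> (if ev env c \<noteq> DNil then ok env e else ok env d))"
| "ok env (Let e d) = (ok env e \<and> ok (ev env e # env) d)"
| "ok env (Call f e) = (ok env e \<and> halts f (ev env e))"

fun cost :: "'a data list \<Rightarrow> exp \<Rightarrow> nat" where
  "cost env (Var i) = 0"
| "cost env Nl = 0"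
| "cost env (Cns e d) = cost env e + cost env d"
| "cost env (Hd e) = cost env e"
| "cost env (Tl e) = cost env e"
| "cost env (Dual e) = cost env e"
| "cost env (IsAtom e) = cost env e"
| "cost env (IsEq e d) = cost env e + cost env d"
| "cost env (If c e d) = cost env c + (if ev env c \<noteq> DNil then cost env e else cost env d)"
| "cost env (Let e d) = cost env e + cost (ev env e # env) d"
| "cost env (Call f e) = cost env e + count f (ev env e)"

text \<open>The bound \<open>B\<close> has to vary in the induction: below a \<open>Let\<close> it
  grows by the factor \<open>out_factor e\<close>. Only the time inside calls is independent of
  \<open>B\<close>, being measured in units of \<open>time_unit P * W\<close>.\<close>

lemma ok_eval:
  assumes "ok env e" and "\<forall>u\<in>set env. data_size u \<le> B" and "W \<le> B" and "1 \<le> B"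
  shows "data_size (ev env e) \<le> out_factor e * B \<and>
    (\<exists>t \<le> time_factor e * B + cost env e * (time_unit P * W). eval bar P env e (ev env e) t)"
  using assms
proof (induction e arbitrary: env B)
  case (Var i)
  then have "data_size (env ! i) \<le> B" by simp
  then show ?case using eval_Var[of i env bar P] Var.prems by auto
next
  case Nl
  then show ?case using eval_Nl by fastforce
next
  case (Cns e d)
  obtain s t where *: "s \<le> time_factor e * B + cost env e * (time_unit P * W)" "eval bar P env e (ev env e) s"
    "t \<le> time_factor d * B + cost env d * (time_unit P * W)" "eval bar P env d (ev env d) t"
    using Cns by fastforce
  have "eval bar P env (Cns e d) (ev env (Cns e d)) (s + t + 1)"
    using eval_Cns[OF *(2,4)] by simp
  moreover have "s + t + 1 \<le> time_factor (Cns e d) * B + cost env (Cns e d) * (time_unit P * W)"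
    using * Cns.prems by (simp add: algebra_simps)
  moreover have "data_size (ev env (Cns e d)) \<le> out_factor (Cns e d) * B"
    using Cns.IH(1)[of env B] Cns.IH(2)[of env B] Cns.prems by (simp add: algebra_simps)
  ultimately show ?case by blast
next
  case (Hd e)
  obtain s where *: "s \<le> time_factor e * B + cost env e * (time_unit P * W)" "eval bar P env e (ev env e) s"
    using Hd by fastforce
  have "eval bar P env (Hd e) (ev env (Hd e)) (s + 1)"
    using eval_Hd[OF *(2)] by simp
  moreover have "s + 1 \<le> time_factor (Hd e) * B + cost env (Hd e) * (time_unit P * W)"
    using * Hd.prems by (simp add: algebra_simps)
  moreover have "data_size (ev env (Hd e)) \<le> out_factor (Hd e) * B"
    using Hd.IH[of env B] Hd.prems data_size_hd[of "ev env e"] by simp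
  ultimately show ?case by blast
next
  case (Tl e)
  obtain s where *: "s \<le> time_factor e * B + cost env e * (time_unit P * W)" "eval bar P env e (ev env e) s"
    using Tl by fastforce
  have "eval bar P env (Tl e) (ev env (Tl e)) (s + 1)"
    using eval_Tl[OF *(2)] by simp
  moreover have "s + 1 \<le> time_factor (Tl e) * B + cost env (Tl e) * (time_unit P * W)"
    using * Tl.prems by (simp add: algebra_simps)
  moreover have "data_size (ev env (Tl e)) \<le> out_factor (Tl e) * B"
    using Tl.IH[of env B] Tl.prems data_size_tl[of "ev env e"] by simp
  ultimately show ?case by blast
next
  case (Dual e)
  obtain s where *: "s \<le> time_factor e * B + cost env e * (time_unit P * W)" "eval bar P env e (ev env e) s"
    using Dual by fastforce
  have "eval bar P env (Dual e) (ev env (Dual e)) (s + 1)"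
    using eval_Dual[OF *(2)] by simp
  moreover have "s + 1 \<le> time_factor (Dual e) * B + cost env (Dual e) * (time_unit P * W)"
    using * Dual.prems by (simp add: algebra_simps)
  moreover have "data_size (ev env (Dual e)) \<le> out_factor (Dual e) * B"
    using Dual.prems by (simp add: data_size_dual)
  ultimately show ?case by blast
next
  case (IsAtom e)
  obtain s where *: "s \<le> time_factor e * B + cost env e * (time_unit P * W)" "eval bar P env e (ev env e) s"
    using IsAtom by fastforce
  have "eval bar P env (IsAtom e) (ev env (IsAtom e)) (s + 1)"
    using eval_IsAtom[OF *(2)] by simp
  moreover have "s + 1 \<le> time_factor (IsAtom e) * B + cost env (IsAtom e) * (time_unit P * W)"
    using * IsAtom.prems by (simp add: algebra_simps)
  moreover have "data_size (ev env (IsAtom e)) \<le> out_factor (IsAtom e) * B"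
    using IsAtom.prems by (simp add: data_bool_def)
  ultimately show ?case by blast
next
  case (IsEq e d)
  obtain s t where *: "s \<le> time_factor e * B + cost env e * (time_unit P * W)" "eval bar P env e (ev env e) s"
    "t \<le> time_factor d * B + cost env d * (time_unit P * W)" "eval bar P env d (ev env d) t"
    using IsEq by fastforce
  have "eval bar P env (IsEq e d) (ev env (IsEq e d)) (s + t + 1)"
    using eval_IsEq[OF *(2,4)] by simp
  moreover have "s + t + 1 \<le> time_factor (IsEq e d) * B + cost env (IsEq e d) * (time_unit P * W)"
    using * IsEq.prems by (simp add: algebra_simps)
  moreover have "data_size (ev env (IsEq e d)) \<le> out_factor (IsEq e d) * B"
    using IsEq.prems by (simp add: data_bool_def)
  ultimately show ?case by blast
next
  case (If c e d)
  define b where "b = (if ev env c \<noteq> DNil then e else d)"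
  obtain s t where *: "s \<le> time_factor c * B + cost env c * (time_unit P * W)" "eval bar P env c (ev env c) s"
    "t \<le> time_factor b * B + cost env b * (time_unit P * W)" "eval bar P env b (ev env b) t"
    using If.IH(1)[of env B] If.IH(2)[of env B] If.IH(3)[of env B] If.prems
    unfolding b_def by (fastforce split: if_splits)
  have "eval bar P env (If c e d) (ev env (If c e d)) (s + t + 1)"
  proof (cases "ev env c = DNil")
    case True
    then show ?thesis using * eval_If_false[of bar P env c s d "ev env d" t e] by (simp add: b_def)
  next
    case False
    then show ?thesis using * eval_If_true[OF *(2) False, of e "ev env e" t d] by (simp add: b_def)
  qed
  moreover have "time_factor b * B \<le> (time_factor e + time_factor d) * B"
    unfolding b_def by (intro mult_right_mono) auto
  then have "s + t + 1 \<le> time_factor (If c e d) * B + cost env (If c e d) * (time_unit P * W)"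
    using * If.prems by (auto simp: b_def algebra_simps split: if_splits)
  moreover have "data_size (ev env (If c e d)) \<le> out_factor (If c e d) * B"
    using If.IH(2)[of env B] If.IH(3)[of env B] If.prems by (auto simp: algebra_simps split: if_splits)
  ultimately show ?case by blast
next
  case (Let e d)
  let ?env = "ev env e # env" and ?B = "out_factor e * B"
  obtain s where *: "s \<le> time_factor e * B + cost env e * (time_unit P * W)" "eval bar P env e (ev env e) s"
    "data_size (ev env e) \<le> ?B"
    using Let.IH(1)[of env B] Let.prems by fastforce
  have B: "B \<le> ?B" using out_factor_pos[of e] by simp
  have "\<forall>u\<in>set ?env. data_size u \<le> ?B"
    using Let.prems(2) *(3) le_trans[OF _ B] by (metis set_ConsD)
  moreover have "ok ?env d" using Let.prems(1) by simp
  moreover have "W \<le> ?B" "1 \<le> ?B" using Let.prems(3,4) B by linarith+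
  ultimately have d: "ok ?env d" "\<forall>u\<in>set ?env. data_size u \<le> ?B" "W \<le> ?B" "1 \<le> ?B"
    by blast+
  obtain t where **: "t \<le> time_factor d * ?B + cost ?env d * (time_unit P * W)" "eval bar P ?env d (ev ?env d) t"
    "data_size (ev ?env d) \<le> out_factor d * ?B"
    using Let.IH(2)[OF d] by blast
  have "eval bar P env (Let e d) (ev env (Let e d)) (s + t + 1)"
    using eval_Let[OF *(2) **(2)] by simp
  moreover have "s + t + 1 \<le> time_factor (Let e d) * B + cost env (Let e d) * (time_unit P * W)"
    using * ** Let.prems by (simp add: algebra_simps)
  moreover have "data_size (ev env (Let e d)) \<le> out_factor (Let e d) * B"
    using ** by (simp add: algebra_simps)
  ultimately show ?case by blast
next
  case (Call f e)
  obtain s where *: "s \<le> time_factor e * B + cost env e * (time_unit P * W)" "eval bar P env e (ev env e) s"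
    using Call by fastforce
  have "calls f (ev env e) (result f (ev env e)) (count f (ev env e))"
    using Call.prems by (intro calls_result) simp
  then obtain t where t: "f < length P" "t \<le> count f (ev env e) * (time_unit P * W)"
    "eval bar P [ev env e] (P ! f) (result f (ev env e)) t" "data_size (result f (ev env e)) \<le> W"
    unfolding calls_def by blast
  have "eval bar P env (Call f e) (ev env (Call f e)) (s + t + 1)"
    using eval_Call[OF t(1) *(2) t(3)] by simp
  moreover have "s + t + 1 \<le> time_factor (Call f e) * B + cost env (Call f e) * (time_unit P * W)"
    using * t Call.prems by (simp add: algebra_simps)
  moreover have "data_size (ev env (Call f e)) \<le> out_factor (Call f e) * B"
    using t Call.prems by simp
  ultimately show ?case by blast
qed

text \<open>The inequality for the cost is strict because the body itself, apart from the calls it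
  makes, counts as one call.\<close>

lemma callsI:
  assumes "f < length P" and "ok [u] (P ! f)" and "ev [u] (P ! f) = v" and "cost [u] (P ! f) < n"
    and "data_size u \<le> W" and "data_size v \<le> W"
  shows "calls f u v n"
proof -
  have "1 \<le> W" using assms(5) data_size_pos[of u] by simp
  then obtain t where t: "t \<le> time_factor (P ! f) * W + cost [u] (P ! f) * (time_unit P * W)"
    "eval bar P [u] (P ! f) v t"
    using ok_eval[of "[u]" "P ! f" W] assms by auto
  have "time_factor (P ! f) * W \<le> time_unit P * W"
    using time_factor_le_unit[OF assms(1)] by (intro mult_right_mono) auto
  then have "t \<le> (cost [u] (P ! f) + 1) * (time_unit P * W)"
    using t(1) by (simp only: add_mult_distrib mult_1)
  also have "\<dots> \<le> n * (time_unit P * W)"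
    using assms(4) by (intro mult_right_mono) auto
  finally show ?thesis using t(2) assms unfolding calls_def by blast
qed

end

section \<open>The program\<close>

fun num :: "nat \<Rightarrow> 'a data" where
  "num 0 = DNil"
| "num (Suc n) = DCons DNil (num n)"

text \<open>Inner nodes look like disjunctions. So for trees as for formulae, a tail other than
  \<open>DNil\<close> is the test for a compound object.\<close>

fun encode_tree :: "'a tree \<Rightarrow> 'a data" where
  "encode_tree (Leaf u) = encode_fm (leaf_fm u)"
| "encode_tree (Node l r) = DCons DNil (DCons (encode_tree l) (encode_tree r))"

abbreviation (input) "FFe \<equiv> Nl"
abbreviation (input) "TTe \<equiv> Cns Nl Nl"
abbreviation (input) "mke c a b \<equiv> Cns c (Cns a b)"
abbreviation (input) "Ore \<equiv> mke FFe"
abbreviation (input) "Ande \<equiv> mke TTe"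
abbreviation (input) "lft e \<equiv> Hd (Tl e)"
abbreviation (input) "rgt e \<equiv> Tl (Tl e)"

fun lst :: "exp list \<Rightarrow> exp" where
  "lst [] = Nl"
| "lst (e # es) = Cns e (lst es)"

text \<open>The last component is not followed by \<open>DNil\<close>: in a function body it is read
  with one of the \<open>rest\<close> abbreviations, the earlier ones with
  \<open>arg\<close>.\<close>

fun tup :: "exp list \<Rightarrow> exp" where
  "tup [] = Nl"
| "tup [e] = e"
| "tup (e # es) = Cns e (tup es)"

abbreviation (input) "arg0 \<equiv> Hd (Var 0)"
abbreviation (input) "rest1 \<equiv> Tl (Var 0)"
abbreviation (input) "arg1 \<equiv> Hd rest1"
abbreviation (input) "rest2 \<equiv> Tl rest1"
abbreviation (input) "arg2 \<equiv> Hd rest2"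
abbreviation (input) "rest3 \<equiv> Tl rest2"
abbreviation (input) "arg3 \<equiv> Hd rest3"
abbreviation (input) "rest4 \<equiv> Tl rest3"
abbreviation (input) "arg4 \<equiv> Hd rest4"
abbreviation (input) "rest5 \<equiv> Tl rest4"
abbreviation (input) "arg5 \<equiv> Hd rest5"
abbreviation (input) "rest6 \<equiv> Tl rest5"

abbreviation (input) "f_map \<equiv> 1"
abbreviation (input) "f_par \<equiv> 2"
abbreviation (input) "f_append \<equiv> 3"
abbreviation (input) "f_last \<equiv> 4"
abbreviation (input) "f_generic \<equiv> 5"
abbreviation (input) "f_mem \<equiv> 6"
abbreviation (input) "f_insert \<equiv> 7"
abbreviation (input) "f_collect \<equiv> 8"
abbreviation (input) "f_threshold \<equiv> 9"
abbreviation (input) "f_conv \<equiv> 10"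
abbreviation (input) "f_succ \<equiv> 11"
abbreviation (input) "f_succ_conv \<equiv> 12"
abbreviation (input) "f_succ_node \<equiv> 13"
abbreviation (input) "f_distribute \<equiv> 14"
abbreviation (input) "f_weaken_left \<equiv> 15"
abbreviation (input) "f_subst \<equiv> 16"
abbreviation (input) "f_pull \<equiv> 17"
abbreviation (input) "f_pull_node \<equiv> 18"
abbreviation (input) "f_pull_leaf \<equiv> 19"
abbreviation (input) "f_sim \<equiv> 20"
abbreviation (input) "f_wrap \<equiv> 21"
abbreviation (input) "f_sim_leaf \<equiv> 22"
abbreviation (input) "f_lines \<equiv> 23"
abbreviation (input) "f_levels \<equiv> 24"
abbreviation (input) "f_drop \<equiv> 25"
abbreviation (input) "f_add \<equiv> 26"
abbreviation (input) "f_sim_line \<equiv> 27"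
abbreviation (input) "f_frame \<equiv> 28"
abbreviation (input) "f_identity \<equiv> 29"
abbreviation (input) "f_cut \<equiv> 30"

abbreviation (input) "call f es \<equiv> Call f (tup es)"
abbreviation (input) "parOr d e \<equiv> call f_par [FFe, d, e]"
abbreviation (input) "parAnd d e \<equiv> call f_par [TTe, d, e]"
abbreviation (input) "app d e \<equiv> call f_append [d, e]"
abbreviation (input) "weakening A \<equiv> call f_generic [FFe, FFe, A]"
abbreviation (input) "contraction A \<equiv> call f_generic [FFe, TTe, A]"
abbreviation (input) "coweakening A \<equiv> call f_generic [TTe, FFe, A]"
abbreviation (input) "cocontraction A \<equiv> call f_generic [TTe, TTe, A]"

definition "b_map = If rest2 (Cns (mke arg0 arg1 (Hd rest2)) (call f_map [arg0, arg1, Tl rest2])) Nl"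

definition "b_par = If (Tl arg1)
  (Cns (mke arg0 (Hd arg1) (Hd rest2)) (call f_par [arg0, Tl arg1, rest2]))
  (call f_map [arg0, Hd arg1, rest2])"

definition "b_append = If arg0 (Cns (Hd arg0) (app (Tl arg0) rest1)) rest1"

definition "b_last = If (Tl (Var 0)) (Call f_last (Tl (Var 0))) (Hd (Var 0))"

definition "b_generic = (let N = rest2;
     source = If arg0 N (If arg1 (Ore N N) FFe);
     target = If arg0 (If arg1 (Ande N N) TTe) N
   in If (Tl N)
     (Cns source (app (call f_par [Hd N, call f_generic [arg0, arg1, lft N], call f_generic [arg0, arg1, rgt N]])
       (lst [target])))
     (If (IsEq (Cns source target) (Cns FFe TTe))
       (lst [FFe, Ande FFe (Ore TTe TTe), Ore (Ande FFe TTe) TTe, TTe])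
       (lst [source, target])))"

definition "b_mem = If (Tl rest1)
  (If (call f_mem [arg0, lft rest1]) TTe (call f_mem [arg0, rgt rest1])) (IsEq arg0 rest1)"

definition "b_insert = If (Tl rest1)
  (Ore (call f_insert [arg0, rgt rest1]) (lft rest1)) (Ore rest1 arg0)"

text \<open>Beside the tree, the state holds its number of leaves in unary. It starts at 1 for the
  empty leaf and later serves as the number of levels.\<close>

definition "b_collect = (let u = arg0; state = rest1; T = Hd state; M = Tl state in
  If (IsAtom u)
    (If (call f_mem [Dual u, T]) state (Cns (call f_insert [u, T]) (Cns Nl M)))
    (If u (call f_collect [Tl u, call f_collect [Hd u, state]]) state))"

text \<open>One function serves for formulae and derivations. Its result is a derivation that starts
  at the threshold formula, with \<open>x\<close> deleted if \<open>x\<close> is an atom; the head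
  of the result is therefore how the program obtains \<open>\<theta> k\<close> and
  \<open>\<tau> k x\<close>.\<close>

definition "b_threshold = (let x = arg0; T = arg1; k = rest2 in
  If (Tl T) (call f_conv [x, lft T, rgt T, Nl, k])
    (If k
      (If (Tl k) (lst [FFe])
        (If (IsAtom T) (If (IsEq x T) (lst [FFe, T]) (If (IsAtom x) (lst [T]) (lst [T, TTe]))) (lst [T])))
      (lst [TTe])))"

definition "b_conv = (let x = arg0; l = arg1; r = arg2; i = arg3; j = rest4 in
  parOr (parAnd (call f_threshold [x, l, i]) (call f_threshold [x, r, j]))
    (If j (call f_conv [x, l, r, Cns Nl i, Tl j]) (lst [FFe])))"

definition "b_succ = (let x = arg0; T = arg1; k = rest2 in
  If (Tl T)
    (Cns (Ande x (Hd (call f_threshold [x, T, k])))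
      (app (If (call f_mem [x, lft T]) (call f_succ_node [x, lft T, rgt T, k])
          (call f_succ_node [x, rgt T, lft T, k]))
        (lst [Hd (call f_threshold [Nl, T, Cns Nl k])])))
    (If k (lst [Ande x FFe, Ande TTe FFe, FFe]) (lst [Ande x TTe, x])))"

definition "b_succ_conv = (let x = arg0; l = arg1; r = arg2; i = arg3; j = rest4 in
  app (call f_distribute [x, Hd (call f_conv [x, l, r, i, j])])
    (parOr (parAnd (call f_succ [x, l, i]) (call f_threshold [x, r, j]))
      (If j (call f_succ_conv [x, l, r, Cns Nl i, Tl j])
        (lst [Ande x FFe, Ande TTe FFe, FFe]))))"

definition "b_succ_node = (let x = arg0; l = arg1; r = arg2; k = rest3 in
  app (call f_succ_conv [x, l, r, Nl, k])
    (Call f_weaken_left (Hd (call f_conv [Nl, l, r, Nl, Cns Nl k]))))"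

definition "b_distribute = (let x = arg0; A = lft rest1; B = rgt rest1 in
  lst [Ande x (Ore A B), Ande (Ande x x) (Ore A B), Ande x (Ande x (Ore A B)),
    Ande x (Ore (Ande x A) B), Ande x (Ore B (Ande x A)), Ore (Ande x B) (Ande x A)])"

definition "b_weaken_left = parOr (weakening (lft (Var 0))) (lst [rgt (Var 0)])"

text \<open>
  From here on, the first component of an argument is a quadruple: the tree, the level \<open>k\<close>, and the
  thresholds at levels \<open>k\<close> and \<open>k + 1\<close>.
\<close>

abbreviation (input) "treee \<equiv> Hd arg0"
abbreviation (input) "levele \<equiv> Hd (Tl arg0)"
abbreviation (input) "thise \<equiv> Hd (Tl (Tl arg0))"
abbreviation (input) "nexte \<equiv> Tl (Tl (Tl arg0))"

definition "b_subst = (let A = rest1 in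
  If (Tl A) (mke (Hd A) (call f_subst [arg0, lft A]) (call f_subst [arg0, rgt A]))
    (If (IsAtom A)
      (If (call f_mem [A, treee]) A (Hd (call f_threshold [Dual A, treee, levele]))) A))"

text \<open>Pulls a formula \<open>Q\<close> out of all leaves of \<open>N\<close> to the top. If
  \<open>Q\<close> is an atom \<open>x\<close> and \<open>N\<close> is \<open>\<theta> k\<close>,
  this yields \<open>\<tau> k x\<close> or \<open>x\<close>. If \<open>Q\<close> is
  \<open>\<theta> (k + 1)\<close>, it leads from the image of \<open>N\<close> under
  \<open>\<sigma> k\<close> back to \<open>N\<close>.\<close>

definition "b_pull = (let Q = arg1; N = rest2 in
  If (Tl N)
    (Call f_pull_node (call f_par [Hd N, call f_pull [arg0, Q, lft N], call f_pull [arg0, Q, rgt N]]))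
    (Call f_pull_leaf (Var 0)))"

text \<open>Receives only the parallel composition of the derivations for the two subformulae, and
  reads the connective, both subformulae and \<open>Q\<close> off its last line.\<close>

definition "b_pull_node = Let (Call f_last (Var 0))
  (let X = lft (Var 0); Y = rgt (Var 0); A = lft X; B = lft Y; Q = rgt X;
     contract = parOr (lst [mke (Hd (Var 0)) A B]) (contraction Q)
   in app (Var 1)
     (If (Hd (Var 0))
       (Cns (Ore (Ande X B) Q) (Cns (Ore (Ande B X) Q) (Cns (Ore (Ore (Ande B A) Q) Q) contract)))
       contract))"

definition "b_pull_leaf = (let Q = arg1; N = rest2; x = Dual N;
     default = Cns N (parOr (lst [N]) (weakening Q));
     tau = Hd (call f_threshold [x, treee, levele])
   in If (IsAtom Q)
     (If (IsEq N Q) (lst [Q, Ore FFe Q]) default)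
     (If (IsAtom N)
       (If (call f_mem [N, treee]) default
         (Cns tau (Cns (Ande tau TTe) (Cns (Ande tau (Ore x N)) (Cns (Ore (Ande tau x) N)
           (app (parOr (call f_succ [x, treee, levele]) (lst [N])) (lst [Ore N Q])))))))
       default))"

definition "b_drop = parAnd (coweakening arg0) (lst [rest1])"

definition "b_add = parOr (lst [arg0]) (weakening rest1)"

definition "b_frame = (let A = arg1; B = arg2; d = rest3 in
  app (call f_drop [thise, call f_subst [arg0, A]])
    (app d (call f_add [call f_subst [arg0, B], nexte])))"

definition "b_identity = (let b = lft rest1 in
  Cns (Ande thise TTe)
    (app (call f_pull [arg0, If (call f_mem [b, treee]) b (Dual b), thise])
      (call f_add [call f_subst [arg0, rest1], nexte])))"

definition "b_cut = (let b = lft rest1 in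
  app (call f_drop [thise, call f_subst [arg0, rest1]])
    (app (call f_succ [If (call f_mem [b, treee]) b (Dual b), treee, levele])
      (lst [Ore FFe nexte])))"

text \<open>The empty list, which is no derivation, reports that no atomic rule fits.
  \<open>b_wrap\<close> and \<open>b_sim\<close> pass this report on.\<close>

definition "b_sim_leaf = (let A = arg1; B = rest2 in
  If (IsAtom B)
    (If (IsEq A FFe) (call f_frame [arg0, A, B, weakening (call f_subst [arg0, B])])
      (If (IsEq A (Ore B B)) (call f_frame [arg0, A, B, contraction (call f_subst [arg0, B])]) Nl))
    (If (IsAtom A)
      (If (IsEq B TTe) (call f_frame [arg0, A, B, coweakening (call f_subst [arg0, A])])
        (If (IsEq B (Ande A A)) (call f_frame [arg0, A, B, cocontraction (call f_subst [arg0, A])]) Nl))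
      (If (IsEq A TTe)
        (If (IsAtom (lft B)) (If (IsEq B (Ore (lft B) (Dual (lft B)))) (call f_identity [arg0, B]) Nl) Nl)
        (If (IsEq B FFe)
          (If (IsAtom (lft A)) (If (IsEq A (Ande (lft A) (Dual (lft A)))) (call f_cut [arg0, A]) Nl) Nl)
          Nl))))"

definition "b_wrap = (let A = arg1; B = arg2; A' = call f_subst [arg0, arg3]; B' = call f_subst [arg0, arg4];
     C = call f_subst [arg0, arg5]; d = rest6;
     source = Ande thise (call f_subst [arg0, A]); target = Ore (call f_subst [arg0, B]) nexte
   in If d
     (If (Hd A)
       (Cns source (app (parAnd d (lst [C])) (lst [Ande C (Ore B' nexte), Ore (Ande C B') nexte, target])))
       (Cns source (Cns (Ande thise (Ore A' C)) (app (parOr d (lst [C])) (lst [target])))))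
     Nl)"

definition "b_sim = (let A = arg1; B = rest2; A1 = lft A; A2 = rgt A; B1 = lft B; B2 = rgt B in
  If (Tl A)
    (If (Tl B)
      (If (IsEq (Hd A) (Hd B))
        (If (IsEq A2 B2) (call f_wrap [arg0, A, B, A1, B1, A2, call f_sim [arg0, A1, B1]])
          (If (IsEq A1 B1) (call f_wrap [arg0, A, B, A2, B2, A1, call f_sim [arg0, A2, B2]]) Nl))
        Nl)
      (Call f_sim_leaf (Var 0)))
    (Call f_sim_leaf (Var 0)))"

definition "b_sim_line = If (Call f_sim (Var 0)) (Call f_sim (Var 0))
  (call f_frame [arg0, arg1, rest2, lst [call f_subst [arg0, arg1], call f_subst [arg0, rest2]]])"

definition "b_lines = (let A = arg1; B = Hd rest2; sA = call f_subst [arg0, A]; sB = call f_subst [arg0, B] in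
  If rest2
    (app (parOr (parAnd (cocontraction thise) (lst [sA])) (lst [nexte]))
      (app (parOr (parAnd (lst [thise]) (call f_sim_line [arg0, A, B])) (lst [nexte]))
        (Cns (Ore (Ore (Ande thise sB) nexte) nexte)
          (app (parOr (lst [Ande thise sB]) (contraction nexte)) (call f_lines [arg0, B, Tl rest2])))))
    (app (parOr (call f_drop [thise, sA]) (lst [nexte]))
      (app (parOr (call f_pull [arg0, nexte, A]) (lst [nexte]))
        (parOr (lst [A]) (contraction nexte)))))"

definition "b_levels = (let T = arg0; k = arg1; m = arg2; A = arg3; lines = rest4 in
  If m
    (Let (tup [T, k, Hd (call f_threshold [Nl, T, k]), Hd (call f_threshold [Nl, T, Cns Nl k])])
      (let T = Hd (Var 1); k = Hd (Tl (Var 1)); m = Hd (Tl (Tl (Var 1)));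
         A = Hd (Tl (Tl (Tl (Var 1)))); lines = Tl (Tl (Tl (Tl (Var 1))));
         this = Hd (Tl (Tl (Var 0))); next = Tl (Tl (Tl (Var 0)))
       in app (parOr (lst [A]) (Cns this (app (parOr (lst [Ande this TTe]) (weakening next))
            (call f_lines [Var 0, TTe, Tl lines]))))
          (app (parOr (contraction A) (lst [next]))
            (call f_levels [T, Cns Nl k, Tl m, A, lines]))))
    (app (parOr (lst [A]) (call f_threshold [Nl, T, k])) (lst [A])))"

definition "b_main = Let (call f_collect [Var 0, Nl, Cns Nl Nl])
  (let T = Hd (Var 0); M = Tl (Var 0); A = Call f_last (Var 1) in
    Cns TTe (app (parOr (weakening A) (lst [Hd (call f_threshold [Nl, T, Nl])]))
      (call f_levels [T, Nl, M, A, Var 1])))"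

definition cut_program :: program where
  "cut_program = [b_main, b_map, b_par, b_append, b_last, b_generic, b_mem, b_insert, b_collect,
     b_threshold, b_conv, b_succ, b_succ_conv, b_succ_node, b_distribute, b_weaken_left, b_subst,
     b_pull, b_pull_node, b_pull_leaf, b_sim, b_wrap, b_sim_leaf, b_lines, b_levels, b_drop, b_add,
     b_sim_line, b_frame, b_identity, b_cut]"

lemma length_program [simp]: "length cut_program = 31"
  by (simp add: cut_program_def)

lemma program_nth [simplified, simp]:
  "cut_program ! 0 = b_main"
  "cut_program ! f_map = b_map"
  "cut_program ! f_par = b_par"
  "cut_program ! f_append = b_append"
  "cut_program ! f_last = b_last"
  "cut_program ! f_generic = b_generic"
  "cut_program ! f_mem = b_mem"
  "cut_program ! f_insert = b_insert"
  "cut_program ! f_collect = b_collect"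
  "cut_program ! f_threshold = b_threshold"
  "cut_program ! f_conv = b_conv"
  "cut_program ! f_succ = b_succ"
  "cut_program ! f_succ_conv = b_succ_conv"
  "cut_program ! f_succ_node = b_succ_node"
  "cut_program ! f_distribute = b_distribute"
  "cut_program ! f_weaken_left = b_weaken_left"
  "cut_program ! f_subst = b_subst"
  "cut_program ! f_pull = b_pull"
  "cut_program ! f_pull_node = b_pull_node"
  "cut_program ! f_pull_leaf = b_pull_leaf"
  "cut_program ! f_sim = b_sim"
  "cut_program ! f_wrap = b_wrap"
  "cut_program ! f_sim_leaf = b_sim_leaf"
  "cut_program ! f_lines = b_lines"
  "cut_program ! f_levels = b_levels"
  "cut_program ! f_drop = b_drop"
  "cut_program ! f_add = b_add"
  "cut_program ! f_sim_line = b_sim_line"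
  "cut_program ! f_frame = b_frame"
  "cut_program ! f_identity = b_identity"
  "cut_program ! f_cut = b_cut"
  by (simp_all add: cut_program_def)

lemma data_bool_iff [simp]: "data_bool b = DNil \<longleftrightarrow> \<not> b" "data_bool b = data_bool c \<longleftrightarrow> b = c"
  by (auto simp: data_bool_def)

lemma data_bool_values [simp]: "data_bool False = DNil" "data_bool True = DCons DNil DNil"
  by (auto simp: data_bool_def)

lemma encode_mk [simp]: "encode_fm (mk c A B) = DCons (data_bool c) (DCons (encode_fm A) (encode_fm B))"
  by (simp add: data_bool_def)

lemma encode_fm_eq_iff [simp]: "encode_fm A = encode_fm B \<longleftrightarrow> A = B"
  using encode_fm_inject by blast

lemma encode_eq_DNil [simp]: "encode d = DNil \<longleftrightarrow> d = []"
  by (cases d) auto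

lemma num_eq_DNil [simp]: "num k = DNil \<longleftrightarrow> k = 0"
  by (cases k) auto

lemma size_num [simp]: "data_size (num k) = 2 * k + 1"
  by (induction k) auto

lemma size_encode_tree: "data_size (encode_tree T) + 3 \<le> 4 * leaves T"
proof (induction T)
  case (Leaf u)
  then show ?case by (cases u) auto
qed auto

section \<open>Correctness and calls of the list operations\<close>

locale elimination = cut_free +
  fixes Z :: nat
  assumes Z_ge: "10 \<le> Z"
begin

definition Z2 :: nat where
  "Z2 = Z * Z"

text \<open>By \<open>size_fits\<close> an encoded derivation takes at most \<open>9 * Z2\<close>,
  and a single formula or tree within the bound \<open>Z\<close> at most \<open>Z2\<close>. An
  argument combines only a few of them.\<close>

definition W :: nat where
  "W = 100 * Z2"

sublocale execution bar cut_program W .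

lemma Z_le_square: "100 \<le> Z2" "10 * Z \<le> Z2" "100 * Z2 \<le> W"
  using Z_ge mult_mono[of 10 Z 10 Z] mult_mono[of 10 Z Z Z] by (auto simp: Z2_def W_def)

definition fits :: "'a fm list \<Rightarrow> bool" where
  "fits d \<longleftrightarrow> length d \<le> Z \<and> (\<forall>x\<in>set d. fm_size x \<le> Z)"

lemma fits_append: "fits (d @ e) \<Longrightarrow> fits d \<and> fits e"
  by (auto simp: fits_def)

lemma fits_der: "der s d A B \<Longrightarrow> s \<le> Z \<Longrightarrow> fits d"
  by (force simp: fits_def der_def)

lemma size_fits:
  assumes "fits d" shows "data_size (encode d) \<le> 9 * Z2"
proof -
  have "proof_size d \<le> length d * Z"
    using assms sum_list_mono[of d fm_size "\<lambda>_. Z"] by (simp add: fits_def proof_size_def sum_list_triv)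
  also have "\<dots> \<le> Z2" using assms mult_right_mono[of "length d" Z Z] by (simp add: fits_def Z2_def)
  finally show ?thesis using encode_size[of d] Z_le_square by (simp add: Z2_def)
qed

lemma size_fm: "fm_size A \<le> Z \<Longrightarrow> data_size (encode_fm A) \<le> Z2"
  using encode_fm_size[of A] Z_le_square by linarith

lemma size_data_bool: "data_size (data_bool c :: 'a data) \<le> 3"
  by (simp add: data_bool_def)

lemma size_tree: "leaves T \<le> Z \<Longrightarrow> data_size (encode_tree T) \<le> Z2"
  using size_encode_tree[of T] Z_le_square by linarith

lemma size_level: "k \<le> Z \<Longrightarrow> data_size (num k) \<le> Z2"
  using Z_le_square Z_ge by (simp only: size_num)

lemma map_calls:
  "fits (map (mk c x) d) \<Longrightarrow> fits d \<Longrightarrow> fm_size x \<le> Z \<Longrightarrow>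
    calls f_map (DCons (data_bool c) (DCons (encode_fm x) (encode d))) (encode (map (mk c x) d)) (length d + 1)"
proof (induction d)
  case Nil
  show ?case
    using Z_le_square size_fm[OF Nil(3)] size_data_bool[of c]
    by (intro callsI; simp add: b_map_def; linarith)
next
  case (Cons y d)
  have c: "calls f_map (DCons (data_bool c) (DCons (encode_fm x) (encode d))) (encode (map (mk c x) d)) (length d + 1)"
    using Cons by (simp add: fits_def)
  show ?case
    using callsD[OF c] size_fits[OF Cons.prems(1)] size_fits[OF Cons.prems(2)] size_fm[OF Cons.prems(3)]
      size_data_bool[of c] Z_le_square
    by (intro callsI; simp add: b_map_def; linarith)
qed

lemma par_calls:
  "d \<noteq> [] \<Longrightarrow> e \<noteq> [] \<Longrightarrow> fits (par c d e) \<Longrightarrow> fits d \<Longrightarrow> fits e \<Longrightarrow>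
    calls f_par (DCons (data_bool c) (DCons (encode d) (encode e))) (encode (par c d e)) (length d + length e + 1)"
proof (induction c d e rule: par.induct)
  case (2 c x e)
  have c: "calls f_map (DCons (data_bool c) (DCons (encode_fm x) (encode e))) (encode (map (mk c x) e)) (length e + 1)"
    using 2 by (intro map_calls) (auto simp: fits_def)
  show ?case
    using callsD[OF c] size_fits[OF 2(3)] size_fits[OF 2(4)] size_fits[OF 2(5)] size_data_bool[of c] Z_le_square
    by (intro callsI; simp add: b_par_def; linarith)
next
  case (3 c x y d e)
  have c: "calls f_par (DCons (data_bool c) (DCons (encode (y # d)) (encode e))) (encode (par c (y # d) e))
      (length (y # d) + length e + 1)"
    using 3 by (intro 3(1)) (auto simp: fits_def)
  obtain z e' where e: "e = z # e'" using 3(3) by (cases e) auto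
  show ?case
    using callsD[OF c] size_fits[OF 3(4)] size_fits[OF 3(5)] size_fits[OF 3(6)] size_data_bool[of c] Z_le_square
    unfolding e by (intro callsI; simp add: b_par_def; linarith)
qed simp

lemma append_calls:
  "fits (d @ e) \<Longrightarrow> calls f_append (DCons (encode d) (encode e)) (encode (d @ e)) (length d + 1)"
proof (induction d)
  case Nil
  show ?case
    using Z_le_square size_fits[OF Nil]
    by (intro callsI; simp add: b_append_def; linarith)
next
  case (Cons y d)
  have c: "calls f_append (DCons (encode d) (encode e)) (encode (d @ e)) (length d + 1)"
    using Cons by (simp add: fits_def)
  have "fits (y # d)" "fits e" using fits_append[of "y # d" e] Cons(2) by auto
  then show ?case
    using callsD[OF c] size_fits[OF Cons(2)] size_fits[of "y # d"] size_fits[of e] Z_le_square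
    by (intro callsI; simp add: b_append_def; linarith)
qed

lemma last_calls: "d \<noteq> [] \<Longrightarrow> fits d \<Longrightarrow> calls f_last (encode d) (encode_fm (last d)) (length d + 1)"
proof (induction d)
  case (Cons y d)
  have y: "data_size (encode_fm y) \<le> Z2" using Cons(3) by (intro size_fm) (simp add: fits_def)
  show ?case
  proof (cases "d = []")
    case True
    then show ?thesis using y Z_le_square
      by (intro callsI; simp add: b_last_def; linarith)
  next
    case False
    have c: "calls f_last (encode d) (encode_fm (last d)) (length d + 1)"
      using Cons False by (simp add: fits_def)
    have "fm_size (last d) \<le> Z" using False Cons(3) by (simp add: fits_def)
    then show ?thesis using False y Z_le_square callsD[OF c] size_fits[OF Cons(3)] size_fm[of "last d"]
      by (intro callsI; simp add: b_last_def; linarith)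
  qed
qed simp

end

section \<open>Derivations computed by the program\<close>

fun data_atoms :: "'a data \<Rightarrow> 'a set" where
  "data_atoms DNil = {}"
| "data_atoms (DAtom a) = {a}"
| "data_atoms (DCons u v) = data_atoms u \<union> data_atoms v"

fun num_atoms :: "'a data \<Rightarrow> nat" where
  "num_atoms DNil = 0"
| "num_atoms (DAtom a) = 1"
| "num_atoms (DCons u v) = num_atoms u + num_atoms v"

lemma num_atoms_encode_fm: "num_atoms (encode_fm A) \<le> fm_size A"
  by (induction A) auto

lemma num_atoms_encode: "num_atoms (encode As) \<le> proof_size As"
proof (induction As)
  case (Cons A As)
  then show ?case using num_atoms_encode_fm[of A] by (simp add: proof_size_def)
qed simp

context cut_free
begin

text \<open>The atom of a dual pair that is met first becomes the positive one. Only the dual is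
  looked up, so a positive atom is inserted again at each further occurrence.\<close>

fun collect :: "'a data \<Rightarrow> 'a tree \<Rightarrow> 'a tree" where
  "collect DNil T = T"
| "collect (DAtom a) T = (if bar a \<in> atoms T then T else insert_leaf a T)"
| "collect (DCons u v) T = collect v (collect u T)"

lemma collect_leaves: "leaves T \<le> leaves (collect u T)" "leaves (collect u T) \<le> leaves T + num_atoms u"
  by (induction u T rule: collect.induct) auto

lemma collect_atom_leaves: "atom_leaves T + 1 = leaves T \<Longrightarrow> atom_leaves (collect u T) + 1 = leaves (collect u T)"
  by (induction u T rule: collect.induct) auto

lemma collect_balanced: "balanced T \<Longrightarrow> balanced (collect u T)"
  by (induction u T rule: collect.induct) (auto intro: balanced_insert)

lemma collect_mono: "atoms T \<subseteq> atoms (collect u T)"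
  by (induction u T rule: collect.induct) auto

lemma collect_covers: "a \<in> data_atoms u \<Longrightarrow> a \<in> atoms (collect u T) \<or> bar a \<in> atoms (collect u T)"
  by (induction u T rule: collect.induct) (use collect_mono in \<open>auto split: if_splits\<close>)

lemma collect_consistent:
  "(\<And>a. bar a \<noteq> a) \<Longrightarrow> (\<forall>a\<in>atoms T. bar a \<notin> atoms T) \<Longrightarrow>
    (\<forall>a\<in>atoms (collect u T). bar a \<notin> atoms (collect u T))"
  by (induction u T rule: collect.induct) (simp_all, metis bar_bar)

end

context elimination
begin

text \<open>
  The same bound \<open>s\<close> serves for the computed derivation and, up to the factor \<open>20 * Z\<close>, for the number of
  function calls. The number \<open>Z\<close> bounds every derivation that occurs in the whole computation.
\<close>

definition runs :: "nat \<Rightarrow> 'a data \<Rightarrow> nat \<Rightarrow> 'a fm \<Rightarrow> 'a fm \<Rightarrow> bool" where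
  "runs f u s A B \<longleftrightarrow> (\<exists>d. calls f u (encode d) (20 * Z * s) \<and> der s d A B)"

lemma par_der:
  assumes "der s d A B" and "der r e C D" and "s + r \<le> Z"
  shows "calls f_par (DCons (data_bool c) (DCons (encode d) (encode e))) (encode (par c d e)) (3 * Z)"
    and "der (s + r) (par c d e) (mk c A C) (mk c B D)"
proof -
  show p: "der (s + r) (par c d e) (mk c A C) (mk c B D)"
    using assms by (intro der_par)
  have "calls f_par (DCons (data_bool c) (DCons (encode d) (encode e))) (encode (par c d e)) (length d + length e + 1)"
    using fits_der[OF assms(1)] fits_der[OF assms(2)] fits_der[OF p] assms
    by (intro par_calls) (auto simp: der_def)
  then show "calls f_par (DCons (data_bool c) (DCons (encode d) (encode e))) (encode (par c d e)) (3 * Z)"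
    by (rule calls_mono) (use assms Z_ge in \<open>auto simp: der_def\<close>)
qed

lemma parOr_der:
  assumes "der s d A B" and "der r e C D" and "s + r \<le> Z"
  shows "calls f_par (DCons DNil (DCons (encode d) (encode e))) (encode (par False d e)) (3 * Z)"
    and "der (s + r) (par False d e) (Or A C) (Or B D)"
  using par_der[OF assms, of False] by (simp_all add: data_bool_def)

lemma parAnd_der:
  assumes "der s d A B" and "der r e C D" and "s + r \<le> Z"
  shows "calls f_par (DCons (DCons DNil DNil) (DCons (encode d) (encode e))) (encode (par True d e)) (3 * Z)"
    and "der (s + r) (par True d e) (And A C) (And B D)"
  using par_der[OF assms, of True] by (simp_all add: data_bool_def)

lemma append_der:
  assumes "der s d A B" and "der r e C D" and "s + r \<le> Z" and "step B C"
  shows "calls f_append (DCons (encode d) (encode e)) (encode (d @ e)) (2 * Z)"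
    and "der (s + r) (d @ e) A D"
proof -
  show p: "der (s + r) (d @ e) A D"
    using assms by (intro der_append)
  have "calls f_append (DCons (encode d) (encode e)) (encode (d @ e)) (length d + 1)"
    using fits_der[OF p] assms by (intro append_calls) auto
  then show "calls f_append (DCons (encode d) (encode e)) (encode (d @ e)) (2 * Z)"
    by (rule calls_mono) (use assms Z_ge in \<open>auto simp: der_def\<close>)
qed

text \<open>
  The four choices of \<open>p\<close> and \<open>q\<close> give weakening, contraction, coweakening and cocontraction, which
  are all derived from the atomic rules by the same recursion on the formula.
\<close>

definition source :: "bool \<Rightarrow> bool \<Rightarrow> 'a fm \<Rightarrow> 'a fm" where
  "source p q N = (if p then N else if q then Or N N else FF)"

definition target :: "bool \<Rightarrow> bool \<Rightarrow> 'a fm \<Rightarrow> 'a fm" where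
  "target p q N = (if p then if q then And N N else TT else N)"

lemma source_step: "step (source p q (mk c A B)) (mk c (source p q A) (source p q B))"
  unfolding source_def
  by (cases p; cases q; cases c)
    (auto intro: step_refl step_rules, (auto intro!: step_feq simp: feq_simps)+)

lemma target_step: "step (mk c (target p q A) (target p q B)) (target p q (mk c A B))"
  unfolding target_def
  by (cases p; cases q; cases c)
    (auto intro: step_refl step_rules, (auto intro!: step_feq simp: feq_simps)+)

lemma generic_leaf_step:
  "N = FF \<or> N = TT \<or> N = Atom a \<Longrightarrow> (source p q N, target p q N) \<noteq> (FF, TT) \<Longrightarrow>
    step (source p q N) (target p q N)"
  unfolding source_def target_def
  by (cases p; cases q) (auto intro: step_refl step_rules step_feq simp: feq_simps)

lemma generic_size: "fm_size (source p q N) \<le> 2 * fm_size N" "fm_size (target p q N) \<le> 2 * fm_size N"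
  using fm_size_pos[of N] by (auto simp: source_def target_def)

text \<open>Weakening to \<open>TT\<close> has no atomic rule. Since \<open>Or TT TT\<close> equals
  \<open>TT\<close>, it can be conjoined to \<open>FF\<close>, and a switch frees one of its
  disjuncts. The same lines serve for coweakening from \<open>FF\<close>.\<close>

lemma FF_to_TT:
  "step FF (And FF (Or TT TT))" "step (And FF (Or TT TT)) (Or (And FF TT) TT)"
  "step (Or (And FF TT) TT) TT"
  by (auto intro: step_feq step_rules simp: feq_simps)

text \<open>One unit of slack in a size bound pays for \<open>20 * Z\<close> calls. This is what the
  list operations in a body are charged to: an append takes at most \<open>2 * Z\<close> calls and a
  parallel composition at most \<open>3 * Z\<close>.\<close>

lemma budget: "s < t \<Longrightarrow> 20 * Z * s + 20 * Z \<le> 20 * Z * t"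
  using mult_le_mono2[of "s + 1" t "20 * Z"] by simp

text \<open>The mixed term \<open>8 * a * b\<close> dominates \<open>4 * (a + b)\<close>, since both
  numbers are at least 1. Hence a quadratic bound survives a recursion with linear cost per
  node.\<close>

lemma square_sum_bound:
  "1 \<le> a \<Longrightarrow> 1 \<le> b \<Longrightarrow> 4 * (a * a) + 4 * (b * b) + 4 * (a + b) \<le> 4 * ((a + b) * (a + b))" for a b :: nat
  by (cases a; cases b; simp add: algebra_simps)

lemma generic_leaf_runs:
  assumes N: "N = FF \<or> N = TT \<or> N = Atom a" and Z: "4 * (fm_size N * fm_size N) \<le> Z"
  shows "runs f_generic (DCons (data_bool p) (DCons (data_bool q) (encode_fm N)))
      (4 * (fm_size N * fm_size N)) (source p q N) (target p q N)"
proof -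
  define d where "d = (if (source p q N, target p q N) = (FF, TT)
    then [FF, And FF (Or TT TT), Or (And FF TT) TT, TT] else [source p q N, target p q N])"
  have size: "fm_size N = 1" using N by auto
  have "der 4 d (source p q N) (target p q N)"
    using FF_to_TT generic_leaf_step[OF N, of p q] generic_size[of p q N] size
    by (auto simp: d_def der_def)
  moreover have "data_tl (encode_fm N) = DNil" using N by auto
  moreover have "encode_fm (source p q N) = DNil \<and> encode_fm (target p q N) = DCons DNil DNil
      \<longleftrightarrow> (source p q N, target p q N) = (FF, TT)"
    using encode_fm_eq_iff[of "source p q N" FF] encode_fm_eq_iff[of "target p q N" TT] by auto
  moreover have "data_size (encode_fm N) \<le> 3" using N by auto
  moreover have "ok [DCons (data_bool p) (DCons (data_bool q) (encode_fm N))] b_generic"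
    "ev [DCons (data_bool p) (DCons (data_bool q) (encode_fm N))] b_generic = encode d"
    "cost [DCons (data_bool p) (DCons (data_bool q) (encode_fm N))] b_generic = 0"
    using calculation(2,3) by (cases p; cases q; auto simp: b_generic_def Let_def d_def source_def target_def)+
  moreover have "data_size (encode d) \<le> 9 * Z2"
    using size_fits[OF fits_der[OF calculation(1)]] Z size by simp
  ultimately have "calls f_generic (DCons (data_bool p) (DCons (data_bool q) (encode_fm N))) (encode d) 1"
    using size_data_bool[of p] size_data_bool[of q] Z_le_square by (intro callsI) simp_all
  then have "calls f_generic (DCons (data_bool p) (DCons (data_bool q) (encode_fm N))) (encode d) (20 * Z * 4)"
    by (rule calls_mono) (use Z_ge in simp)
  with \<open>der 4 d _ _\<close> show ?thesis unfolding runs_def using size by auto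
qed

lemma generic_runs:
  "4 * (fm_size N * fm_size N) \<le> Z \<Longrightarrow>
    runs f_generic (DCons (data_bool p) (DCons (data_bool q) (encode_fm N)))
      (4 * (fm_size N * fm_size N)) (source p q N) (target p q N)"
proof (induction N)
  have *: "runs f_generic (DCons (data_bool p) (DCons (data_bool q) (encode_fm (mk c A B))))
      (4 * (fm_size (mk c A B) * fm_size (mk c A B))) (source p q (mk c A B)) (target p q (mk c A B))"
    if IH: "4 * (fm_size A * fm_size A) \<le> Z \<Longrightarrow> runs f_generic (DCons (data_bool p) (DCons (data_bool q) (encode_fm A)))
      (4 * (fm_size A * fm_size A)) (source p q A) (target p q A)"
      "4 * (fm_size B * fm_size B) \<le> Z \<Longrightarrow> runs f_generic (DCons (data_bool p) (DCons (data_bool q) (encode_fm B)))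
      (4 * (fm_size B * fm_size B)) (source p q B) (target p q B)"
      and Z: "4 * (fm_size (mk c A B) * fm_size (mk c A B)) \<le> Z" for c A B
  proof -
    let ?N = "mk c A B"
    define a b where "a = fm_size A" and "b = fm_size B"
    have N: "fm_size ?N = a + b" by (simp add: a_def b_def)
    have ab: "1 \<le> a" "1 \<le> b" using fm_size_pos by (auto simp: a_def b_def)
    have sq: "(a + b) * (a + b) = a * a + b * b + 2 * (a * b)" by (simp add: algebra_simps)
    have "4 * (a * a) \<le> Z" "4 * (b * b) \<le> Z" using Z N sq by simp_all
    then obtain d e where
      d: "calls f_generic (DCons (data_bool p) (DCons (data_bool q) (encode_fm A))) (encode d) (20 * Z * (4 * (a * a)))"
        "der (4 * (a * a)) d (source p q A) (target p q A)" and
      e: "calls f_generic (DCons (data_bool p) (DCons (data_bool q) (encode_fm B))) (encode e) (20 * Z * (4 * (b * b)))"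
        "der (4 * (b * b)) e (source p q B) (target p q B)"
      using IH unfolding runs_def a_def b_def by blast
    have sizes: "4 * (a * a) + 4 * (b * b) + 4 * (a + b) \<le> 4 * (fm_size ?N * fm_size ?N)"
      unfolding N using \<open>1 \<le> a\<close> \<open>1 \<le> b\<close> by (rule square_sum_bound)
    have src: "fm_size (source p q ?N) \<le> 2 * (a + b)" and tgt: "fm_size (target p q ?N) \<le> 2 * (a + b)"
      using generic_size[of p q ?N] N by auto
    have par: "4 * (a * a) + 4 * (b * b) \<le> Z" using sizes Z by linarith
    note pr = par_der[OF d(2) e(2) par, of c]
    have app: "4 * (a * a) + 4 * (b * b) + 2 * (a + b) \<le> Z" using sizes Z by linarith
    note ap = append_der[OF pr(2) der_single[OF tgt] app target_step]
    define r where "r = source p q ?N # par c d e @ [target p q ?N]"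
    have r: "der (4 * (fm_size ?N * fm_size ?N)) r (source p q ?N) (target p q ?N)"
      unfolding r_def by (rule der_mono[OF der_Cons[OF ap(2) source_step]]) (use src sizes in linarith)
    have cost: "20 * Z * (4 * (a * a)) + 20 * Z * (4 * (b * b)) + 6 * Z < 20 * Z * (4 * (fm_size ?N * fm_size ?N))"
      using budget[of "4 * (a * a) + 4 * (b * b)" "4 * (fm_size ?N * fm_size ?N)"] sizes ab Z_ge
      by (simp add: distrib_left)
    have "fm_size ?N \<le> fm_size ?N * fm_size ?N" using fm_size_pos[of ?N] by simp
    then have "fm_size ?N \<le> Z" using Z by linarith
    note szN = size_fm[OF this]
    have "calls f_generic (DCons (data_bool p) (DCons (data_bool q) (encode_fm ?N))) (encode r) (20 * Z * (4 * (fm_size ?N * fm_size ?N)))"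
      using callsD[OF d(1)] callsD[OF e(1)] callsD[OF pr(1)] callsD[OF ap(1)] cost szN
        size_data_bool[of p] size_data_bool[of q] Z_le_square size_fits[OF fits_der[OF r Z]]
      unfolding encode_mk
      by (cases p; cases q; intro callsI; simp add: b_generic_def Let_def r_def source_def target_def; linarith?)
    with r show ?thesis unfolding runs_def by blast
  qed
  {
    case (Or A B)
    then show ?case using *[of A B False] by simp
  next
    case (And A B)
    then show ?case using *[of A B True] by simp
  }
qed (rule generic_leaf_runs; simp)+

lemma mem_calls:
  "leaves T \<le> Z \<Longrightarrow>
    calls f_mem (DCons (DAtom a) (encode_tree T)) (data_bool (a \<in> atoms T)) (2 * leaves T - 1)"
proof (induction T)
  case (Leaf u)
  show ?case using size_tree[OF Leaf] Z_le_square
    by (intro callsI; cases u; simp add: b_mem_def data_bool_def)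
next
  case (Node l r)
  have "leaves l \<le> Z" "leaves r \<le> Z" using Node.prems by auto
  note c = callsD[OF Node.IH(1)[OF this(1)]] callsD[OF Node.IH(2)[OF this(2)]]
  show ?case
    using c size_tree[OF Node.prems] Z_le_square leaves_pos[of r] leaves_pos[of l]
      size_data_bool[of "a \<in> atoms l \<or> a \<in> atoms r"]
    by (intro callsI; simp add: b_mem_def; linarith?)
qed

lemma insert_calls:
  "leaves T < Z \<Longrightarrow>
    calls f_insert (DCons (DAtom a) (encode_tree T)) (encode_tree (insert_leaf a T)) (2 * leaves T)"
proof (induction T)
  case (Leaf u)
  have "data_size (encode_tree (Leaf u)) \<le> 1" by (cases u) auto
  then show ?case using Z_le_square
    by (intro callsI; cases u; simp add: b_insert_def)
next
  case (Node l r)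
  have "leaves r < Z" using Node.prems by auto
  note c = callsD[OF Node.IH(2)[OF this]]
  show ?case
    using c size_tree[of "Node l r"] size_tree[of "insert_leaf a (Node l r)"] Node.prems Z_le_square leaves_pos[of l]
    by (intro callsI; simp add: b_insert_def; linarith?)
qed

lemma collect_calls:
  "leaves (collect u T) < Z \<Longrightarrow> data_size u \<le> 9 * Z2 \<Longrightarrow>
    calls f_collect (DCons u (DCons (encode_tree T) (num (leaves T))))
      (DCons (encode_tree (collect u T)) (num (leaves (collect u T)))) (10 * Z * data_size u)"
proof (induction u T rule: collect.induct)
  case (1 T)
  then show ?case using Z_le_square Z_ge size_tree[of T] size_level[of "leaves T"]
    by (intro callsI; simp add: b_collect_def Let_def)
next
  case (2 a T)
  have T: "leaves T < Z" using 2 by (auto split: if_splits)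
  have m: "calls f_mem (DCons (DAtom (bar a)) (encode_tree T)) (data_bool (bar a \<in> atoms T)) (2 * leaves T - 1)"
    using T by (intro mem_calls) simp
  note i = insert_calls[OF T, of a]
  show ?case
    using callsD[OF m] callsD[OF i] 2 Z_le_square Z_ge T size_tree[of T] size_level[of "leaves T"]
      size_tree[of "insert_leaf a T"] size_level[of "Suc (leaves T)"]
    by (intro callsI; simp add: b_collect_def Let_def split: if_splits; linarith?)
next
  case (3 u v T)
  have le: "leaves (collect u T) < Z" "leaves T < Z"
    using 3(3) collect_leaves(1)[of "collect u T" v] collect_leaves(1)[of T u] by auto
  have c: "calls f_collect (DCons u (DCons (encode_tree T) (num (leaves T))))
      (DCons (encode_tree (collect u T)) (num (leaves (collect u T)))) (10 * Z * data_size u)"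
    using 3 le by (intro 3(1)) auto
  have c': "calls f_collect (DCons v (DCons (encode_tree (collect u T)) (num (leaves (collect u T)))))
      (DCons (encode_tree (collect v (collect u T))) (num (leaves (collect v (collect u T))))) (10 * Z * data_size v)"
    using 3 by (intro 3(2)) auto
  show ?case
    using callsD[OF c] callsD[OF c'] 3(3,4) Z_le_square Z_ge le size_tree[of T] size_level[of "leaves T"]
      size_tree[of "collect v (collect u T)"] size_level[of "leaves (collect v (collect u T))"]
    by (intro callsI; simp add: b_collect_def Let_def add_mult_distrib2; linarith?)
qed

end

section \<open>Derivations between threshold formulae\<close>

lemma subst_conv: "subst h (conv f g i j) = conv (\<lambda>n. subst h (f n)) (\<lambda>n. subst h (g n)) i j"
  by (induction j arbitrary: i) auto

lemma leaves_delete [simp]: "leaves (delete a T) = leaves T"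
  by (induction T) auto

text \<open>Each of the \<open>j + 1\<close> summands has two components of cost \<open>s\<close>
  and one spare unit that pays for bookkeeping calls through \<open>budget\<close>; the last 1 is
  for the final \<open>FF\<close>.\<close>

definition conv_bound :: "nat \<Rightarrow> nat \<Rightarrow> nat" where
  "conv_bound s j = (j + 1) * (2 * s + 1) + 1"

lemma conv_bound_simps: "conv_bound s 0 = 2 * s + 2" "conv_bound s (Suc j) = 2 * s + 1 + conv_bound s j"
  by (simp_all add: conv_bound_def)

text \<open>Each level of the tree multiplies the bound by roughly \<open>2 * (m + 1)\<close>, so
  the height of the tree becomes the exponent.\<close>

fun threshold_bound :: "nat \<Rightarrow> nat \<Rightarrow> nat" where
  "threshold_bound m 0 = 2"
| "threshold_bound m (Suc h) = (m + 1) * (2 * threshold_bound m h + 2) + 2"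

lemma conv_bound_le: "j \<le> m \<Longrightarrow> conv_bound (threshold_bound m h) j < threshold_bound m (Suc h)"
proof -
  assume "j \<le> m"
  then have "(j + 1) * (2 * threshold_bound m h + 1) \<le> (m + 1) * (2 * threshold_bound m h + 2)"
    by (intro mult_mono) auto
  then show ?thesis by (simp add: conv_bound_def)
qed

lemma threshold_bound_mono: "threshold_bound m h \<le> threshold_bound m (Suc h)"
  by simp

lemma threshold_bound_ge: "2 \<le> threshold_bound m h"
  by (cases h) auto

text \<open>With \<open>t\<close> bounding a whole convolution, each summand costs \<open>s\<close>
  for the recursion into the left subtree, \<open>6 * (t + 1)\<close> for the six lines of
  \<open>distribute_der\<close> and at most \<open>t\<close> for a weakening in the right subtree;
  the rest is slack for the calls.\<close>

definition succ_bound_conv :: "nat \<Rightarrow> nat \<Rightarrow> nat \<Rightarrow> nat" where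
  "succ_bound_conv s t j = (j + 1) * (s + 8 * t + 13) + 10"

fun succ_bound :: "nat \<Rightarrow> nat \<Rightarrow> nat" where
  "succ_bound m 0 = 10"
| "succ_bound m (Suc h) = succ_bound_conv (succ_bound m h) (threshold_bound m (Suc h)) m +
     4 * (threshold_bound m (Suc h) * threshold_bound m (Suc h)) + 10 * threshold_bound m (Suc h) + 10"

lemma succ_bound_conv_simps:
  "succ_bound_conv s t 0 = s + 8 * t + 23"
  "succ_bound_conv s t (Suc j) = s + 8 * t + 13 + succ_bound_conv s t j"
  by (simp_all add: succ_bound_conv_def)

lemma succ_bound_conv_mono: "j \<le> m \<Longrightarrow> succ_bound_conv s t j \<le> succ_bound_conv s t m"
  unfolding succ_bound_conv_def by (intro add_mono mult_mono) auto

context elimination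
begin

text \<open>Separates the symbolic execution of a body from the arithmetic of its cost and the
  bounds on data sizes, so that each becomes a goal of manageable size.\<close>

definition yields :: "nat \<Rightarrow> 'a data \<Rightarrow> 'a data \<Rightarrow> nat \<Rightarrow> bool" where
  "yields f u v c \<longleftrightarrow> ok [u] (cut_program ! f) \<and> ev [u] (cut_program ! f) = v \<and> cost [u] (cut_program ! f) \<le> c"

lemma calls_if_yields:
  assumes "yields f u v c" and "c < n" and "f < 31" and "data_size u \<le> W" and "data_size v \<le> W"
  shows "calls f u v n"
  using assms unfolding yields_def by (intro callsI) auto

lemma runsE:
  assumes "runs f u s A B" "s \<le> Z"
  obtains d where "calls f u (encode d) (20 * Z * s)" "der s d A B" "data_hd (encode d) = encode_fm A"
    "data_size (encode d) \<le> 9 * Z2"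
proof -
  obtain d where d: "calls f u (encode d) (20 * Z * s)" "der s d A B"
    using assms unfolding runs_def by blast
  moreover have "data_hd (encode d) = encode_fm A"
    using d(2) by (cases d) (auto simp: der_def)
  ultimately show ?thesis using that size_fits[OF fits_der[OF d(2) assms(2)]] by blast
qed

text \<open>
  The program computes derivations from \<open>before u T k\<close> to \<open>after u T k\<close>. With \<open>u = Some a\<close> this is the
  weakening from \<open>\<tau> k a\<close> to \<open>\<theta> k\<close>; with \<open>u = None\<close> the premiss provides \<open>\<theta> k\<close> itself, and the conclusion is a
  formula without atoms, which for large \<open>k\<close> equals \<open>FF\<close>.
\<close>

definition before :: "'a option \<Rightarrow> 'a tree \<Rightarrow> nat \<Rightarrow> 'a fm" where
  "before u T k = (case u of None \<Rightarrow> threshold T k | Some a \<Rightarrow> threshold (delete a T) k)"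

definition after :: "'a option \<Rightarrow> 'a tree \<Rightarrow> nat \<Rightarrow> 'a fm" where
  "after u T k = (case u of None \<Rightarrow> all_true (threshold T k) | Some a \<Rightarrow> threshold T k)"

lemma before_after_simps [simp]:
  "before None T = threshold T" "before (Some a) T = threshold (delete a T)"
  "after None T = (\<lambda>k. all_true (threshold T k))" "after (Some a) T = threshold T"
  by (auto simp: before_def after_def fun_eq_iff)

lemma before_after_Node:
  "before u (Node l r) k = conv (before u l) (before u r) 0 k"
  "after u (Node l r) k = conv (after u l) (after u r) 0 k"
  by (cases u; simp add: subst_conv)+

definition threshold_arg :: "'a option \<Rightarrow> 'a tree \<Rightarrow> nat \<Rightarrow> 'a data" where
  "threshold_arg u T k = DCons (encode_fm (leaf_fm u)) (DCons (encode_tree T) (num k))"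

definition conv_arg :: "'a option \<Rightarrow> 'a tree \<Rightarrow> 'a tree \<Rightarrow> nat \<Rightarrow> nat \<Rightarrow> 'a data" where
  "conv_arg u l r i j =
    DCons (encode_fm (leaf_fm u)) (DCons (encode_tree l) (DCons (encode_tree r) (DCons (num i) (num j))))"

lemma size_leaf_fm: "data_size (encode_fm (leaf_fm u)) = 1"
  by (cases u) auto

lemma conv_runs:
  assumes l: "\<And>n. n \<le> m \<Longrightarrow> runs f_threshold (threshold_arg u l n) s (f n) (f' n)"
    and r: "\<And>n. n \<le> m \<Longrightarrow> runs f_threshold (threshold_arg u r n) s (g n) (g' n)"
    and "leaves l + leaves r \<le> Z" "m \<le> Z"
  shows "i + j \<le> m \<Longrightarrow> conv_bound s j \<le> Z \<Longrightarrow>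
    runs f_conv (conv_arg u l r i j) (conv_bound s j) (conv f g i j) (conv f' g' i j)"
proof (induction j arbitrary: i)
  case 0
  have s: "s \<le> Z" "s + s \<le> Z" "s + s + 1 \<le> Z" using 0 by (auto simp: conv_bound_simps)
  obtain d where d: "calls f_threshold (threshold_arg u l i) (encode d) (20 * Z * s)" "der s d (f i) (f' i)"
    using 0 l[of i] unfolding runs_def by auto
  obtain e where e: "calls f_threshold (threshold_arg u r 0) (encode e) (20 * Z * s)" "der s e (g 0) (g' 0)"
    using r[of 0] unfolding runs_def by auto
  note p = parAnd_der[OF d(2) e(2) s(2)]
  note q = parOr_der[OF p(2) der_single[of FF 1] s(3)]
  have D: "der (conv_bound s 0) (par False (par True d e) [FF]) (conv f g i 0) (conv f' g' i 0)"
    using der_mono[OF q(2)] by (simp add: conv_bound_simps)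
  have "calls f_conv (conv_arg u l r i 0) (encode (par False (par True d e) [FF])) (20 * Z * conv_bound s 0)"
    using callsD[OF d(1)] callsD[OF e(1)] callsD[OF p(1)] callsD[OF q(1)] size_leaf_fm[of u]
      size_tree[of l] size_tree[of r] size_level[of i] assms(3,4) 0(1) Z_le_square size_fits[OF fits_der[OF D 0(2)]]
      budget[of "s + s" "conv_bound s 0"] Z_ge
    by (intro callsI; simp add: b_conv_def Let_def conv_arg_def threshold_arg_def distrib_left conv_bound_simps(1); linarith?)
  with D show ?case unfolding runs_def by blast
next
  case (Suc j)
  have s: "s \<le> Z" "s + s \<le> Z" "s + s + conv_bound s j \<le> Z" "conv_bound s j \<le> Z"
    using Suc by (auto simp: conv_bound_simps)
  obtain d where d: "calls f_threshold (threshold_arg u l i) (encode d) (20 * Z * s)" "der s d (f i) (f' i)"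
    using Suc.prems l[of i] unfolding runs_def by auto
  obtain e where e: "calls f_threshold (threshold_arg u r (Suc j)) (encode e) (20 * Z * s)" "der s e (g (Suc j)) (g' (Suc j))"
    using Suc.prems r[of "Suc j"] unfolding runs_def by auto
  obtain c where c: "calls f_conv (conv_arg u l r (Suc i) j) (encode c) (20 * Z * conv_bound s j)"
    "der (conv_bound s j) c (conv f g (Suc i) j) (conv f' g' (Suc i) j)"
    using Suc.prems s Suc.IH[of "Suc i"] unfolding runs_def by auto
  note p = parAnd_der[OF d(2) e(2) s(2)]
  note q = parOr_der[OF p(2) c(2) s(3)]
  have D: "der (conv_bound s (Suc j)) (par False (par True d e) c) (conv f g i (Suc j)) (conv f' g' i (Suc j))"
    using der_mono[OF q(2)] by (simp add: conv_bound_simps)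
  have "calls f_conv (conv_arg u l r i (Suc j)) (encode (par False (par True d e) c)) (20 * Z * conv_bound s (Suc j))"
    using callsD[OF d(1)] callsD[OF e(1)] callsD[OF c(1)] callsD[OF p(1)] callsD[OF q(1)] size_leaf_fm[of u]
      size_tree[of l] size_tree[of r] size_level[of i] size_level[of "Suc j"] assms(3,4) Suc.prems(1) Z_le_square
      size_fits[OF fits_der[OF D Suc.prems(2)]]
      budget[of "s + s + conv_bound s j" "conv_bound s (Suc j)"] Z_ge
    by (intro callsI; simp add: b_conv_def Let_def conv_arg_def threshold_arg_def distrib_left conv_bound_simps(2); linarith?)
  with D show ?case unfolding runs_def by blast
qed

lemma threshold_runs:
  "height T \<le> h \<Longrightarrow> k \<le> m \<Longrightarrow> m \<le> Z \<Longrightarrow> leaves T \<le> Z \<Longrightarrow> threshold_bound m h \<le> Z \<Longrightarrow>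
    runs f_threshold (threshold_arg u T k) (threshold_bound m h) (before u T k) (after u T k)"
proof (induction T arbitrary: h k)
  case (Leaf v)
  define d where "d = (if k = 0 then [TT] else if k = 1 then
    (case v of None \<Rightarrow> [FF] | Some b \<Rightarrow>
      (case u of None \<Rightarrow> [Atom b, TT] | Some a \<Rightarrow> if a = b then [FF, Atom b] else [Atom b])) else [FF])"
  have "der 2 d (before u (Leaf v) k) (after u (Leaf v) k)"
    by (auto simp: d_def der_def before_def after_def split: option.splits)
  then have D: "der (threshold_bound m h) d (before u (Leaf v) k) (after u (Leaf v) k)"
    using der_mono threshold_bound_ge by blast
  have "calls f_threshold (threshold_arg u (Leaf v) k) (encode d) 1"
  proof -
    note facts = size_leaf_fm[of u] size_leaf_fm[of v] size_level[of k] Leaf.prems Z_le_square size_fits[OF fits_der[OF D]]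
    consider "k = 0" | "k = 1" | n where "k = Suc (Suc n)" by (metis One_nat_def not0_implies_Suc)
    then show ?thesis
      using facts
      by cases (cases u; cases v; intro callsI; simp add: b_threshold_def Let_def threshold_arg_def d_def; linarith?)+
  qed
  then have "calls f_threshold (threshold_arg u (Leaf v) k) (encode d) (20 * Z * threshold_bound m h)"
    by (rule calls_mono) (use Z_ge threshold_bound_ge[of m h] in \<open>simp add: mult_le_mono\<close>)
  with D show ?case unfolding runs_def by blast
next
  case (Node l r)
  obtain h' where h: "h = Suc h'" "height l \<le> h'" "height r \<le> h'"
    using Node.prems(1) by (cases h) auto
  have le: "leaves l \<le> Z" "leaves r \<le> Z" "leaves l + leaves r \<le> Z" "threshold_bound m h' \<le> Z"
    using Node.prems(4,5) threshold_bound_mono[of m h'] unfolding h by auto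
  have b: "conv_bound (threshold_bound m h') k < threshold_bound m h"
    using conv_bound_le Node.prems(2) unfolding h by blast
  have "runs f_conv (conv_arg u l r 0 k) (conv_bound (threshold_bound m h') k)
     (conv (before u l) (before u r) 0 k) (conv (after u l) (after u r) 0 k)"
    using Node.IH h le Node.prems b by (intro conv_runs[where m = m]) auto
  then obtain d where d: "calls f_conv (conv_arg u l r 0 k) (encode d) (20 * Z * conv_bound (threshold_bound m h') k)"
    "der (conv_bound (threshold_bound m h') k) d (before u (Node l r) k) (after u (Node l r) k)"
    unfolding runs_def before_after_Node by auto
  have D: "der (threshold_bound m h) d (before u (Node l r) k) (after u (Node l r) k)"
    using der_mono[OF d(2)] b by simp
  have "calls f_threshold (threshold_arg u (Node l r) k) (encode d) (20 * Z * threshold_bound m h)"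
    using callsD[OF d(1)] size_leaf_fm[of u] size_tree[of "Node l r"] size_level[of k] Node.prems Z_le_square
      size_fits[OF fits_der[OF D]] budget[OF b] Z_ge
    by (intro callsI; simp add: b_threshold_def Let_def conv_arg_def threshold_arg_def; linarith?)
  with D show ?case unfolding runs_def by blast
qed

lemma distribute_calls:
  assumes "fm_size (Or A B) + 2 \<le> Z"
  shows "calls f_distribute (DCons (DAtom a) (encode_fm (Or A B)))
    (encode [And (Atom a) (Or A B), And (And (Atom a) (Atom a)) (Or A B), And (Atom a) (And (Atom a) (Or A B)),
      And (Atom a) (Or (And (Atom a) A) B), And (Atom a) (Or B (And (Atom a) A)),
      Or (And (Atom a) B) (And (Atom a) A)]) 1"
    (is "calls _ ?u (encode ?d) _")
proof -
  have "fits ?d" using assms Z_ge by (simp add: fits_def)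
  from size_fits[OF this] show ?thesis
    using size_fm[of "Or A B"] assms Z_le_square
    by (intro callsI; simp add: b_distribute_def Let_def; linarith?)
qed

text \<open>Distributivity is not an equation of the system. The atom is duplicated by
  cocontraction, and two switches bring one copy to each disjunct.\<close>

lemma distribute_der:
  "der (6 * (fm_size (Or A B) + 2))
    [And (Atom a) (Or A B), And (And (Atom a) (Atom a)) (Or A B), And (Atom a) (And (Atom a) (Or A B)),
      And (Atom a) (Or (And (Atom a) A) B), And (Atom a) (Or B (And (Atom a) A)),
      Or (And (Atom a) B) (And (Atom a) A)] (And (Atom a) (Or A B)) (Or (And (Atom a) B) (And (Atom a) A))"
proof -
  have "step (And (Atom a) (Or A B)) (And (And (Atom a) (Atom a)) (Or A B))"
    "step (And (And (Atom a) (Atom a)) (Or A B)) (And (Atom a) (And (Atom a) (Or A B)))"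
    "step (And (Atom a) (And (Atom a) (Or A B))) (And (Atom a) (Or (And (Atom a) A) B))"
    "step (And (Atom a) (Or (And (Atom a) A) B)) (And (Atom a) (Or B (And (Atom a) A)))"
    "step (And (Atom a) (Or B (And (Atom a) A))) (Or (And (Atom a) B) (And (Atom a) A))"
    by (intro step_ctx step_rules, intro step_feq and_assoc, intro step_ctx step_rules,
        intro step_ctx step_feq or_comm, intro step_rules)
  then show ?thesis by (auto simp: der_def)
qed

text \<open>A conjunction with \<open>FF\<close> equals \<open>FF\<close> only if the other conjunct
  is a unit, so the atom is first coweakened to \<open>TT\<close>.\<close>

lemma absorb_FF: "der 5 [And (Atom a) FF, And TT FF, FF] (And (Atom a) FF) FF"
proof -
  have "step (And (Atom a) FF) (And TT FF)" "step (And TT FF) FF"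
    by (auto intro: step_feq simp: feq_simps)
  then show ?thesis by (auto simp: der_def)
qed

text \<open>In every summand the atom is spent in the left subtree, where it raises the index by
  one, while the deletion in the right subtree is undone by weakening. So all left indices are
  shifted by one.\<close>

lemma succ_conv_runs:
  assumes S: "\<And>n. n < m \<Longrightarrow> runs f_succ (threshold_arg (Some a) l n) s
      (And (Atom a) (threshold (delete a l) n)) (threshold l (Suc n))"
    and h: "height l \<le> h" "height r \<le> h" and t: "t = threshold_bound m (Suc h)"
    and "leaves l + leaves r \<le> Z" "m \<le> Z"
  shows "i + j < m \<Longrightarrow> succ_bound_conv s t j \<le> Z \<Longrightarrow>
    runs f_succ_conv (conv_arg (Some a) l r i j) (succ_bound_conv s t j)
      (And (Atom a) (conv (threshold (delete a l)) (threshold (delete a r)) i j))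
      (conv (threshold l) (threshold r) (Suc i) j)"
proof (induction j arbitrary: i rule: less_induct)
  case (less j i)
  let ?f = "threshold (delete a l)" and ?g = "threshold (delete a r)"
  let ?C = "conv ?f ?g i j"
  \<comment> \<open>\<open>R\<close> and \<open>R'\<close> are what follows the first summand,
    before and after: the remaining convolution, or the final \<open>FF\<close>. In the latter case
    \<open>absorb_FF\<close> takes the place of the recursive call, whence the 5 in
    \<open>K\<close>.\<close>
  define R where "R = (if j = 0 then FF else conv ?f ?g (Suc i) (j - 1))"
  define R' where "R' = (if j = 0 then FF else conv (threshold l) (threshold r) (Suc (Suc i)) (j - 1))"
  define K where "K = (if j = 0 then 5 else succ_bound_conv s t (j - 1))"
  have C: "?C = Or (And (?f i) (?g j)) R"
    "conv (threshold l) (threshold r) (Suc i) j = Or (And (threshold l (Suc i)) (threshold r j)) R'"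
    by (cases j; simp add: R_def R'_def)+
  have K: "K + s + 8 * t + 13 \<le> succ_bound_conv s t j"
    by (cases j) (simp_all add: K_def succ_bound_conv_simps)
  have tb: "threshold_bound m h \<le> t" unfolding t by simp
  have T: "runs f_threshold (threshold_arg (Some a) T n) (threshold_bound m h) (before (Some a) T n) (after (Some a) T n)"
    if "n \<le> m" "T = l \<or> T = r" for n T
    using that h assms(5,6) K less.prems tb by (intro threshold_runs) auto
  have cb: "conv_bound (threshold_bound m h) j < t"
    using less.prems unfolding t by (intro conv_bound_le) simp
  have "runs f_conv (conv_arg (Some a) l r i j) (conv_bound (threshold_bound m h) j)
     (conv (before (Some a) l) (before (Some a) r) i j) (conv (after (Some a) l) (after (Some a) r) i j)"
    using T assms(5,6) less.prems cb K by (intro conv_runs[where m = m]) auto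
  then obtain c where c: "calls f_conv (conv_arg (Some a) l r i j) (encode c) (20 * Z * conv_bound (threshold_bound m h) j)"
    "der (conv_bound (threshold_bound m h) j) c ?C (conv (after (Some a) l) (after (Some a) r) i j)" "data_hd (encode c) = encode_fm ?C"
    using cb K less.prems by (elim runsE) auto
  have sC: "fm_size ?C + 2 \<le> t + 1" using der_sizes(1)[OF c(2)] cb by simp
  obtain d where d: "calls f_succ (threshold_arg (Some a) l i) (encode d) (20 * Z * s)"
    "der s d (And (Atom a) (?f i)) (threshold l (Suc i))"
    using less.prems S[of i] unfolding runs_def by auto
  obtain e where e: "calls f_threshold (threshold_arg (Some a) r j) (encode e) (20 * Z * threshold_bound m h)"
    "der (threshold_bound m h) e (?g j) (threshold r j)"
    using less.prems T[of j r] unfolding runs_def by auto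
  obtain k where k: "j = 0 \<Longrightarrow> k = [And (Atom a) FF, And TT FF, FF]"
    "j \<noteq> 0 \<Longrightarrow> calls f_succ_conv (conv_arg (Some a) l r (Suc i) (j - 1)) (encode k) (20 * Z * K)"
    "der K k (And (Atom a) R) R'"
  proof (cases "j = 0")
    case True
    then show ?thesis using that absorb_FF[of a] by (simp add: K_def R_def R'_def)
  next
    case False
    then have "runs f_succ_conv (conv_arg (Some a) l r (Suc i) (j - 1)) K (And (Atom a) R) R'"
      using less.IH[of "j - 1" "Suc i"] less.prems K unfolding K_def R_def R'_def by simp
    then show ?thesis using that False unfolding runs_def by auto
  qed
  note D = distribute_calls[of "And (?f i) (?g j)" R a]
  note Dd = distribute_der[of "And (?f i) (?g j)" R a]
  have z1: "s + threshold_bound m h \<le> Z" and z2: "s + threshold_bound m h + K \<le> Z"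
    using K tb less.prems by linarith+
  note p = parAnd_der[OF d(2) e(2) z1]
  note q = parOr_der[OF p(2) k(3) z2]
  have st: "step (Or (And (Atom a) R) (And (Atom a) (And (?f i) (?g j))))
    (Or (And (And (Atom a) (?f i)) (?g j)) (And (Atom a) R))"
    by (intro step_feq) (simp add: feq_simps)
  have z3: "6 * (fm_size (Or (And (?f i) (?g j)) R) + 2) + (s + threshold_bound m h + K) < succ_bound_conv s t j"
    using sC tb K unfolding C by simp
  have z4: "6 * (fm_size (Or (And (?f i) (?g j)) R) + 2) + (s + threshold_bound m h + K) \<le> Z"
    using z3 less.prems by linarith
  note ap = append_der[OF Dd q(2) z4 st]
  have z5: "fm_size (Or (And (?f i) (?g j)) R) + 2 \<le> Z" using z4 by simp
  note F = der_mono[OF ap(2) less_imp_le[OF z3]]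
  have b: "conv_bound (threshold_bound m h) j + s + threshold_bound m h + K < succ_bound_conv s t j"
    using cb tb K by linarith
  let ?L = "[And (Atom a) (Or (And (?f i) (?g j)) R),
    And (And (Atom a) (Atom a)) (Or (And (?f i) (?g j)) R), And (Atom a) (And (Atom a) (Or (And (?f i) (?g j)) R)),
    And (Atom a) (Or (And (Atom a) (And (?f i) (?g j))) R), And (Atom a) (Or R (And (Atom a) (And (?f i) (?g j)))),
    Or (And (Atom a) R) (And (Atom a) (And (?f i) (?g j)))]"
  let ?c = "20 * Z * conv_bound (threshold_bound m h) j + 20 * Z * s + 20 * Z * threshold_bound m h + 20 * Z * K + (8 * Z + 1)"
  have "calls f_succ_conv (conv_arg (Some a) l r i j) (encode (?L @ par False (par True d e) k)) (20 * Z * succ_bound_conv s t j)"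
  proof (rule calls_if_yields[where c = ?c])
    show "yields f_succ_conv (conv_arg (Some a) l r i j) (encode (?L @ par False (par True d e) k)) ?c"
      using callsD[OF c(1)] c(3) callsD[OF d(1)] callsD[OF e(1)] k(1) callsD[OF k(2)] callsD[OF p(1)] callsD[OF q(1)]
        callsD[OF D[OF z5]] callsD[OF ap(1)]
      unfolding C
      by (cases j; simp add: yields_def b_succ_conv_def Let_def conv_arg_def threshold_arg_def)
    show "?c < 20 * Z * succ_bound_conv s t j"
      using budget[OF b] Z_ge by (simp add: distrib_left)
  qed (use size_tree[of l] size_tree[of r] size_level[of i] size_level[of j] assms(5,6) less.prems(1) Z_le_square
      size_fits[OF fits_der[OF F less.prems(2)]] in \<open>simp_all add: conv_arg_def\<close>)
  with F show ?case unfolding runs_def C by blast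
qed

lemma weaken_left_calls:
  assumes "4 * (fm_size A * fm_size A) + fm_size B \<le> Z"
  shows "runs f_weaken_left (encode_fm (Or A B)) (4 * (fm_size A * fm_size A) + fm_size B + 1) (Or FF B) (Or A B)"
proof -
  have z: "4 * (fm_size A * fm_size A) \<le> Z" using assms by simp
  obtain d where d: "calls f_generic (DCons DNil (DCons DNil (encode_fm A))) (encode d) (20 * Z * (4 * (fm_size A * fm_size A)))"
    "der (4 * (fm_size A * fm_size A)) d FF A"
    using generic_runs[OF z, of False False] unfolding runs_def source_def target_def by auto
  note p = parOr_der[OF d(2) der_single[of B "fm_size B", OF order_refl] assms]
  have "fm_size A \<le> fm_size A * fm_size A" using fm_size_pos[of A] by simp
  then have "fm_size A \<le> Z" "fm_size B \<le> Z" using assms by linarith+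
  note sz = size_fm[OF this(1)] size_fm[OF this(2)]
  have "calls f_weaken_left (encode_fm (Or A B)) (encode (par False d [B])) (20 * Z * (4 * (fm_size A * fm_size A) + fm_size B + 1))"
    using callsD[OF d(1)] callsD[OF p(1)] sz Z_le_square Z_ge size_fits[OF fits_der[OF p(2) assms]]
      budget[of "4 * (fm_size A * fm_size A)" "4 * (fm_size A * fm_size A) + fm_size B + 1"]
    by (intro callsI; simp add: b_weaken_left_def distrib_left; linarith?)
  then show ?thesis using der_mono[OF p(2)] unfolding runs_def by fastforce
qed

lemma succ_runs:
  "a \<in> atoms T \<Longrightarrow> height T \<le> h \<Longrightarrow> k < m \<Longrightarrow> m \<le> Z \<Longrightarrow> leaves T \<le> Z \<Longrightarrow> succ_bound m h \<le> Z \<Longrightarrow>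
    runs f_succ (threshold_arg (Some a) T k) (succ_bound m h)
      (And (Atom a) (threshold (delete a T) k)) (threshold T (Suc k))"
proof (induction T arbitrary: h k)
  case (Leaf v)
  then have v: "v = Some a" by (cases v) auto
  define d where "d = (if k = 0 then [And (Atom a) TT, Atom a] else [And (Atom a) FF, And TT FF, FF])"
  have "der 5 d (And (Atom a) (threshold (delete a (Leaf v)) k)) (threshold (Leaf v) (Suc k))"
    using absorb_FF[of a] step_feq[OF and_unit, of "Atom a"] by (auto simp: d_def v der_def)
  then have D: "der (succ_bound m h) d (And (Atom a) (threshold (delete a (Leaf v)) k)) (threshold (Leaf v) (Suc k))"
    by (rule der_mono) (cases h; simp)
  have "calls f_succ (threshold_arg (Some a) (Leaf v) k) (encode d) 1"
    using size_level[of k] Leaf.prems Z_le_square size_fits[OF fits_der[OF D]]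
    by (cases k; intro callsI; simp add: b_succ_def Let_def threshold_arg_def d_def v; linarith?)
  then have "calls f_succ (threshold_arg (Some a) (Leaf v) k) (encode d) (20 * Z * succ_bound m h)"
    by (rule calls_mono) (use Z_ge in \<open>cases h; simp\<close>)
  with D show ?case unfolding runs_def by blast
next
  case (Node l r)
  obtain h' where h: "h = Suc h'" "height l \<le> h'" "height r \<le> h'"
    using Node.prems(2) by (cases h) auto
  define t where "t = threshold_bound m (Suc h')"
  have bound: "succ_bound m h = succ_bound_conv (succ_bound m h') t m + 4 * (t * t) + 10 * t + 10"
    unfolding h t_def by simp
  have t2: "2 \<le> t" unfolding t_def by (rule threshold_bound_ge)
  have le: "leaves l \<le> Z" "leaves r \<le> Z" "leaves l + leaves r \<le> Z" "t \<le> Z"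
    using Node.prems(5,6) bound by auto
  have sb: "succ_bound m h' \<le> succ_bound_conv (succ_bound m h') t m"
    by (simp add: succ_bound_conv_def)
  \<comment> \<open>After the shift, the convolution has every summand of the threshold at level
    \<open>Suc k\<close> except the one with left index 0; this one is added by weakening.\<close>
  have node: "runs f_succ_node (DCons (DAtom a) (DCons (encode_tree l) (DCons (encode_tree r) (num k))))
     (succ_bound_conv (succ_bound m h') t m + 4 * (t * t) + 3 * t + 2)
     (And (Atom a) (conv (threshold (delete a l)) (threshold (delete a r)) 0 k))
     (threshold (Node l r) (Suc k))"
    if a: "a \<in> atoms l" and IH: "\<And>h k. a \<in> atoms l \<Longrightarrow> height l \<le> h \<Longrightarrow> k < m \<Longrightarrow> m \<le> Z \<Longrightarrow> leaves l \<le> Z \<Longrightarrow> succ_bound m h \<le> Z \<Longrightarrow>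
       runs f_succ (threshold_arg (Some a) l k) (succ_bound m h)
      (And (Atom a) (threshold (delete a l) k)) (threshold l (Suc k))"
      and h: "height l \<le> h'" "height r \<le> h'" and le: "leaves l + leaves r \<le> Z" for l r
  proof -
    let ?f = "threshold l" and ?g = "threshold r"
    define R where "R = conv ?f ?g (Suc 0) k"
    have sm: "succ_bound_conv (succ_bound m h') t k \<le> succ_bound_conv (succ_bound m h') t m"
      using Node.prems(3) by (intro succ_bound_conv_mono) simp
    have "runs f_succ_conv (conv_arg (Some a) l r 0 k) (succ_bound_conv (succ_bound m h') t k)
      (And (Atom a) (conv (threshold (delete a l)) (threshold (delete a r)) 0 k)) R"
      unfolding R_def
    proof (rule succ_conv_runs[where m = m, OF _ h])
      show "runs f_succ (threshold_arg (Some a) l n) (succ_bound m h') (And (Atom a) (threshold (delete a l) n)) (threshold l (Suc n))"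
        if "n < m" for n using that IH a h le Node.prems(4,6) sb bound by auto
    qed (use le Node.prems sm bound in \<open>auto simp: t_def\<close>)
    then obtain d where d: "calls f_succ_conv (conv_arg (Some a) l r 0 k) (encode d) (20 * Z * succ_bound_conv (succ_bound m h') t k)"
      "der (succ_bound_conv (succ_bound m h') t k) d (And (Atom a) (conv (threshold (delete a l)) (threshold (delete a r)) 0 k)) R"
      unfolding runs_def by blast
    have cb: "conv_bound (threshold_bound m h') (Suc k) < t"
      using Node.prems(3) unfolding t_def by (intro conv_bound_le) simp
    have th: "runs f_threshold (threshold_arg None T n) (threshold_bound m h') (before None T n) (after None T n)"
      if "n \<le> m" "T = l \<or> T = r" for n T
      using that h le Node.prems(4,6) bound by (intro threshold_runs) (auto simp: t_def)
    have "runs f_conv (conv_arg None l r 0 (Suc k)) (conv_bound (threshold_bound m h') (Suc k))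
       (conv (before None l) (before None r) 0 (Suc k)) (conv (after None l) (after None r) 0 (Suc k))"
      using th le Node.prems cb bound by (intro conv_runs[where m = m]) auto
    then obtain c where c: "calls f_conv (conv_arg None l r 0 (Suc k)) (encode c) (20 * Z * conv_bound (threshold_bound m h') (Suc k))"
      "der (conv_bound (threshold_bound m h') (Suc k)) c (Or (And (?f 0) (?g (Suc k))) R) (conv (after None l) (after None r) 0 (Suc k))"
      "data_hd (encode c) = encode_fm (Or (And (?f 0) (?g (Suc k))) R)"
      using cb bound Node.prems(6) by (elim runsE) (auto simp: R_def)
    let ?A = "And (?f 0) (?g (Suc k))"
    have szs: "fm_size ?A + fm_size R \<le> t" using der_sizes(1)[OF c(2)] cb by simp
    then have sq: "fm_size ?A * fm_size ?A \<le> t * t" by (intro mult_mono) auto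
    have z: "4 * (fm_size ?A * fm_size ?A) + fm_size R \<le> Z" using szs sq bound Node.prems(6) by linarith
    obtain w where w: "calls f_weaken_left (encode_fm (Or ?A R)) (encode w) (20 * Z * (4 * (fm_size ?A * fm_size ?A) + fm_size R + 1))"
      "der (4 * (fm_size ?A * fm_size ?A) + fm_size R + 1) w (Or FF R) (Or ?A R)"
      using weaken_left_calls[OF z] unfolding runs_def by blast
    have st: "step R (Or FF R)" by (intro step_feq) (simp add: feq_iff_class R_def class_units)
    have z2: "succ_bound_conv (succ_bound m h') t k + (4 * (fm_size ?A * fm_size ?A) + fm_size R + 1) \<le> Z"
      using szs sq bound Node.prems(6) sm by linarith
    note ap = append_der[OF d(2) w(2) z2 st]
    have b: "succ_bound_conv (succ_bound m h') t k + (4 * (fm_size ?A * fm_size ?A) + fm_size R + 1) + conv_bound (threshold_bound m h') (Suc k)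
        < succ_bound_conv (succ_bound m h') t m + 4 * (t * t) + 3 * t + 2"
      using szs sq sm cb by linarith
    have "calls f_succ_node (DCons (DAtom a) (DCons (encode_tree l) (DCons (encode_tree r) (num k)))) (encode (d @ w))
       (20 * Z * (succ_bound_conv (succ_bound m h') t m + 4 * (t * t) + 3 * t + 2))"
      using callsD[OF d(1)] callsD[OF w(1)] callsD[OF c(1)] callsD[OF ap(1)] c(3) budget[OF b] Z_ge
        size_tree[of l] size_tree[of r] size_level[of k] le Node.prems(3,4) Z_le_square
        size_fits[OF fits_der[OF ap(2) z2]]
      by (intro callsI; simp add: b_succ_node_def Let_def conv_arg_def distrib_left; linarith?)
    moreover have "der (succ_bound_conv (succ_bound m h') t m + 4 * (t * t) + 3 * t + 2) (d @ w)
      (And (Atom a) (conv (threshold (delete a l)) (threshold (delete a r)) 0 k)) (threshold (Node l r) (Suc k))"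
      using der_mono[OF ap(2)] b by (simp add: R_def)
    ultimately show ?thesis unfolding runs_def by blast
  qed
  \<comment> \<open>\<open>node\<close> expects the atom in the left subtree. Otherwise the children
    are exchanged by an equality step at both ends of the derivation.\<close>
  define l' r' where "l' = (if a \<in> atoms l then l else r)" and "r' = (if a \<in> atoms l then r else l)"
  let ?s = "succ_bound_conv (succ_bound m h') t m + 4 * (t * t) + 3 * t + 2"
  have "runs f_succ_node (DCons (DAtom a) (DCons (encode_tree l') (DCons (encode_tree r') (num k)))) ?s
     (And (Atom a) (conv (threshold (delete a l')) (threshold (delete a r')) 0 k)) (threshold (Node l' r') (Suc k))"
    using node[of l r] node[of r l] Node.IH h le Node.prems(1) by (auto simp: l'_def r'_def)
  then obtain d where d: "calls f_succ_node (DCons (DAtom a) (DCons (encode_tree l') (DCons (encode_tree r') (num k)))) (encode d) (20 * Z * ?s)"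
    "der ?s d (And (Atom a) (conv (threshold (delete a l')) (threshold (delete a r')) 0 k)) (threshold (Node l' r') (Suc k))"
    unfolding runs_def by blast
  have th: "runs f_threshold (threshold_arg u (Node l r) n) t (before u (Node l r) n) (after u (Node l r) n)"
    if "n \<le> m" for n u
    using that h le Node.prems unfolding t_def by (intro threshold_runs) auto
  obtain x where x: "calls f_threshold (threshold_arg (Some a) (Node l r) k) (encode x) (20 * Z * t)"
    "data_hd (encode x) = encode_fm (threshold (delete a (Node l r)) k)" "der t x (threshold (delete a (Node l r)) k) (threshold (Node l r) k)"
    using th[OF less_imp_le[OF Node.prems(3)], of "Some a"] le by (elim runsE) auto
  obtain y where y: "calls f_threshold (threshold_arg None (Node l r) (Suc k)) (encode y) (20 * Z * t)"
    "data_hd (encode y) = encode_fm (threshold (Node l r) (Suc k))" "der t y (threshold (Node l r) (Suc k)) (all_true (threshold (Node l r) (Suc k)))"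
    using th[OF Suc_leI[OF Node.prems(3)], of None] le by (elim runsE) auto
  have sx: "fm_size (threshold (delete a (Node l r)) k) \<le> t" and sy: "fm_size (threshold (Node l r) (Suc k)) \<le> t"
    using der_sizes[OF x(3)] der_sizes[OF y(3)] by auto
  have st1: "step (And (Atom a) (threshold (delete a (Node l r)) k))
      (And (Atom a) (conv (threshold (delete a l')) (threshold (delete a r')) 0 k))"
    unfolding l'_def r'_def by (cases "a \<in> atoms l"; simp add: step_refl; rule step_ctx(4)[OF step_feq[OF conv_comm]])
  have st2: "step (threshold (Node l' r') (Suc k)) (threshold (Node l r) (Suc k))"
    using threshold_swap by (auto intro!: step_feq intro: feq_refl simp: l'_def r'_def simp del: threshold.simps)
  have z: "?s + t \<le> Z" using bound Node.prems(6) by linarith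
  note ap = append_der[OF d(2) der_single[OF sy] z st2]
  note F = der_Cons[OF ap(2) st1]
  have b: "?s + t + t + t < succ_bound m h" unfolding bound by linarith
  have F': "der (succ_bound m h) (And (Atom a) (threshold (delete a (Node l r)) k) # d @ [threshold (Node l r) (Suc k)])
      (And (Atom a) (threshold (delete a (Node l r)) k)) (threshold (Node l r) (Suc k))"
    using sx by (intro der_mono[OF F]) (simp add: bound)
  have m: "calls f_mem (DCons (DAtom a) (encode_tree l)) (data_bool (a \<in> atoms l)) (2 * leaves l - 1)"
    using le by (intro mem_calls)
  let ?c = "20 * Z * ?s + 20 * Z * t + 20 * Z * t + (4 * Z + 1)"
  have "calls f_succ (threshold_arg (Some a) (Node l r) k)
     (encode (And (Atom a) (threshold (delete a (Node l r)) k) # d @ [threshold (Node l r) (Suc k)])) (20 * Z * succ_bound m h)"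
    (is "calls _ ?u ?v _")
  proof (rule calls_if_yields[where c = ?c])
    show "yields f_succ ?u ?v ?c"
      using callsD[OF d(1)] callsD[OF x(1)] callsD[OF y(1)] callsD[OF ap(1)] x(2) y(2) callsD[OF m] le
      by (cases "a \<in> atoms l"; simp add: yields_def b_succ_def Let_def threshold_arg_def l'_def r'_def del: threshold.simps delete.simps)
    show "?c < 20 * Z * succ_bound m h"
      using budget[OF b] Z_ge by (simp add: distrib_left)
  qed (use size_tree[of "Node l r"] size_level[of k] Node.prems(3,4,5) Z_le_square
      size_fits[OF fits_der[OF F' Node.prems(6)]] in \<open>simp_all add: threshold_arg_def\<close>)
  with F' show ?case unfolding runs_def by blast
qed

end

section \<open>Substituting thresholds for negative atoms, and pulling formulae out\<close>

fun fm_atoms :: "'a fm \<Rightarrow> 'a set" where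
  "fm_atoms FF = {}"
| "fm_atoms TT = {}"
| "fm_atoms (Atom a) = {a}"
| "fm_atoms (Or A B) = fm_atoms A \<union> fm_atoms B"
| "fm_atoms (And A B) = fm_atoms A \<union> fm_atoms B"

lemma subst_size: "(\<And>a. a \<in> fm_atoms A \<Longrightarrow> fm_size (f a) \<le> t) \<Longrightarrow> 1 \<le> t \<Longrightarrow> fm_size (subst f A) \<le> fm_size A * t"
proof (induction A)
  case (Or A B)
  then show ?case using add_mono[OF Or.IH(1) Or.IH(2)] by (simp add: add_mult_distrib)
next
  case (And A B)
  then show ?case using add_mono[OF And.IH(1) And.IH(2)] by (simp add: add_mult_distrib)
qed auto

text \<open>Connects the two views of \<open>\<tau> k a\<close>: the program computes it from a tree
  with deleted leaves, whereas pulling \<open>a\<close> out of \<open>\<theta> k\<close> replaces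
  atoms in a formula.\<close>

lemma subst_delete: "subst (\<lambda>b. if b = a then FF else Atom b) (threshold T k) = threshold (delete a T) k"
proof (induction T arbitrary: k)
  case (Leaf u)
  then show ?case by (cases u) auto
next
  case (Node l r)
  have "(\<lambda>n. subst (\<lambda>b. if b = a then FF else Atom b) (threshold l n)) = threshold (delete a l)"
    "(\<lambda>n. subst (\<lambda>b. if b = a then FF else Atom b) (threshold r n)) = threshold (delete a r)"
    using Node by auto
  then show ?case by (simp add: subst_conv)
qed

lemma encode_fm_eq_leaf [simp]:
  "encode_fm A = DNil \<longleftrightarrow> A = FF" "encode_fm A = DCons DNil DNil \<longleftrightarrow> A = TT"
  "encode_fm A = DAtom a \<longleftrightarrow> A = Atom a" "is_DAtom (encode_fm A) \<longleftrightarrow> (\<exists>a. A = Atom a)"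
  by (cases A; auto)+

locale simulation = elimination +
  fixes T :: "'a tree" and m h B :: nat
  assumes height: "height T \<le> h"
    and levels: "m \<le> B"
    and leaves: "leaves T \<le> B"
    and succ_bound: "succ_bound m h \<le> B"
    and threshold_bound: "threshold_bound m h \<le> B"
    and consistent: "\<And>a. a \<in> atoms T \<Longrightarrow> bar a \<notin> atoms T"
    and root: "\<And>a. T \<noteq> Leaf (Some a)"
    and room: "30 * (40 * (B * (4 * (B * B)))) \<le> Z"
begin

text \<open>The bound of \<open>generic_runs\<close> for a formula of size \<open>B\<close>; it also
  dominates any fixed small multiple of \<open>B\<close>.\<close>

definition G :: nat where
  "G = 4 * (B * B)"

text \<open>Bounds a pull through a formula of size at most \<open>B\<close>, at
  \<open>40 * G\<close> per unit or atom occurrence.\<close>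

definition U :: nat where
  "U = 40 * (B * G)"

lemma B_pos: "10 \<le> B"
  using succ_bound by (cases h) auto

lemma G_ge: "B \<le> G" "40 * B \<le> G"
  using mult_le_mono[OF B_pos order_refl[of B]] by (auto simp: G_def)

lemma U_ge: "400 * G \<le> U"
  using mult_le_mono[OF B_pos order_refl[of G]] by (auto simp: U_def)

lemma room': "30 * U \<le> Z" "B \<le> Z" "G \<le> Z" "U \<le> Z"
proof -
  show "30 * U \<le> Z" using room by (simp add: U_def G_def)
  then show "B \<le> Z" "G \<le> Z" "U \<le> Z" using U_ge G_ge by linarith+
qed

definition \<theta> :: "nat \<Rightarrow> 'a fm" where
  "\<theta> = threshold T"

definition \<tau> :: "nat \<Rightarrow> 'a \<Rightarrow> 'a fm" where
  "\<tau> k a = threshold (delete a T) k"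

definition \<sigma> :: "nat \<Rightarrow> 'a \<Rightarrow> 'a fm" where
  "\<sigma> k a = (if a \<in> atoms T then Atom a else \<tau> k (bar a))"

definition env :: "nat \<Rightarrow> 'a data" where
  "env k = DCons (encode_tree T) (DCons (num k) (DCons (encode_fm (\<theta> k)) (encode_fm (\<theta> (Suc k)))))"

text \<open>An occurrence grows to size at most \<open>threshold_bound m h\<close> under
  \<open>\<sigma> k\<close>, so the product keeps the image of \<open>A\<close> below
  \<open>B\<close>. The extra 1 pays for the calls made while substituting.\<close>

definition covered :: "'a fm \<Rightarrow> bool" where
  "covered A \<longleftrightarrow> fm_size A * (threshold_bound m h + 1) \<le> B \<and> (\<forall>a\<in>fm_atoms A. a \<in> atoms T \<or> bar a \<in> atoms T)"

lemma theta_run: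
  "k \<le> m \<Longrightarrow> runs f_threshold (threshold_arg None T k) (threshold_bound m h) (\<theta> k) (all_true (\<theta> k))"
  using threshold_runs[OF height, of k m None] levels leaves threshold_bound room' by (simp add: \<theta>_def)

lemma tau_run:
  "k \<le> m \<Longrightarrow> runs f_threshold (threshold_arg (Some a) T k) (threshold_bound m h) (\<tau> k a) (\<theta> k)"
  using threshold_runs[OF height, of k m "Some a"] levels leaves threshold_bound room' by (simp add: \<tau>_def \<theta>_def)

lemma succ_run:
  "k < m \<Longrightarrow> a \<in> atoms T \<Longrightarrow> runs f_succ (threshold_arg (Some a) T k) (succ_bound m h)
     (And (Atom a) (\<tau> k a)) (\<theta> (Suc k))"
  using succ_runs[OF _ height, of a k m] levels leaves succ_bound room' by (simp add: \<tau>_def \<theta>_def)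

lemma theta_size: "k \<le> m \<Longrightarrow> fm_size (\<theta> k) \<le> B"
  using theta_run[of k] threshold_bound der_sizes(1) unfolding runs_def by (meson le_trans)

lemma tau_size: "k \<le> m \<Longrightarrow> fm_size (\<tau> k a) \<le> threshold_bound m h"
  using tau_run[of k a] der_sizes(1) unfolding runs_def by meson

lemma sigma_size: "k \<le> m \<Longrightarrow> fm_size (\<sigma> k a) \<le> threshold_bound m h"
  using tau_size threshold_bound_ge[of m h] by (simp add: \<sigma>_def)

lemma covered_sizes:
  assumes "covered A" "k \<le> m" shows "fm_size A \<le> B" "fm_size (subst (\<sigma> k) A) \<le> B"
proof -
  have "fm_size A * 1 \<le> fm_size A * (threshold_bound m h + 1)" by (intro mult_le_mono2) simp
  then show "fm_size A \<le> B" using assms by (simp add: covered_def)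
  have "fm_size (subst (\<sigma> k) A) \<le> fm_size A * threshold_bound m h"
    using sigma_size[OF assms(2)] threshold_bound_ge[of m h] by (intro subst_size) auto
  then show "fm_size (subst (\<sigma> k) A) \<le> B" using assms by (simp add: covered_def)
qed

lemma covered_data_sizes:
  assumes "covered A" "k \<le> m"
  shows "data_size (encode_fm A) \<le> Z2" "data_size (encode_fm (subst (\<sigma> k) A)) \<le> Z2"
  using covered_sizes[OF assms] room' by (auto intro: size_fm)

lemma covered_mk: "covered (mk c A A') \<Longrightarrow> covered A \<and> covered A'"
  unfolding covered_def by (cases c; simp add: add_mult_distrib)

lemma size_env: "k < m \<Longrightarrow> data_size (env k) \<le> 5 * Z2"
  using size_tree[of T] size_level[of k] size_fm[of "\<theta> k"] size_fm[of "\<theta> (Suc k)"] theta_size[of k] theta_size[of "Suc k"]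
    leaves levels room' Z_le_square by (simp add: env_def)

lemma subst_calls_mk:
  assumes k: "k < m" and cov: "covered (mk c A A')"
    and n1: "\<exists>n. calls f_subst (DCons (env k) (encode_fm A)) (encode_fm (subst (\<sigma> k) A)) n \<and>
      n + Z \<le> 20 * Z * (fm_size A * (threshold_bound m h + 1))"
    and n2: "\<exists>n. calls f_subst (DCons (env k) (encode_fm A')) (encode_fm (subst (\<sigma> k) A')) n \<and>
      n + Z \<le> 20 * Z * (fm_size A' * (threshold_bound m h + 1))"
  shows "\<exists>n. calls f_subst (DCons (env k) (encode_fm (mk c A A'))) (encode_fm (subst (\<sigma> k) (mk c A A'))) n \<and>
      n + Z \<le> 20 * Z * (fm_size (mk c A A') * (threshold_bound m h + 1))"
proof -
  obtain n1 n2 where n: "calls f_subst (DCons (env k) (encode_fm A)) (encode_fm (subst (\<sigma> k) A)) n1"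
    "n1 + Z \<le> 20 * Z * (fm_size A * (threshold_bound m h + 1))"
    "calls f_subst (DCons (env k) (encode_fm A')) (encode_fm (subst (\<sigma> k) A')) n2"
    "n2 + Z \<le> 20 * Z * (fm_size A' * (threshold_bound m h + 1))"
    using n1 n2 by blast
  let ?c = "n1 + n2"
  have "calls f_subst (DCons (env k) (encode_fm (mk c A A'))) (encode_fm (subst (\<sigma> k) (mk c A A'))) (n1 + n2 + 1)"
  proof (rule calls_if_yields[where c = ?c])
    show "yields f_subst (DCons (env k) (encode_fm (mk c A A'))) (encode_fm (subst (\<sigma> k) (mk c A A'))) ?c"
      using callsD[OF n(1)] callsD[OF n(3)]
      by (cases c) (simp_all add: yields_def b_subst_def Let_def)
  qed (use size_env[OF k] Z_le_square covered_data_sizes[OF cov less_imp_le[OF k]] in simp_all)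
  then show ?thesis by (intro exI conjI) (use n(2,4) Z_ge in \<open>simp_all add: distrib_left add_mult_distrib, linarith?\<close>)
qed

lemma subst_calls_aux:
  "k < m \<Longrightarrow> covered A \<Longrightarrow>
    \<exists>n. calls f_subst (DCons (env k) (encode_fm A)) (encode_fm (subst (\<sigma> k) A)) n \<and>
      n + Z \<le> 20 * Z * (fm_size A * (threshold_bound m h + 1))"
proof (induction A)
  case FF
  show ?case using size_env[OF FF(1)] Z_le_square Z_ge
    by (intro exI[of _ 1] conjI callsI; simp add: b_subst_def Let_def)
next
  case TT
  show ?case using size_env[OF TT(1)] Z_le_square Z_ge
    by (intro exI[of _ 1] conjI callsI; simp add: b_subst_def Let_def)
next
  case (Atom a)
  let ?n = "20 * Z * threshold_bound m h + 3 * Z"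
  have mem: "calls f_mem (DCons (DAtom a) (encode_tree T)) (data_bool (a \<in> atoms T)) (2 * leaves T - 1)"
    using leaves room' by (intro mem_calls) simp
  obtain d where d: "calls f_threshold (threshold_arg (Some (bar a)) T k) (encode d) (20 * Z * threshold_bound m h)"
    "data_hd (encode d) = encode_fm (\<tau> k (bar a))"
    using tau_run[OF less_imp_le[OF Atom.prems(1)], of "bar a"] threshold_bound room'(2) by (elim runsE) auto
  let ?c = "20 * Z * threshold_bound m h + 2 * Z"
  have "calls f_subst (DCons (env k) (encode_fm (Atom a))) (encode_fm (subst (\<sigma> k) (Atom a))) ?n"
  proof (rule calls_if_yields[where c = ?c])
    show "yields f_subst (DCons (env k) (encode_fm (Atom a))) (encode_fm (subst (\<sigma> k) (Atom a))) ?c"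
      using callsD[OF mem] callsD[OF d(1)] d(2) leaves room'
      by (simp add: yields_def b_subst_def Let_def env_def threshold_arg_def \<sigma>_def) linarith
  qed (use size_env[OF Atom(1)] Z_le_square Z_ge covered_data_sizes(2)[OF Atom(2) less_imp_le[OF Atom(1)]] in simp_all)
  moreover have "20 * Z * threshold_bound m h + 3 * Z + Z \<le> 20 * Z * (fm_size (Atom a) * (threshold_bound m h + 1))"
    by (simp only: fm_size.simps mult_1 distrib_left mult_1_right)
  ultimately show ?case by blast
next
  case (Or A A')
  show ?case using subst_calls_mk[of k False A A'] Or.IH Or.prems covered_mk[of False A A'] by simp
next
  case (And A A')
  show ?case using subst_calls_mk[of k True A A'] And.IH And.prems covered_mk[of True A A'] by simp
qed

lemma subst_calls:
  "k < m \<Longrightarrow> covered A \<Longrightarrow> calls f_subst (DCons (env k) (encode_fm A)) (encode_fm (subst (\<sigma> k) A)) (20 * Z * B)"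
proof -
  assume k: "k < m" and A: "covered A"
  obtain n where n: "calls f_subst (DCons (env k) (encode_fm A)) (encode_fm (subst (\<sigma> k) A)) n"
    "n + Z \<le> 20 * Z * (fm_size A * (threshold_bound m h + 1))"
    using subst_calls_aux[OF k A] by blast
  have "20 * Z * (fm_size A * (threshold_bound m h + 1)) \<le> 20 * Z * B"
    using A unfolding covered_def by (intro mult_le_mono2) simp
  then show ?thesis using n(2) by (intro calls_mono[OF n(1)]) linarith
qed

lemma runs_mono: "runs f u s C D \<Longrightarrow> s \<le> r \<Longrightarrow> runs f u r C D"
  unfolding runs_def using der_mono calls_mono mult_le_mono2 by metis

lemma generic_small:
  assumes "fm_size N \<le> B"
  shows "runs f_generic (DCons DNil (DCons DNil (encode_fm N))) G FF N"
    "runs f_generic (DCons DNil (DCons (DCons DNil DNil) (encode_fm N))) G (Or N N) N"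
    "runs f_generic (DCons (DCons DNil DNil) (DCons DNil (encode_fm N))) G N TT"
    "runs f_generic (DCons (DCons DNil DNil) (DCons (DCons DNil DNil) (encode_fm N))) G N (And N N)"
proof -
  have "4 * (fm_size N * fm_size N) \<le> G"
    unfolding G_def using mult_le_mono[OF assms assms] by simp
  then have *: "runs f_generic (DCons (data_bool p) (DCons (data_bool q) (encode_fm N))) G (source p q N) (target p q N)" for p q
    using room' by (intro runs_mono[OF generic_runs]) auto
  show "runs f_generic (DCons DNil (DCons DNil (encode_fm N))) G FF N"
    using *[of False False] by (simp add: source_def target_def)
  show "runs f_generic (DCons DNil (DCons (DCons DNil DNil) (encode_fm N))) G (Or N N) N"
    using *[of False True] by (simp add: source_def target_def)
  show "runs f_generic (DCons (DCons DNil DNil) (DCons DNil (encode_fm N))) G N TT"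
    using *[of True False] by (simp add: source_def target_def)
  show "runs f_generic (DCons (DCons DNil DNil) (DCons (DCons DNil DNil) (encode_fm N))) G N (And N N)"
    using *[of True True] by (simp add: source_def target_def)
qed

lemma small_fm: "fm_size A \<le> B \<Longrightarrow> data_size (encode_fm A) \<le> Z2"
  using room' by (intro size_fm) simp

lemma drop_runs:
  assumes "fm_size C \<le> B" "fm_size A \<le> B"
  shows "runs f_drop (DCons (encode_fm C) (encode_fm A)) (2 * G) (And C A) (And TT A)"
proof -
  obtain d where d: "calls f_generic (DCons (DCons DNil DNil) (DCons DNil (encode_fm C))) (encode d) (20 * Z * G)" "der G d C TT"
    using generic_small(3)[OF assms(1)] unfolding runs_def by blast
  have z: "G + B \<le> Z" "G + B < 2 * G" "2 * G \<le> Z" using room' G_ge U_ge B_pos by auto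
  note p = parAnd_der[OF d(2) der_single[OF assms(2)] z(1)]
  have D: "der (2 * G) (par True d [A]) (And C A) (And TT A)"
    by (rule der_mono[OF p(2)]) (use z in simp)
  let ?c = "20 * Z * G + 3 * Z"
  have "calls f_drop (DCons (encode_fm C) (encode_fm A)) (encode (par True d [A])) (20 * Z * (2 * G))"
    (is "calls _ ?u ?v _")
  proof (rule calls_if_yields[where c = ?c])
    show "yields f_drop ?u ?v ?c"
      using callsD[OF d(1)] callsD[OF p(1)] by (simp add: yields_def b_drop_def)
    show "?c < 20 * Z * (2 * G)"
      using budget[of G "2 * G"] G_ge B_pos Z_ge by linarith
  qed (use small_fm[OF assms(1)] small_fm[OF assms(2)] Z_le_square size_fits[OF fits_der[OF D z(3)]] in simp_all)
  with D show ?thesis unfolding runs_def by blast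
qed

lemma add_runs:
  assumes "fm_size C \<le> B" "fm_size A \<le> B"
  shows "runs f_add (DCons (encode_fm A) (encode_fm C)) (2 * G) (Or A FF) (Or A C)"
proof -
  obtain d where d: "calls f_generic (DCons DNil (DCons DNil (encode_fm C))) (encode d) (20 * Z * G)" "der G d FF C"
    using generic_small(1)[OF assms(1)] unfolding runs_def by blast
  have z: "B + G \<le> Z" "B + G < 2 * G" "2 * G \<le> Z" using room' G_ge U_ge B_pos by auto
  note p = parOr_der[OF der_single[OF assms(2)] d(2) z(1)]
  have D: "der (2 * G) (par False [A] d) (Or A FF) (Or A C)"
    by (rule der_mono[OF p(2)]) (use z in simp)
  let ?c = "20 * Z * G + 3 * Z"
  have "calls f_add (DCons (encode_fm A) (encode_fm C)) (encode (par False [A] d)) (20 * Z * (2 * G))"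
    (is "calls _ ?u ?v _")
  proof (rule calls_if_yields[where c = ?c])
    show "yields f_add ?u ?v ?c"
      using callsD[OF d(1)] callsD[OF p(1)] by (simp add: yields_def b_add_def)
    show "?c < 20 * Z * (2 * G)"
      using budget[of G "2 * G"] G_ge B_pos Z_ge by linarith
  qed (use small_fm[OF assms(1)] small_fm[OF assms(2)] Z_le_square size_fits[OF fits_der[OF D z(3)]] in simp_all)
  with D show ?thesis unfolding runs_def by blast
qed

text \<open>In a conjunction two switches, one per conjunct, release the two copies of
  \<open>Q\<close>; in a disjunction the equality rule gathers them. A contraction then merges the
  copies.\<close>

lemma pull_node_calls:
  assumes p: "der s p C (mk c (Or A Q) (Or A' Q))" and s: "s + 13 * G \<le> Z"
    and small: "fm_size A + fm_size A' \<le> B" "fm_size Q \<le> B"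
  shows "\<exists>d. calls f_pull_node (encode p) (encode d) (20 * Z * (2 * G)) \<and> der (s + 13 * G) d C (Or (mk c A A') Q)"
proof -
  obtain e where e: "calls f_generic (DCons DNil (DCons (DCons DNil DNil) (encode_fm Q))) (encode e) (20 * Z * G)" "der G e (Or Q Q) Q"
    using generic_small(2)[OF small(2)] unfolding runs_def by blast
  have g: "1 \<le> G" using G_ge B_pos by linarith
  have sz: "fm_size (mk c A A') \<le> B" using small by auto
  have z: "B + G \<le> Z" using s G_ge by linarith
  note q = parOr_der[OF der_single[OF sz] e(2) z]
  define post where "post = (if c then [Or (And (Or A Q) A') Q, Or (And A' (Or A Q)) Q, Or (Or (And A' A) Q) Q] else [])"
  have st: "step (And (Or A Q) (Or A' Q)) (Or (And (Or A Q) A') Q)" "step (Or (And (Or A Q) A') Q) (Or (And A' (Or A Q)) Q)"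
    "step (Or (And A' (Or A Q)) Q) (Or (Or (And A' A) Q) Q)" "step (Or (Or (And A' A) Q) Q) (Or (And A A') (Or Q Q))"
    "step (Or (Or A Q) (Or A' Q)) (Or (Or A A') (Or Q Q))"
    by (rule step_rules, rule step_ctx, rule step_feq, rule and_comm, rule step_ctx, rule step_rules)
      (auto intro!: step_feq simp: feq_simps)
  have r: "der (11 * G) (post @ par False [mk c A A'] e) (if c then Or (And (Or A Q) A') Q else Or (Or A A') (Or Q Q)) (Or (mk c A A') Q)"
  proof (cases c)
    case True
    have q': "der (B + G) (par False [And A A'] e) (Or (And A A') (Or Q Q)) (Or (And A A') Q)"
      using q(2) True by simp
    note der_Cons[OF der_Cons[OF der_Cons[OF q' st(4)] st(3)] st(2)]
    then have "der (11 * G) (Or (And (Or A Q) A') Q # Or (And A' (Or A Q)) Q # Or (Or (And A' A) Q) Q # par False [And A A'] e)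
      (Or (And (Or A Q) A') Q) (Or (And A A') Q)"
      by (rule der_mono) (use small G_ge in simp)
    then show ?thesis using True by (simp add: post_def)
  next
    case False
    then show ?thesis using q(2) G_ge by (auto simp: post_def elim!: der_mono)
  qed
  have zz: "s + 11 * G \<le> Z" using s by linarith
  have st0: "step (mk c (Or A Q) (Or A' Q)) (if c then Or (And (Or A Q) A') Q else Or (Or A A') (Or Q Q))"
    using st by simp
  note ap = append_der[OF p r zz st0]
  have lst: "calls f_last (encode p) (encode_fm (mk c (Or A Q) (Or A' Q))) (length p + 1)"
    using last_calls[of p] p fits_der[OF p] s unfolding der_def by auto
  have len: "length p \<le> Z" using p s by (auto simp: der_def)
  have D: "der (s + 13 * G) (p @ post @ par False [mk c A A'] e) C (Or (mk c A A') Q)"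
    by (rule der_mono[OF ap(2)]) simp
  let ?c = "20 * Z * G + 8 * Z"
  have "calls f_pull_node (encode p) (encode (p @ post @ par False [mk c A A'] e)) (20 * Z * (2 * G))"
    (is "calls _ ?u ?v _")
  proof (rule calls_if_yields[where c = ?c])
    show "yields f_pull_node ?u ?v ?c"
      using callsD[OF lst] callsD[OF e(1)] callsD[OF q(1)] callsD[OF ap(1)] len Z_ge
      by (cases c) (simp_all add: yields_def b_pull_node_def Let_def post_def)
    show "?c < 20 * Z * (2 * G)"
      using budget[of G "2 * G"] g Z_ge by linarith
  qed (use Z_le_square size_fits[OF fits_der[OF p]] size_fits[OF fits_der[OF D s]] s in simp_all)
  with D show ?thesis by blast
qed

definition pull_arg :: "nat \<Rightarrow> 'a fm \<Rightarrow> 'a fm \<Rightarrow> 'a data" where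
  "pull_arg k Q N = DCons (env k) (DCons (encode_fm Q) (encode_fm N))"

text \<open>The summand \<open>13 * G\<close> in the bounds is the price of
  \<open>pull_node_calls\<close>, saved up in advance. The two subformulae bring it twice: one is
  spent at this node, the other is kept for the node above.\<close>

lemma pull_mk:
  assumes k: "k < m" and Q: "fm_size Q \<le> B" and N: "fm_size (mk c N N') \<le> B"
    and fg: "fm_size (subst g (mk c N N')) \<le> B"
    and n: "runs f_pull (pull_arg k Q N) s (subst f N) (Or (subst g N) Q)" "s + 13 * G \<le> 40 * (fm_size N * G)"
    and n': "runs f_pull (pull_arg k Q N') s' (subst f N') (Or (subst g N') Q)" "s' + 13 * G \<le> 40 * (fm_size N' * G)"
  shows "\<exists>s. runs f_pull (pull_arg k Q (mk c N N')) s (subst f (mk c N N')) (Or (subst g (mk c N N')) Q) \<and>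
    s + 13 * G \<le> 40 * (fm_size (mk c N N') * G)"
proof -
  have g: "1 \<le> G" using G_ge B_pos by linarith
  obtain d where d: "calls f_pull (pull_arg k Q N) (encode d) (20 * Z * s)" "der s d (subst f N) (Or (subst g N) Q)"
    using n unfolding runs_def by blast
  obtain d' where d': "calls f_pull (pull_arg k Q N') (encode d') (20 * Z * s')" "der s' d' (subst f N') (Or (subst g N') Q)"
    using n' unfolding runs_def by blast
  have ss: "s + s' + 13 * G + 13 * G \<le> 40 * (fm_size (mk c N N') * G)"
    using n(2) n'(2) by (simp add: add_mult_distrib)
  moreover have "40 * (fm_size (mk c N N') * G) \<le> U"
    unfolding U_def using N by (intro mult_le_mono) auto
  ultimately have z: "s + s' + 13 * G \<le> Z" "s + s' \<le> Z" using room' by linarith+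
  note p = par_der[OF d(2) d'(2) z(2), of c]
  obtain e where e: "calls f_pull_node (encode (par c d d')) (encode e) (20 * Z * (2 * G))"
    "der (s + s' + 13 * G) e (mk c (subst f N) (subst f N')) (Or (mk c (subst g N) (subst g N')) Q)"
    using pull_node_calls[OF p(2) z(1) _ Q] fg by (cases c) auto
  let ?c = "20 * Z * s + 20 * Z * s' + 20 * Z * (2 * G) + 3 * Z"
  have "calls f_pull (pull_arg k Q (mk c N N')) (encode e) (20 * Z * (s + s' + 13 * G))"
    (is "calls _ ?u ?v _")
  proof (rule calls_if_yields[where c = ?c])
    show "yields f_pull ?u ?v ?c"
      using callsD[OF d(1)] callsD[OF d'(1)] callsD[OF p(1)] callsD[OF e(1)]
      by (simp add: yields_def b_pull_def Let_def pull_arg_def)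
    show "?c < 20 * Z * (s + s' + 13 * G)"
      using budget[of "s + s' + 2 * G" "s + s' + 13 * G"] g Z_ge by (simp add: distrib_left)
  qed (use Z_le_square size_fits[OF fits_der[OF e(2) z(1)]] size_env[OF k] small_fm[OF Q] small_fm[OF N] in \<open>simp_all add: pull_arg_def\<close>)
  then have "runs f_pull (pull_arg k Q (mk c N N')) (s + s' + 13 * G) (subst f (mk c N N')) (Or (subst g (mk c N N')) Q)"
    using e(2) unfolding runs_def by (cases c) auto
  then show ?thesis using ss by blast
qed

lemma pull_leaf:
  assumes k: "k < m" and Q: "fm_size Q \<le> B" and N: "N = FF \<or> N = TT \<or> N = Atom a"
    and leaf: "runs f_pull_leaf (pull_arg k Q N) (19 * G) C D"
  shows "\<exists>s. runs f_pull (pull_arg k Q N) s C D \<and> s + 13 * G \<le> 40 * (fm_size N * G)"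
proof -
  have g: "1 \<le> G" using G_ge B_pos by linarith
  have z: "20 * G \<le> Z" using room' U_ge by linarith
  obtain d where d: "calls f_pull_leaf (pull_arg k Q N) (encode d) (20 * Z * (19 * G))" "der (19 * G) d C D"
    using leaf unfolding runs_def by blast
  have D: "der (20 * G) d C D" by (rule der_mono[OF d(2)]) simp
  have "data_size (encode_fm N) \<le> 3" using N by auto
  then have "calls f_pull (pull_arg k Q N) (encode d) (20 * Z * (20 * G))"
    (is "calls _ ?u ?v _")
    by (intro calls_if_yields[where c = "20 * Z * (19 * G)"])
      (use N callsD[OF d(1)] size_env[OF k] small_fm[OF Q] Z_le_square size_fits[OF fits_der[OF D z]] g Z_ge
        in \<open>auto simp: yields_def b_pull_def Let_def pull_arg_def\<close>)
  with D have "runs f_pull (pull_arg k Q N) (20 * G) C D" unfolding runs_def by blast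
  moreover have "fm_size N = 1" using N by auto
  ultimately show ?thesis by (intro exI[of _ "20 * G"]) simp
qed

text \<open>\<open>f\<close> and \<open>g\<close> abstract from what happens at an atom.
  \<open>pull_sigma\<close> instantiates them with \<open>\<sigma> k\<close> and
  \<open>Atom\<close>, \<open>pull_theta\<close> with \<open>Atom\<close> and the replacement of
  \<open>x\<close> by \<open>FF\<close>.\<close>

lemma pull_runs_aux:
  assumes k: "k < m" and Q: "fm_size Q \<le> B"
    and units: "runs f_pull_leaf (pull_arg k Q FF) (19 * G) FF (Or FF Q)"
      "runs f_pull_leaf (pull_arg k Q TT) (19 * G) TT (Or TT Q)"
  shows "fm_size N \<le> B \<Longrightarrow> fm_size (subst g N) \<le> B \<Longrightarrow>
    (\<And>a. a \<in> fm_atoms N \<Longrightarrow> runs f_pull_leaf (pull_arg k Q (Atom a)) (19 * G) (f a) (Or (g a) Q)) \<Longrightarrow>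
    \<exists>s. runs f_pull (pull_arg k Q N) s (subst f N) (Or (subst g N) Q) \<and> s + 13 * G \<le> 40 * (fm_size N * G)"
proof (induction N)
  case FF
  show ?case using pull_leaf[OF k Q _ units(1)] by simp
next
  case TT
  show ?case using pull_leaf[OF k Q _ units(2)] by simp
next
  case (Atom a)
  show ?case using pull_leaf[OF k Q _ Atom.prems(3)[of a], of a] by simp
next
  case (Or N N')
  obtain s s' where "runs f_pull (pull_arg k Q N) s (subst f N) (Or (subst g N) Q)" "s + 13 * G \<le> 40 * (fm_size N * G)"
    "runs f_pull (pull_arg k Q N') s' (subst f N') (Or (subst g N') Q)" "s' + 13 * G \<le> 40 * (fm_size N' * G)"
    using Or.IH Or.prems by fastforce
  then show ?case using pull_mk[OF k Q, of False N N' g s f s'] Or.prems by simp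
next
  case (And N N')
  obtain s s' where "runs f_pull (pull_arg k Q N) s (subst f N) (Or (subst g N) Q)" "s + 13 * G \<le> 40 * (fm_size N * G)"
    "runs f_pull (pull_arg k Q N') s' (subst f N') (Or (subst g N') Q)" "s' + 13 * G \<le> 40 * (fm_size N' * G)"
    using And.IH And.prems by fastforce
  then show ?case using pull_mk[OF k Q, of True N N' g s f s'] And.prems by simp
qed

lemma pull_runs:
  assumes "k < m" "fm_size Q \<le> B"
    "runs f_pull_leaf (pull_arg k Q FF) (19 * G) FF (Or FF Q)"
    "runs f_pull_leaf (pull_arg k Q TT) (19 * G) TT (Or TT Q)"
    "fm_size N \<le> B" "fm_size (subst g N) \<le> B"
    "\<And>a. a \<in> fm_atoms N \<Longrightarrow> runs f_pull_leaf (pull_arg k Q (Atom a)) (19 * G) (f a) (Or (g a) Q)"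
  shows "runs f_pull (pull_arg k Q N) U (subst f N) (Or (subst g N) Q)"
proof -
  obtain s where s: "runs f_pull (pull_arg k Q N) s (subst f N) (Or (subst g N) Q)" "s + 13 * G \<le> 40 * (fm_size N * G)"
    using pull_runs_aux[OF assms(1-4), of N g f] assms(5-7) by blast
  have "40 * (fm_size N * G) \<le> U"
    unfolding U_def using assms(5) by (intro mult_le_mono) auto
  then show ?thesis using s by (intro runs_mono[OF s(1)]) linarith
qed

end

section \<open>The two uses of pulling; simulation of identities and cuts\<close>

context simulation
begin

lemma mem_facts:
  "halts f_mem (DCons (DAtom a) (encode_tree T))"
  "result f_mem (DCons (DAtom a) (encode_tree T)) = data_bool (a \<in> atoms T)"
  "count f_mem (DCons (DAtom a) (encode_tree T)) \<le> 2 * Z"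
proof -
  have c: "calls f_mem (DCons (DAtom a) (encode_tree T)) (data_bool (a \<in> atoms T)) (2 * leaves T - 1)"
    using leaves room' by (intro mem_calls) simp
  show "halts f_mem (DCons (DAtom a) (encode_tree T))"
    "result f_mem (DCons (DAtom a) (encode_tree T)) = data_bool (a \<in> atoms T)"
    "count f_mem (DCons (DAtom a) (encode_tree T)) \<le> 2 * Z"
    using callsD[OF c] leaves room' by auto
qed

lemma G_pos: "1 \<le> G"
  using G_ge B_pos by linarith

lemma pull_leaf_default:
  assumes k: "k < m" and Q: "fm_size Q \<le> B" and N: "N = FF \<or> N = TT \<or> N = Atom a"
    and default: "if \<exists>x. Q = Atom x then N \<noteq> Q else \<forall>b. N = Atom b \<longrightarrow> b \<in> atoms T"
  shows "runs f_pull_leaf (pull_arg k Q N) (19 * G) N (Or N Q)"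
proof -
  have N1: "fm_size N \<le> 1" "fm_size N \<le> B" using N B_pos by auto
  obtain d where d: "calls f_generic (DCons DNil (DCons DNil (encode_fm Q))) (encode d) (20 * Z * G)" "der G d FF Q"
    using generic_small(1)[OF Q] unfolding runs_def by blast
  have z: "1 + G \<le> Z" "19 * G \<le> Z" using room' U_ge G_pos by linarith+
  note p = parOr_der[OF der_single[OF N1(1)] d(2) z(1)]
  have st: "step N (Or N FF)" by (intro step_feq feq_sym[OF or_unit])
  have D: "der (19 * G) (N # par False [N] d) N (Or N Q)"
    by (rule der_mono[OF der_Cons[OF p(2) st]]) (use N1 G_pos in linarith)
  let ?c = "20 * Z * G + 8 * Z"
  have "calls f_pull_leaf (pull_arg k Q N) (encode (N # par False [N] d)) (20 * Z * (19 * G))"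
    (is "calls _ ?u ?v _")
  proof (rule calls_if_yields[where c = ?c])
    show "yields f_pull_leaf ?u ?v ?c"
      using callsD[OF d(1)] callsD[OF p(1)] N default mem_facts[of a]
      by (cases "\<exists>x. Q = Atom x") (auto simp: yields_def b_pull_leaf_def Let_def pull_arg_def env_def)
    show "?c < 20 * Z * (19 * G)"
      using budget[of G "19 * G"] G_pos Z_ge by linarith
  qed (use size_env[OF k] small_fm[OF Q] small_fm[OF N1(2)] Z_le_square size_fits[OF fits_der[OF D z(2)]] in \<open>simp_all add: pull_arg_def\<close>)
  with D show ?thesis unfolding runs_def by blast
qed

lemma pull_leaf_self:
  assumes k: "k < m"
  shows "runs f_pull_leaf (pull_arg k (Atom x) (Atom x)) (19 * G) (Atom x) (Or FF (Atom x))"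
proof -
  have st: "step (Atom x) (Or FF (Atom x))" by (intro step_feq) (simp add: feq_simps)
  then have "der 2 [Atom x, Or FF (Atom x)] (Atom x) (Or FF (Atom x))" by (simp add: der_def)
  then have D: "der (19 * G) [Atom x, Or FF (Atom x)] (Atom x) (Or FF (Atom x))"
    by (rule der_mono) (use G_pos in simp)
  have "calls f_pull_leaf (pull_arg k (Atom x) (Atom x)) (encode [Atom x, Or FF (Atom x)]) 1"
    using size_env[OF k] Z_le_square
    by (intro callsI; simp add: b_pull_leaf_def Let_def pull_arg_def)
  then have "calls f_pull_leaf (pull_arg k (Atom x) (Atom x)) (encode [Atom x, Or FF (Atom x)]) (20 * Z * (19 * G))"
    by (rule calls_mono) (use G_pos Z_ge in simp)
  with D show ?thesis unfolding runs_def by blast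
qed

text \<open>\<open>b_pull_leaf\<close> tells its two uses apart by asking whether \<open>Q\<close>
  is an atom, so a threshold must never be one. The assumption \<open>root\<close> guarantees this,
  and it holds because the tree is grown from an empty leaf.\<close>

lemma theta_not_Atom: "\<theta> k \<noteq> Atom a"
proof -
  have "conv f g i j \<noteq> Atom a" for f g :: "nat \<Rightarrow> 'a fm" and i j by (cases j) auto
  then show ?thesis using root unfolding \<theta>_def by (cases T) (auto split: option.splits elim: leaf_fm.elims)
qed

lemma pull_leaf_negative:
  assumes k: "k < m" and b: "b \<notin> atoms T" "bar b \<in> atoms T"
  shows "runs f_pull_leaf (pull_arg k (\<theta> (Suc k)) (Atom b)) (19 * G) (\<tau> k (bar b)) (Or (Atom b) (\<theta> (Suc k)))"
proof -
  let ?Q = "\<theta> (Suc k)" and ?x = "bar b" and ?t = "\<tau> k (bar b)" and ?N = "Atom b"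
  have Q: "fm_size ?Q \<le> B" and t: "fm_size ?t \<le> B"
    using theta_size[of "Suc k"] tau_size[of k ?x] k threshold_bound by auto
  obtain c where c: "calls f_threshold (threshold_arg (Some ?x) T k) (encode c) (20 * Z * threshold_bound m h)"
    "data_hd (encode c) = encode_fm ?t"
    using tau_run[OF less_imp_le[OF k], of ?x] threshold_bound room'(2) by (elim runsE) auto
  obtain d where d: "calls f_succ (threshold_arg (Some ?x) T k) (encode d) (20 * Z * succ_bound m h)"
    "der (succ_bound m h) d (And (Atom ?x) ?t) ?Q"
    using succ_run[OF k b(2)] unfolding runs_def by blast
  have z: "B + 1 \<le> Z" "B + 1 + (B + 1) \<le> Z" "19 * G \<le> Z" using room' U_ge G_ge B_pos by linarith+
  have one: "fm_size ?N \<le> 1" by simp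
  note p = parOr_der[OF der_mono[OF d(2) succ_bound] der_single[OF one] z(1)]
  have nq: "fm_size (Or ?N ?Q) \<le> B + 1" using Q by simp
  have st: "step ?t (And ?t TT)" "step (And ?t TT) (And ?t (Or (Atom ?x) ?N))"
    "step (And ?t (Or (Atom ?x) ?N)) (Or (And ?t (Atom ?x)) ?N)"
    "step (Or (And ?t (Atom ?x)) ?N) (Or (And (Atom ?x) ?t) ?N)" "step (Or ?Q ?N) (Or ?N ?Q)"
    using step_rules(1)[of ?x]
    by (auto intro: step_rules) (auto intro!: step_feq simp: feq_simps)
  note q = append_der[OF p(2) der_single[OF nq] z(2) st(5)]
  let ?L = "?t # And ?t TT # And ?t (Or (Atom ?x) ?N) # Or (And ?t (Atom ?x)) ?N # par False d [?N] @ [Or ?N ?Q]"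
  have D: "der (19 * G) ?L ?t (Or ?N ?Q)"
    by (rule der_mono[OF der_Cons[OF der_Cons[OF der_Cons[OF der_Cons[OF q(2) st(4)] st(3)] st(2)] st(1)]])
      (use t G_ge B_pos in simp)
  let ?c = "20 * Z * (4 * threshold_bound m h) + 20 * Z * succ_bound m h + 10 * Z"
  have "calls f_pull_leaf (pull_arg k ?Q ?N) (encode ?L) (20 * Z * (19 * G))"
    (is "calls _ ?u ?v _")
  proof (rule calls_if_yields[where c = ?c])
    show "yields f_pull_leaf ?u ?v ?c"
      using callsD[OF c(1)] c(2) callsD[OF d(1)] callsD[OF p(1)] callsD[OF q(1)] mem_facts[of b] b theta_not_Atom
      by (auto simp: yields_def b_pull_leaf_def Let_def pull_arg_def env_def threshold_arg_def)
    have "4 * threshold_bound m h + succ_bound m h < 19 * G" using threshold_bound succ_bound G_ge B_pos by linarith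
    from budget[OF this] show "?c < 20 * Z * (19 * G)"
      using Z_ge by (simp add: distrib_left)
  qed (use size_env[OF k] small_fm[OF Q] Z_le_square size_fits[OF fits_der[OF D z(3)]] in \<open>simp_all add: pull_arg_def\<close>)
  with D show ?thesis unfolding runs_def by blast
qed

lemma covered_atoms: "covered A \<Longrightarrow> a \<in> fm_atoms A \<Longrightarrow> a \<in> atoms T \<or> bar a \<in> atoms T"
  by (auto simp: covered_def)

lemma pull_sigma:
  assumes k: "k < m" and A: "covered A"
  shows "runs f_pull (pull_arg k (\<theta> (Suc k)) A) U (subst (\<sigma> k) A) (Or A (\<theta> (Suc k)))"
proof -
  have Q: "fm_size (\<theta> (Suc k)) \<le> B" using theta_size[of "Suc k"] k by simp
  have "runs f_pull (pull_arg k (\<theta> (Suc k)) A) U (subst (\<sigma> k) A) (Or (subst Atom A) (\<theta> (Suc k)))"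
  proof (rule pull_runs[OF k Q])
    fix a assume "a \<in> fm_atoms A"
    then have a: "a \<in> atoms T \<or> bar a \<in> atoms T" using covered_atoms[OF A] by simp
    show "runs f_pull_leaf (pull_arg k (\<theta> (Suc k)) (Atom a)) (19 * G) (\<sigma> k a) (Or (Atom a) (\<theta> (Suc k)))"
    proof (cases "a \<in> atoms T")
      case True
      then show ?thesis using pull_leaf_default[OF k Q, of "Atom a" a] theta_not_Atom by (simp add: \<sigma>_def)
    next
      case False
      then show ?thesis using pull_leaf_negative[OF k False] a by (simp add: \<sigma>_def)
    qed
  qed (use pull_leaf_default[OF k Q] theta_not_Atom covered_sizes(1)[OF A less_imp_le[OF k]] in auto)
  then show ?thesis by simp
qed

lemma pull_theta:
  assumes k: "k < m"
  shows "runs f_pull (pull_arg k (Atom x) (\<theta> k)) U (\<theta> k) (Or (\<tau> k x) (Atom x))"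
proof -
  let ?g = "\<lambda>b. if b = x then FF else Atom b"
  have Q: "fm_size (Atom x) \<le> B" using B_pos by simp
  have g: "subst ?g (\<theta> k) = \<tau> k x" by (simp add: \<theta>_def \<tau>_def subst_delete)
  have "runs f_pull (pull_arg k (Atom x) (\<theta> k)) U (subst Atom (\<theta> k)) (Or (subst ?g (\<theta> k)) (Atom x))"
  proof (rule pull_runs[OF k Q])
    show "fm_size (\<theta> k) \<le> B" using theta_size[of k] k by simp
    show "fm_size (subst ?g (\<theta> k)) \<le> B" unfolding g using tau_size[of k x] k threshold_bound by simp
    fix a
    show "runs f_pull_leaf (pull_arg k (Atom x) (Atom a)) (19 * G) (Atom a) (Or (if a = x then FF else Atom a) (Atom x))"
      using pull_leaf_self[OF k, of x] pull_leaf_default[OF k Q, of "Atom a" a] by auto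
  qed (rule pull_leaf_default[OF k Q]; auto)+
  then show ?thesis by (simp add: g)
qed

definition sim_arg :: "nat \<Rightarrow> 'a fm \<Rightarrow> 'a fm \<Rightarrow> 'a data" where
  "sim_arg k C D = DCons (env k) (DCons (encode_fm C) (encode_fm D))"

definition lhs :: "nat \<Rightarrow> 'a fm \<Rightarrow> 'a fm" where
  "lhs k C = And (\<theta> k) (subst (\<sigma> k) C)"

definition rhs :: "nat \<Rightarrow> 'a fm \<Rightarrow> 'a fm" where
  "rhs k D = Or (subst (\<sigma> k) D) (\<theta> (Suc k))"

text \<open>For the steps that are neither identities nor cuts: \<open>\<theta> k\<close> is removed
  by coweakening, and \<open>\<theta> (Suc k)\<close> is introduced by weakening.\<close>

lemma frame_runs:
  assumes k: "k < m" and C: "covered C" and D: "covered D"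
    and d: "der s d (subst (\<sigma> k) C) (subst (\<sigma> k) D)" and s: "s + 6 * G \<le> Z"
  shows "runs f_frame (DCons (env k) (DCons (encode_fm C) (DCons (encode_fm D) (encode d)))) (s + 6 * G) (lhs k C) (rhs k D)"
proof -
  let ?C = "subst (\<sigma> k) C" and ?D = "subst (\<sigma> k) D"
  have k': "k \<le> m" "Suc k \<le> m" using k by auto
  obtain e where e: "calls f_drop (DCons (encode_fm (\<theta> k)) (encode_fm ?C)) (encode e) (20 * Z * (2 * G))"
    "der (2 * G) e (lhs k C) (And TT ?C)"
    using drop_runs[OF theta_size[OF k'(1)] covered_sizes(2)[OF C k'(1)]] unfolding runs_def lhs_def by blast
  obtain f where f: "calls f_add (DCons (encode_fm ?D) (encode_fm (\<theta> (Suc k)))) (encode f) (20 * Z * (2 * G))"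
    "der (2 * G) f (Or ?D FF) (rhs k D)"
    using add_runs[OF theta_size[OF k'(2)] covered_sizes(2)[OF D k'(1)]] unfolding runs_def rhs_def by blast
  have st: "step (And TT ?C) ?C" "step ?D (Or ?D FF)"
    by (auto intro!: step_feq simp: feq_simps)
  have z: "s + 2 * G \<le> Z" "2 * G + (s + 2 * G) \<le> Z" using s by linarith+
  note p = append_der[OF d f(2) z(1) st(2)]
  note q = append_der[OF e(2) p(2) z(2) st(1)]
  have F: "der (s + 6 * G) (e @ d @ f) (lhs k C) (rhs k D)"
    by (rule der_mono[OF q(2)]) simp
  note sub = subst_calls[OF k C] subst_calls[OF k D]
  have sZ: "s \<le> Z" using s by simp
  let ?c = "20 * Z * (4 * G) + 20 * Z * (2 * B) + 4 * Z"
  have "calls f_frame (DCons (env k) (DCons (encode_fm C) (DCons (encode_fm D) (encode d)))) (encode (e @ d @ f)) (20 * Z * (s + 6 * G))"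
    (is "calls _ ?u ?v _")
  proof (rule calls_if_yields[where c = ?c])
    show "yields f_frame ?u ?v ?c"
      using callsD[OF e(1)] callsD[OF f(1)] callsD[OF p(1)] callsD[OF q(1)] callsD[OF sub(1)] callsD[OF sub(2)]
      by (simp add: yields_def b_frame_def Let_def env_def)
    have "4 * G + 2 * B < s + 6 * G" using G_ge B_pos by linarith
    from budget[OF this] show "?c < 20 * Z * (s + 6 * G)"
      using Z_ge by (simp add: distrib_left)
  qed (use size_env[OF k] covered_data_sizes[OF C k'(1)] covered_data_sizes[OF D k'(1)] Z_le_square
      size_fits[OF fits_der[OF F s]] size_fits[OF fits_der[OF d sZ]] in simp_all)
  with F show ?thesis unfolding runs_def by blast
qed

lemma identity_runs:
  assumes k: "k < m" and D: "covered D" and shape: "D = Or (Atom b) (Atom (bar b))"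
  shows "runs f_identity (DCons (env k) (encode_fm D)) (U + 6 * G) (lhs k TT) (rhs k D)"
proof -
  let ?D = "subst (\<sigma> k) D"
  define x where "x = (if b \<in> atoms T then b else bar b)"
  have k': "k \<le> m" "Suc k \<le> m" using k by auto
  have cov: "b \<in> atoms T \<or> bar b \<in> atoms T" using covered_atoms[OF D, of b] by (simp add: shape)
  have Dx: "?D = (if b \<in> atoms T then Or (Atom x) (\<tau> k x) else Or (\<tau> k x) (Atom x))"
    using cov consistent[of b] consistent[of "bar b"] by (auto simp: shape \<sigma>_def x_def)
  obtain d where d: "calls f_pull (pull_arg k (Atom x) (\<theta> k)) (encode d) (20 * Z * U)"
    "der U d (\<theta> k) (Or (\<tau> k x) (Atom x))"
    using pull_theta[OF k, of x] unfolding runs_def by blast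
  obtain f where f: "calls f_add (DCons (encode_fm ?D) (encode_fm (\<theta> (Suc k)))) (encode f) (20 * Z * (2 * G))"
    "der (2 * G) f (Or ?D FF) (rhs k D)"
    using add_runs[OF theta_size[OF k'(2)] covered_sizes(2)[OF D k'(1)]] unfolding runs_def rhs_def by blast
  have st: "step (lhs k TT) (\<theta> k)" "step (Or (\<tau> k x) (Atom x)) (Or ?D FF)"
    by (auto intro!: step_feq simp: feq_simps lhs_def Dx)
  have z: "U + 2 * G \<le> Z" "U + 6 * G \<le> Z" using room' U_ge by linarith+
  note p = append_der[OF d(2) f(2) z(1) st(2)]
  have F: "der (U + 6 * G) (lhs k TT # d @ f) (lhs k TT) (rhs k D)"
    by (rule der_mono[OF der_Cons[OF p(2) st(1)]]) (use theta_size[OF k'(1)] G_ge B_pos in \<open>simp add: lhs_def\<close>)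
  note sub = subst_calls[OF k D]
  let ?c = "20 * Z * U + 20 * Z * (2 * G) + 20 * Z * B + 4 * Z"
  have "calls f_identity (DCons (env k) (encode_fm D)) (encode (lhs k TT # d @ f)) (20 * Z * (U + 6 * G))"
    (is "calls _ ?u ?v _")
  proof (rule calls_if_yields[where c = ?c])
    show "yields f_identity ?u ?v ?c"
      using callsD[OF d(1)] callsD[OF f(1)] callsD[OF p(1)] callsD[OF sub] mem_facts[of b]
      by (cases "b \<in> atoms T") (simp_all add: yields_def b_identity_def Let_def env_def pull_arg_def shape lhs_def x_def)
    have "U + 2 * G + B < U + 6 * G" using G_ge B_pos by linarith
    from budget[OF this] show "?c < 20 * Z * (U + 6 * G)"
      using Z_ge by (simp add: distrib_left)
  qed (use size_env[OF k] covered_data_sizes[OF D k'(1)] Z_le_square size_fits[OF fits_der[OF F z(2)]] in simp_all)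
  with F show ?thesis unfolding runs_def by blast
qed

lemma cut_runs:
  assumes k: "k < m" and C: "covered C" and shape: "C = And (Atom b) (Atom (bar b))"
  shows "runs f_cut (DCons (env k) (encode_fm C)) (U + 6 * G) (lhs k C) (rhs k FF)"
proof -
  let ?C = "subst (\<sigma> k) C"
  define x where "x = (if b \<in> atoms T then b else bar b)"
  have k': "k \<le> m" "Suc k \<le> m" using k by auto
  have cov: "b \<in> atoms T \<or> bar b \<in> atoms T" using covered_atoms[OF C, of b] by (simp add: shape)
  then have x: "x \<in> atoms T" by (auto simp: x_def)
  have Cx: "?C = (if b \<in> atoms T then And (Atom x) (\<tau> k x) else And (\<tau> k x) (Atom x))"
    using cov consistent[of b] consistent[of "bar b"] by (auto simp: shape \<sigma>_def x_def)
  obtain e where e: "calls f_drop (DCons (encode_fm (\<theta> k)) (encode_fm ?C)) (encode e) (20 * Z * (2 * G))"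
    "der (2 * G) e (lhs k C) (And TT ?C)"
    using drop_runs[OF theta_size[OF k'(1)] covered_sizes(2)[OF C k'(1)]] unfolding runs_def lhs_def by blast
  obtain d where d: "calls f_succ (threshold_arg (Some x) T k) (encode d) (20 * Z * succ_bound m h)"
    "der (succ_bound m h) d (And (Atom x) (\<tau> k x)) (\<theta> (Suc k))"
    using succ_run[OF k x] unfolding runs_def by blast
  have st: "step (And TT ?C) (And (Atom x) (\<tau> k x))" "step (\<theta> (Suc k)) (rhs k FF)"
    by (auto intro!: step_feq simp: feq_simps rhs_def Cx)
  have szr: "fm_size (rhs k FF) \<le> B + 1" using theta_size[OF k'(2)] by (simp add: rhs_def)
  have z: "B + (B + 1) \<le> Z" "2 * G + (B + (B + 1)) \<le> Z" "U + 6 * G \<le> Z" using room' U_ge G_ge B_pos by linarith+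
  note p = append_der[OF der_mono[OF d(2) succ_bound] der_single[OF szr] z(1) st(2)]
  note q = append_der[OF e(2) p(2) z(2) st(1)]
  have F: "der (U + 6 * G) (e @ d @ [rhs k FF]) (lhs k C) (rhs k FF)"
    by (rule der_mono[OF q(2)]) (use G_ge B_pos in linarith)
  note sub = subst_calls[OF k C]
  let ?c = "20 * Z * succ_bound m h + 20 * Z * (2 * G) + 20 * Z * B + 6 * Z"
  have "calls f_cut (DCons (env k) (encode_fm C)) (encode (e @ d @ [rhs k FF])) (20 * Z * (U + 6 * G))"
    (is "calls _ ?u ?v _")
  proof (rule calls_if_yields[where c = ?c])
    show "yields f_cut ?u ?v ?c"
      using callsD[OF d(1)] callsD[OF e(1)] callsD[OF p(1)] callsD[OF q(1)] callsD[OF sub] mem_facts[of b]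
      by (cases "b \<in> atoms T") (simp_all add: yields_def b_cut_def Let_def env_def threshold_arg_def shape rhs_def x_def)
    have "succ_bound m h + 2 * G + B < U + 6 * G" using succ_bound G_ge B_pos by linarith
    from budget[OF this] show "?c < 20 * Z * (U + 6 * G)"
      using Z_ge by (simp add: distrib_left)
  qed (use size_env[OF k] covered_data_sizes[OF C k'(1)] Z_le_square size_fits[OF fits_der[OF F z(3)]] in simp_all)
  with F show ?thesis unfolding runs_def by blast
qed

end

section \<open>Recognising atomic steps\<close>

context cut_free
begin

text \<open>
  The program is not told which rule a step of the given proof applies. It descends through the
  context as long as two immediate subformulae coincide and recognises the atomic rules. If it
  finds none, the rule is a switch, a medial or the equality rule, and the step is preserved by
  every substitution for the atoms.
\<close>

definition atomic_rule :: "'a fm \<Rightarrow> 'a fm \<Rightarrow> bool" where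
  "atomic_rule C D \<longleftrightarrow> (\<exists>a. C = TT \<and> D = Or (Atom a) (Atom (bar a)) \<or> C = FF \<and> D = Atom a \<or>
     C = Or (Atom a) (Atom a) \<and> D = Atom a \<or> C = And (Atom a) (Atom (bar a)) \<and> D = FF \<or>
     C = Atom a \<and> D = TT \<or> C = Atom a \<and> D = And (Atom a) (Atom a))"

definition atomic_step :: "'a fm \<Rightarrow> 'a fm \<Rightarrow> bool" where
  "atomic_step C D \<longleftrightarrow> (\<exists>X C' D'. C = fill X C' \<and> D = fill X D' \<and> atomic_rule C' D')"

text \<open>A subformula that is unchanged cannot contain the redex. Hence comparing immediate
  subformulae suffices to find the way down to it, without any search.\<close>

lemma atomic_step_neq: "atomic_step C D \<Longrightarrow> C \<noteq> D"
  unfolding atomic_step_def atomic_rule_def by (auto dest: fill_inject)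

lemma atomic_step_mk:
  assumes "atomic_step (mk c C1 C2) (mk c' D1 D2)"
  shows "c = c' \<and> (C2 = D2 \<and> atomic_step C1 D1 \<or> C1 = D1 \<and> atomic_step C2 D2)"
proof -
  obtain X C' D' where X: "mk c C1 C2 = fill X C'" "mk c' D1 D2 = fill X D'" "atomic_rule C' D'"
    using assms unfolding atomic_step_def by blast
  have "atomic_step (fill Y C') (fill Y D')" for Y
    using X(3) unfolding atomic_step_def by blast
  moreover have "\<not> atomic_rule (mk c C1 C2) (mk c' D1 D2)"
    by (auto simp: atomic_rule_def)
  ultimately show ?thesis
    using X by (cases X; cases c; cases c') simp_all
qed

lemma atomic_step_leaf:
  assumes "atomic_step C D" and "(\<nexists>c C1 C2. C = mk c C1 C2) \<or> (\<nexists>c D1 D2. D = mk c D1 D2)"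
  shows "atomic_rule C D"
proof -
  obtain X C' D' where X: "C = fill X C'" "D = fill X D'" "atomic_rule C' D'"
    using assms unfolding atomic_step_def by blast
  have "X = Hole"
  proof (cases X)
    case (OrL Y E)
    then have "C = mk False (fill Y C') E" "D = mk False (fill Y D') E" using X by simp_all
    then show ?thesis using assms(2) by blast
  next
    case (OrR E Y)
    then have "C = mk False E (fill Y C')" "D = mk False E (fill Y D')" using X by simp_all
    then show ?thesis using assms(2) by blast
  next
    case (AndL Y E)
    then have "C = mk True (fill Y C') E" "D = mk True (fill Y D') E" using X by simp_all
    then show ?thesis using assms(2) by blast
  next
    case (AndR E Y)
    then have "C = mk True E (fill Y C')" "D = mk True E (fill Y D')" using X by simp_all
    then show ?thesis using assms(2) by blast
  qed
  with X show ?thesis by simp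
qed

lemma step_classification:
  assumes "inference_step bar SKS C D"
  shows "atomic_step C D \<or> step (subst f C) (subst f D)"
proof -
  obtain r X C' D' where r: "rule_instance bar r C' D'" "C = fill X C'" "D = fill X D'"
    using assms unfolding inference_step_def by blast
  have st: "r' \<noteq> AiUp \<Longrightarrow> rule_instance bar r' (subst f C') (subst f D') \<Longrightarrow> step (subst f C) (subst f D)" for r'
    unfolding r subst_fill by (rule stepI)
  have at: "atomic_rule C' D' \<Longrightarrow> atomic_step C D"
    using r unfolding atomic_step_def by blast
  show ?thesis
    using r(1)
  proof cases
    case (switch A B C)
    then show ?thesis using st[of Switch] by (auto intro: rule_instance.intros)
  next
    case (medial A B C D)
    then show ?thesis using st[of Medial] by (auto intro: rule_instance.intros)
  next
    case equality
    then show ?thesis using st[of Equality] by (auto intro: rule_instance.intros feq_subst)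
  qed (use at in \<open>auto simp: atomic_rule_def\<close>)
qed

end

context simulation
begin

lemma sim_leaf_frame:
  assumes k: "k < m" and C: "covered C" and D: "covered D"
    and gen: "runs f_generic (DCons (data_bool p) (DCons (data_bool q) (encode_fm (subst (\<sigma> k) E)))) G (subst (\<sigma> k) C) (subst (\<sigma> k) D)"
    and shape: "E = D \<and> D = Atom a \<and> \<not> p \<and> C = (if q then Or D D else FF) \<or>
      E = C \<and> C = Atom a \<and> p \<and> D = (if q then And C C else TT)"
  shows "runs f_sim_leaf (sim_arg k C D) (U + 8 * G) (lhs k C) (rhs k D)"
proof -
  have E: "covered E" using C D shape by auto
  note sub = subst_calls[OF k E]
  obtain d where d: "calls f_generic (DCons (data_bool p) (DCons (data_bool q) (encode_fm (subst (\<sigma> k) E)))) (encode d) (20 * Z * G)"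
    "der G d (subst (\<sigma> k) C) (subst (\<sigma> k) D)"
    using gen unfolding runs_def by blast
  have z: "G + 6 * G \<le> Z" "U + 8 * G \<le> Z" using room' U_ge by linarith+
  obtain e where e: "calls f_frame (DCons (env k) (DCons (encode_fm C) (DCons (encode_fm D) (encode d)))) (encode e) (20 * Z * (G + 6 * G))"
    "der (G + 6 * G) e (lhs k C) (rhs k D)"
    using frame_runs[OF k C D d(2) z(1)] unfolding runs_def by blast
  have F: "der (U + 8 * G) e (lhs k C) (rhs k D)" by (rule der_mono[OF e(2)]) simp
  have k': "k \<le> m" using k by simp
  let ?c = "20 * Z * (G + 6 * G) + 20 * Z * G + 20 * Z * B"
  have "calls f_sim_leaf (sim_arg k C D) (encode e) (20 * Z * (U + 8 * G))"
    (is "calls _ ?u ?v _")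
  proof (rule calls_if_yields[where c = ?c])
    show "yields f_sim_leaf ?u ?v ?c"
      using callsD[OF d(1)] callsD[OF e(1)] callsD[OF sub] shape
      by (cases p; cases q) (auto simp: yields_def b_sim_leaf_def Let_def sim_arg_def)
    have "G + 6 * G + G + B < U + 8 * G" using G_ge U_ge B_pos by linarith
    from budget[OF this] show "?c < 20 * Z * (U + 8 * G)"
      unfolding distrib_left using Z_ge by linarith
  qed (use size_env[OF k] covered_data_sizes[OF C k'] covered_data_sizes[OF D k'] Z_le_square
      size_fits[OF fits_der[OF F z(2)]] in \<open>simp_all add: sim_arg_def\<close>)
  with F show ?thesis unfolding runs_def by blast
qed

lemma sim_leaf_runs:
  assumes k: "k < m" and C: "covered C" and D: "covered D" and rule: "atomic_rule C D"
  shows "runs f_sim_leaf (sim_arg k C D) (U + 8 * G) (lhs k C) (rhs k D)"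
proof -
  have k': "k \<le> m" using k by simp
  have z: "U + 8 * G \<le> Z" using room' U_ge by linarith
  obtain a where "C = TT \<and> D = Or (Atom a) (Atom (bar a)) \<or> C = FF \<and> D = Atom a \<or>
     C = Or (Atom a) (Atom a) \<and> D = Atom a \<or> C = And (Atom a) (Atom (bar a)) \<and> D = FF \<or>
     C = Atom a \<and> D = TT \<or> C = Atom a \<and> D = And (Atom a) (Atom a)"
    using rule unfolding atomic_rule_def by blast
  then show ?thesis
  proof (elim disjE conjE)
    assume CD: "C = TT" "D = Or (Atom a) (Atom (bar a))"
    obtain d where d: "calls f_identity (DCons (env k) (encode_fm D)) (encode d) (20 * Z * (U + 6 * G))"
      "der (U + 6 * G) d (lhs k C) (rhs k D)"
      using identity_runs[OF k D CD(2)] CD(1) unfolding runs_def by blast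
    have F: "der (U + 8 * G) d (lhs k C) (rhs k D)" by (rule der_mono[OF d(2)]) simp
    let ?c = "20 * Z * (U + 6 * G)"
    have "calls f_sim_leaf (sim_arg k C D) (encode d) (20 * Z * (U + 8 * G))"
      (is "calls _ ?u ?v _")
    proof (rule calls_if_yields[where c = ?c])
      show "yields f_sim_leaf ?u ?v ?c"
        using callsD[OF d(1)] CD by (simp add: yields_def b_sim_leaf_def Let_def sim_arg_def)
    qed (use size_env[OF k] covered_data_sizes[OF C k'] covered_data_sizes[OF D k'] Z_le_square
        size_fits[OF fits_der[OF F z]] Z_ge G_pos in \<open>simp_all add: sim_arg_def\<close>)
    with F show ?thesis unfolding runs_def by blast
  next
    assume CD: "C = And (Atom a) (Atom (bar a))" "D = FF"
    obtain d where d: "calls f_cut (DCons (env k) (encode_fm C)) (encode d) (20 * Z * (U + 6 * G))"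
      "der (U + 6 * G) d (lhs k C) (rhs k D)"
      using cut_runs[OF k C CD(1)] CD(2) unfolding runs_def by blast
    have F: "der (U + 8 * G) d (lhs k C) (rhs k D)" by (rule der_mono[OF d(2)]) simp
    let ?c = "20 * Z * (U + 6 * G)"
    have "calls f_sim_leaf (sim_arg k C D) (encode d) (20 * Z * (U + 8 * G))"
      (is "calls _ ?u ?v _")
    proof (rule calls_if_yields[where c = ?c])
      show "yields f_sim_leaf ?u ?v ?c"
        using callsD[OF d(1)] CD by (simp add: yields_def b_sim_leaf_def Let_def sim_arg_def)
    qed (use size_env[OF k] covered_data_sizes[OF C k'] covered_data_sizes[OF D k'] Z_le_square
        size_fits[OF fits_der[OF F z]] Z_ge G_pos in \<open>simp_all add: sim_arg_def\<close>)
    with F show ?thesis unfolding runs_def by blast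
  next
    assume CD: "C = FF" "D = Atom a"
    show ?thesis
      by (rule sim_leaf_frame[OF k C D, where p = False and q = False and E = D])
        (use CD generic_small(1)[OF covered_sizes(2)[OF D k']] in auto)
  next
    assume CD: "C = Or (Atom a) (Atom a)" "D = Atom a"
    show ?thesis
      by (rule sim_leaf_frame[OF k C D, where p = False and q = True and E = D])
        (use CD generic_small(2)[OF covered_sizes(2)[OF D k']] in auto)
  next
    assume CD: "C = Atom a" "D = TT"
    show ?thesis
      by (rule sim_leaf_frame[OF k C D, where p = True and q = False and E = C])
        (use CD generic_small(3)[OF covered_sizes(2)[OF C k']] in auto)
  next
    assume CD: "C = Atom a" "D = And (Atom a) (Atom a)"
    show ?thesis
      by (rule sim_leaf_frame[OF k C D, where p = True and q = True and E = C])
        (use CD generic_small(4)[OF covered_sizes(2)[OF C k']] in auto)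
  qed
qed

lemma sim_leaf_fails:
  assumes k: "k < m" and C: "covered C" and D: "covered D" and rule: "\<not> atomic_rule C D"
  shows "calls f_sim_leaf (sim_arg k C D) DNil 1"
proof -
  have k': "k \<le> m" using k by simp
  let ?u = "sim_arg k C D"
  have "ok [?u] (cut_program ! f_sim_leaf) \<and> ev [?u] (cut_program ! f_sim_leaf) = DNil \<and>
    cost [?u] (cut_program ! f_sim_leaf) = 0"
    using rule unfolding atomic_rule_def
    by (cases C; cases D) (auto simp: b_sim_leaf_def Let_def sim_arg_def)
  then show ?thesis
    using size_env[OF k] covered_data_sizes[OF C k'] covered_data_sizes[OF D k'] Z_le_square
    by (intro callsI) (simp_all add: sim_arg_def)
qed

definition wrap_arg :: "nat \<Rightarrow> 'a fm \<Rightarrow> 'a fm \<Rightarrow> 'a fm \<Rightarrow> 'a fm \<Rightarrow> 'a fm \<Rightarrow> 'a fm list \<Rightarrow> 'a data" where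
  "wrap_arg k C D C' D' E r = DCons (env k) (DCons (encode_fm C) (DCons (encode_fm D) (DCons (encode_fm C')
     (DCons (encode_fm D') (DCons (encode_fm E) (encode r))))))"

text \<open>A switch is all it takes to move through one connective: at a disjunction it brings
  \<open>\<theta> k\<close> inwards to \<open>C'\<close>, at a conjunction it brings
  \<open>\<theta> (Suc k)\<close> outwards from \<open>D'\<close>. The remaining rearrangements are
  equality steps, and neither threshold is duplicated.\<close>

lemma wrap_runs:
  assumes k: "k < m" and C: "covered C" and D: "covered D"
    and shape: "C = mk c C' E \<and> D = mk c D' E \<or> C = mk c E C' \<and> D = mk c E D'"
    and r: "r \<noteq> [] \<Longrightarrow> der s r (lhs k C') (rhs k D')" and s: "s + 2 * G \<le> Z"
  shows "\<exists>e. calls f_wrap (wrap_arg k C D C' D' E r) (encode e) (20 * Z * (2 * G)) \<and>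
    (r = [] \<longrightarrow> e = []) \<and> (r \<noteq> [] \<longrightarrow> e \<noteq> [] \<and> der (s + 2 * G) e (lhs k C) (rhs k D))"
proof -
  have k': "k \<le> m" "Suc k \<le> m" using k by auto
  have cov: "covered C'" "covered D'" "covered E"
    using covered_mk[of c C' E] covered_mk[of c E C'] covered_mk[of c D' E] covered_mk[of c E D'] C D shape by auto
  note sizes = covered_data_sizes[OF C k'(1)] covered_data_sizes[OF D k'(1)] covered_data_sizes[OF cov(1) k'(1)]
    covered_data_sizes[OF cov(2) k'(1)] covered_data_sizes[OF cov(3) k'(1)]
  show ?thesis
  proof (cases "r = []")
    case True
    have "calls f_wrap (wrap_arg k C D C' D' E r) (encode []) (20 * Z * (2 * G))"
      by (rule calls_if_yields[where c = 0])
        (use True size_env[OF k] sizes Z_le_square Z_ge G_pos in \<open>simp_all add: yields_def b_wrap_def Let_def wrap_arg_def\<close>)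
    then show ?thesis using True by blast
  next
    case False
    let ?C = "subst (\<sigma> k) C" and ?D = "subst (\<sigma> k) D" and ?C' = "subst (\<sigma> k) C'" and ?D' = "subst (\<sigma> k) D'"
      and ?E = "subst (\<sigma> k) E" and ?t = "\<theta> k" and ?n = "\<theta> (Suc k)"
    note rr = r[OF False]
    have E: "fm_size ?E \<le> B" using covered_sizes(2)[OF cov(3) k'(1)] .
    have z: "s + B \<le> Z" "s \<le> Z" "s + B + 10 * B \<le> Z" using s G_ge by linarith+
    note p = par_der[OF rr der_single[OF E] z(1), of c]
    define post where "post = (if c then [And ?E (Or ?D' ?n), Or (And ?E ?D') ?n, rhs k D] else [rhs k D])"
    define pre where "pre = (if c then [] else [And ?t (Or ?C' ?E)])"
    have b: "fm_size ?E + fm_size ?D' \<le> B" "fm_size ?C' + fm_size ?E \<le> B" "fm_size ?t \<le> B" "fm_size ?n \<le> B" "fm_size ?D \<le> B" "fm_size ?C \<le> B"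
      using covered_sizes(2)[OF C k'(1)] covered_sizes(2)[OF D k'(1)] shape theta_size[OF k'(1)] theta_size[OF k'(2)]
      by (auto split: if_splits)
    have post: "der (10 * B) post (if c then And ?E (Or ?D' ?n) else rhs k D) (rhs k D)"
    proof -
      have "step (And ?E (Or ?D' ?n)) (Or (And ?E ?D') ?n)" by (rule step_rules)
      moreover have "c \<Longrightarrow> step (Or (And ?E ?D') ?n) (rhs k D)"
        using shape by (intro step_feq) (auto simp: rhs_def feq_simps)
      ultimately show ?thesis using b B_pos by (auto simp: post_def der_def rhs_def)
    qed
    have st1: "step (mk c (rhs k D') ?E) (if c then And ?E (Or ?D' ?n) else rhs k D)"
      using shape by (intro step_feq) (auto simp: rhs_def feq_simps)
    have st2: "\<not> c \<Longrightarrow> step (lhs k C) (And ?t (Or ?C' ?E))" "\<not> c \<Longrightarrow> step (And ?t (Or ?C' ?E)) (mk c (lhs k C') ?E)"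
      using shape by (auto simp: lhs_def feq_simps intro: step_rules step_feq)
    have st3: "c \<Longrightarrow> step (lhs k C) (mk c (lhs k C') ?E)"
      using shape by (intro step_feq) (auto simp: lhs_def feq_simps)
    note q = append_der[OF p(2) post z(3) st1]
    have q': "der (2 * B + (s + B + 10 * B)) (pre @ par c r [?E] @ post) (if c then mk c (lhs k C') ?E else And ?t (Or ?C' ?E)) (rhs k D)"
    proof (cases c)
      case True
      then show ?thesis using der_mono[OF q(2)] by (simp add: pre_def)
    next
      case False
      then show ?thesis using der_mono[OF der_Cons[OF q(2) st2(2)]] b by (simp add: pre_def)
    qed
    have F: "der (s + 2 * G) (lhs k C # pre @ par c r [?E] @ post) (lhs k C) (rhs k D)"
      by (rule der_mono[OF der_Cons[OF q']]) (use st2(1) st3 b G_ge B_pos in \<open>auto simp: lhs_def\<close>)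
    note sub = callsD[OF subst_calls[OF k C]] callsD[OF subst_calls[OF k D]] callsD[OF subst_calls[OF k cov(1)]]
      callsD[OF subst_calls[OF k cov(2)]] callsD[OF subst_calls[OF k cov(3)]]
    have hd: "data_hd (encode_fm C) = data_bool c" using shape by auto
    let ?c = "20 * Z * (10 * B) + 5 * Z"
    have "calls f_wrap (wrap_arg k C D C' D' E r) (encode (lhs k C # pre @ par c r [?E] @ post)) (20 * Z * (2 * G))"
      (is "calls _ ?u ?v _")
    proof (rule calls_if_yields[where c = ?c])
      show "yields f_wrap ?u ?v ?c"
        using sub callsD[OF p(1)] callsD[OF q(1)] False hd
        by (cases c) (simp_all add: yields_def b_wrap_def Let_def wrap_arg_def pre_def post_def env_def lhs_def rhs_def)
      have "10 * B < 2 * G" using G_ge B_pos by linarith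
      from budget[OF this] show "?c < 20 * Z * (2 * G)"
        using Z_ge by linarith
    qed (use size_env[OF k] sizes Z_le_square size_fits[OF fits_der[OF F s]] size_fits[OF fits_der[OF rr z(2)]] in \<open>simp_all add: wrap_arg_def\<close>)
    with F False show ?thesis by blast
  qed
qed

end

section \<open>Simulation of steps in context, of all lines, and of all levels\<close>

context simulation
begin

definition attempt :: "nat \<Rightarrow> 'a fm \<Rightarrow> 'a fm \<Rightarrow> nat \<Rightarrow> bool" where
  "attempt k C D s \<longleftrightarrow> (\<exists>d. calls f_sim (sim_arg k C D) (encode d) (20 * Z * s) \<and>
     (d \<noteq> [] \<longrightarrow> der s d (lhs k C) (rhs k D)) \<and> (atomic_step C D \<longrightarrow> d \<noteq> []))"

lemma attempt_leaf:
  assumes k: "k < m" and C: "covered C" and D: "covered D"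
    and leaf: "data_tl (encode_fm C) = DNil \<or> data_tl (encode_fm D) = DNil"
    and nomk: "(\<nexists>c C1 C2. C = mk c C1 C2) \<or> (\<nexists>c D1 D2. D = mk c D1 D2)"
  shows "attempt k C D (U + 9 * G)"
proof -
  have k': "k \<le> m" using k by simp
  have z: "U + 9 * G \<le> Z" using room' U_ge by linarith
  show ?thesis
  proof (cases "atomic_rule C D")
    case True
    obtain d where d: "calls f_sim_leaf (sim_arg k C D) (encode d) (20 * Z * (U + 8 * G))"
      "der (U + 8 * G) d (lhs k C) (rhs k D)"
      using sim_leaf_runs[OF k C D True] unfolding runs_def by blast
    have F: "der (U + 9 * G) d (lhs k C) (rhs k D)" by (rule der_mono[OF d(2)]) simp
    let ?c = "20 * Z * (U + 8 * G)"
    have "calls f_sim (sim_arg k C D) (encode d) (20 * Z * (U + 9 * G))"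
      (is "calls _ ?u ?v _")
    proof (rule calls_if_yields[where c = ?c])
      show "yields f_sim ?u ?v ?c"
        using callsD[OF d(1)] leaf by (auto simp: yields_def b_sim_def Let_def sim_arg_def)
    qed (use size_env[OF k] covered_data_sizes[OF C k'] covered_data_sizes[OF D k'] Z_le_square
        size_fits[OF fits_der[OF F z]] Z_ge G_pos in \<open>simp_all add: sim_arg_def\<close>)
    moreover have "d \<noteq> []" using F by (simp add: der_def)
    ultimately show ?thesis using F unfolding attempt_def by blast
  next
    case False
    note c = sim_leaf_fails[OF k C D False]
    have "calls f_sim (sim_arg k C D) (encode []) (20 * Z * (U + 9 * G))"
      (is "calls _ ?u ?v _")
    proof (rule calls_if_yields[where c = 1])
      show "yields f_sim ?u ?v 1"
        using callsD[OF c] leaf by (auto simp: yields_def b_sim_def Let_def sim_arg_def)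
      have "20 * 10 * 9 \<le> 20 * Z * (U + 9 * G)" using Z_ge G_pos by (intro mult_le_mono) auto
      then show "1 < 20 * Z * (U + 9 * G)" by simp
    qed (use size_env[OF k] covered_data_sizes[OF C k'] covered_data_sizes[OF D k'] Z_le_square in \<open>simp_all add: sim_arg_def\<close>)
    moreover have "\<not> atomic_step C D" using atomic_step_leaf nomk False by blast
    ultimately show ?thesis unfolding attempt_def by (intro exI[of _ "[]"]) simp
  qed
qed

lemma attempt_mono: "attempt k C D s \<Longrightarrow> s \<le> r \<Longrightarrow> attempt k C D r"
  unfolding attempt_def using der_mono calls_mono mult_le_mono2 by metis

lemma attempt_mk:
  assumes k: "k < m" and C: "covered (mk c C1 C2)" and D: "covered (mk c' D1 D2)"
    and IH: "attempt k C1 D1 s" "attempt k C2 D2 s" and s: "s + 4 * G \<le> Z"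
  shows "attempt k (mk c C1 C2) (mk c' D1 D2) (s + 4 * G)"
proof -
  let ?C = "mk c C1 C2" and ?D = "mk c' D1 D2"
  have k': "k \<le> m" using k by simp
  note sizes = size_env[OF k] covered_data_sizes[OF C k'] covered_data_sizes[OF D k'] Z_le_square Z_ge G_pos
  show ?thesis
  proof (cases "c = c' \<and> (C2 = D2 \<or> C1 = D1)")
    case True
    define C' D' E where "C' = (if C2 = D2 then C1 else C2)" and "D' = (if C2 = D2 then D1 else D2)"
      and "E = (if C2 = D2 then C2 else C1)"
    have "attempt k C' D' s" using IH unfolding C'_def D'_def by simp
    then obtain r where r: "calls f_sim (sim_arg k C' D') (encode r) (20 * Z * s)"
      "r \<noteq> [] \<Longrightarrow> der s r (lhs k C') (rhs k D')" "atomic_step C' D' \<Longrightarrow> r \<noteq> []"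
      unfolding attempt_def by blast
    have sh: "?C = mk c C' E \<and> ?D = mk c D' E \<or> ?C = mk c E C' \<and> ?D = mk c E D'"
      using True by (auto simp: C'_def D'_def E_def)
    obtain e where e: "calls f_wrap (wrap_arg k ?C ?D C' D' E r) (encode e) (20 * Z * (2 * G))"
      "r = [] \<longrightarrow> e = []" "r \<noteq> [] \<longrightarrow> e \<noteq> [] \<and> der (s + 2 * G) e (lhs k ?C) (rhs k ?D)"
      using wrap_runs[OF k C D sh r(2)] s by auto
    have F: "e \<noteq> [] \<Longrightarrow> der (s + 4 * G) e (lhs k ?C) (rhs k ?D)"
    proof -
      assume "e \<noteq> []"
      then have "der (s + 2 * G) e (lhs k ?C) (rhs k ?D)" using e(2,3) by blast
      then show ?thesis by (rule der_mono) simp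
    qed
    have sze: "data_size (encode e) \<le> 9 * Z2"
      using size_fits[OF fits_der[OF F s]] Z_le_square by (cases "e = []") auto
    let ?c = "20 * Z * s + 20 * Z * (2 * G)"
    have "calls f_sim (sim_arg k ?C ?D) (encode e) (20 * Z * (s + 4 * G))"
      (is "calls _ ?u ?v _")
    proof (rule calls_if_yields[where c = ?c])
      show "yields f_sim ?u ?v ?c"
        using callsD[OF r(1)] callsD[OF e(1)] True
        by (cases "C2 = D2") (simp_all add: yields_def b_sim_def Let_def sim_arg_def wrap_arg_def C'_def D'_def E_def)
      show "?c < 20 * Z * (s + 4 * G)"
        using budget[of "s + 2 * G" "s + 4 * G"] Z_ge G_pos by (simp add: distrib_left)
    qed (use sizes sze in \<open>simp_all add: sim_arg_def\<close>)
    \<comment> \<open>If the second subformulae coincide, an atomic step must change the first ones,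
      by \<open>atomic_step_neq\<close>; otherwise it changes the second ones. This is the branch
      that the program takes.\<close>
    moreover have "atomic_step ?C ?D \<Longrightarrow> e \<noteq> []"
      using atomic_step_mk[of c C1 C2 c' D1 D2] True e r(3) atomic_step_neq[of C2 D2]
      unfolding C'_def D'_def by (cases "C2 = D2") auto
    ultimately show ?thesis using F unfolding attempt_def by blast
  next
    case False
    have "calls f_sim (sim_arg k ?C ?D) (encode []) 1"
      using False sizes
      by (intro callsI; auto simp: b_sim_def Let_def sim_arg_def)
    then have "calls f_sim (sim_arg k ?C ?D) (encode []) (20 * Z * (s + 4 * G))"
      by (rule calls_mono) (use Z_ge G_pos in simp)
    moreover have "\<not> atomic_step ?C ?D"
      using atomic_step_mk[of c C1 C2 c' D1 D2] False atomic_step_neq by blast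
    ultimately show ?thesis unfolding attempt_def by (intro exI[of _ "[]"]) simp
  qed
qed

lemma attempt_exists:
  "k < m \<Longrightarrow> covered C \<Longrightarrow> covered D \<Longrightarrow> attempt k C D (U + 9 * G + 4 * (fm_size C * G))"
proof (induction C arbitrary: D)
  have mk: "attempt k (mk c C1 C2) D (U + 9 * G + 4 * (fm_size (mk c C1 C2) * G))"
    if k: "k < m" and C: "covered (mk c C1 C2)" and D: "covered D"
      and IH: "\<And>D. covered D \<Longrightarrow> attempt k C1 D (U + 9 * G + 4 * (fm_size C1 * G))"
        "\<And>D. covered D \<Longrightarrow> attempt k C2 D (U + 9 * G + 4 * (fm_size C2 * G))" for c C1 C2 D
  proof (cases "\<exists>c' D1 D2. D = mk c' D1 D2")
    case False
    then have "data_tl (encode_fm D) = DNil"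
      by (cases D) (auto, metis (full_types), metis (full_types))
    then have "attempt k (mk c C1 C2) D (U + 9 * G)"
      using False by (intro attempt_leaf[OF k C D]) auto
    then show ?thesis by (rule attempt_mono) simp
  next
    case True
    then obtain c' D1 D2 where D': "D = mk c' D1 D2" by blast
    have covD: "covered D1" "covered D2" using D covered_mk[of c' D1 D2] unfolding D' by auto
    have "4 * (fm_size (mk c C1 C2) * G) \<le> U"
      unfolding U_def using covered_sizes(1)[OF C less_imp_le[OF k]] by (intro mult_le_mono) auto
    then have z: "U + 9 * G + 4 * (fm_size (mk c C1 C2) * G) \<le> Z" using room' U_ge by linarith
    \<comment> \<open>The maximum gives a common bound for both recursive attempts. The connective
      adds at least one to it, which pays for the \<open>4 * G\<close> of
      \<open>attempt_mk\<close>.\<close>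
    define f where "f = max (fm_size C1) (fm_size C2)"
    have f: "f + 1 \<le> fm_size (mk c C1 C2)"
      using fm_size_pos[of C1] fm_size_pos[of C2] by (auto simp: f_def)
    have IH': "attempt k C1 D1 (U + 9 * G + 4 * (f * G))" "attempt k C2 D2 (U + 9 * G + 4 * (f * G))"
      by (rule attempt_mono[OF IH(1)[OF covD(1)]], simp add: f_def)
        (rule attempt_mono[OF IH(2)[OF covD(2)]], simp add: f_def)
    have le: "U + 9 * G + 4 * (f * G) + 4 * G \<le> U + 9 * G + 4 * (fm_size (mk c C1 C2) * G)"
      using mult_le_mono1[OF f, of G] by simp
    have "attempt k (mk c C1 C2) (mk c' D1 D2) (U + 9 * G + 4 * (f * G) + 4 * G)"
      using D le z by (intro attempt_mk[OF k C _ IH']) (auto simp: D')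
    then show ?thesis unfolding D' using le by (rule attempt_mono)
  qed
  {
    case FF
    show ?case by (rule attempt_mono[OF attempt_leaf]) (use FF in auto)
  next
    case TT
    show ?case by (rule attempt_mono[OF attempt_leaf]) (use TT in auto)
  next
    case (Atom a)
    show ?case by (rule attempt_mono[OF attempt_leaf]) (use Atom in auto)
  next
    case (Or C1 C2)
    show ?case using mk[of False C1 C2 D] Or covered_mk[of False C1 C2] by simp
  next
    case (And C1 C2)
    show ?case using mk[of True C1 C2 D] And covered_mk[of True C1 C2] by simp
  }
qed

text \<open>When the attempt fails, \<open>step_classification\<close> makes the image of the step a
  single cut-free step, and a frame around these two lines is enough.\<close>

lemma sim_line_runs:
  assumes k: "k < m" and C: "covered C" and D: "covered D" and inf: "inference_step bar SKS C D"
  shows "runs f_sim_line (sim_arg k C D) (6 * U) (lhs k C) (rhs k D)"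
proof -
  have k': "k \<le> m" using k by simp
  have "4 * (fm_size C * G) \<le> U"
    unfolding U_def using covered_sizes(1)[OF C k'] by (intro mult_le_mono) auto
  then have "U + 9 * G + 4 * (fm_size C * G) \<le> 2 * U + 9 * G" by simp
  from attempt_mono[OF attempt_exists[OF k C D] this] obtain d where
    d: "calls f_sim (sim_arg k C D) (encode d) (20 * Z * (2 * U + 9 * G))"
      "d \<noteq> [] \<Longrightarrow> der (2 * U + 9 * G) d (lhs k C) (rhs k D)" "atomic_step C D \<Longrightarrow> d \<noteq> []"
    unfolding attempt_def by blast
  have z: "6 * U \<le> Z" using room' by linarith
  show ?thesis
  proof (cases "d = []")
    case False
    have F: "der (6 * U) d (lhs k C) (rhs k D)" by (rule der_mono[OF d(2)[OF False]]) (use U_ge in linarith)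
    \<comment> \<open>The attempt is evaluated twice, first as the condition and then as the
      result.\<close>
    let ?c = "20 * Z * (2 * U + 9 * G) + 20 * Z * (2 * U + 9 * G)"
    have "calls f_sim_line (sim_arg k C D) (encode d) (20 * Z * (6 * U))"
      (is "calls _ ?u ?v _")
    proof (rule calls_if_yields[where c = ?c])
      show "yields f_sim_line ?u ?v ?c"
        using callsD[OF d(1)] False by (simp add: yields_def b_sim_line_def)
      have "2 * U + 9 * G + (2 * U + 9 * G) < 6 * U" using U_ge G_pos by simp
      from budget[OF this] show "?c < 20 * Z * (6 * U)"
        unfolding distrib_left using Z_ge by linarith
    qed (use size_env[OF k] covered_data_sizes[OF C k'] covered_data_sizes[OF D k'] Z_le_square
        size_fits[OF fits_der[OF F z]] in \<open>simp_all add: sim_arg_def\<close>)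
    with F show ?thesis unfolding runs_def by blast
  next
    case True
    let ?C = "subst (\<sigma> k) C" and ?D = "subst (\<sigma> k) D"
    have st: "step ?C ?D" using step_classification[OF inf] d(3) True by blast
    have "der (B + B) [?C, ?D] ?C ?D"
      using covered_sizes(2)[OF C k'] covered_sizes(2)[OF D k'] st B_pos by (auto simp: der_def)
    then have f: "der (B + B) [?C, ?D] ?C ?D" .
    have z2: "B + B + 6 * G \<le> Z" using room' G_ge U_ge by linarith
    obtain e where e: "calls f_frame (DCons (env k) (DCons (encode_fm C) (DCons (encode_fm D) (encode [?C, ?D])))) (encode e) (20 * Z * (B + B + 6 * G))"
      "der (B + B + 6 * G) e (lhs k C) (rhs k D)"
      using frame_runs[OF k C D f z2] unfolding runs_def by blast
    have F: "der (6 * U) e (lhs k C) (rhs k D)" by (rule der_mono[OF e(2)]) (use U_ge G_ge in linarith)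
    note sub = callsD[OF subst_calls[OF k C]] callsD[OF subst_calls[OF k D]]
    let ?c = "20 * Z * (2 * U + 9 * G) + 20 * Z * (B + B + 6 * G) + 20 * Z * (2 * B)"
    have "calls f_sim_line (sim_arg k C D) (encode e) (20 * Z * (6 * U))"
      (is "calls _ ?u ?v _")
    proof (rule calls_if_yields[where c = ?c])
      show "yields f_sim_line ?u ?v ?c"
        using callsD[OF d(1)] callsD[OF e(1)] sub True by (simp add: yields_def b_sim_line_def sim_arg_def)
      have "2 * U + 9 * G + (B + B + 6 * G) + 2 * B < 6 * U" using U_ge G_ge B_pos by linarith
      from budget[OF this]
      show "?c < 20 * Z * (6 * U)"
        unfolding distrib_left using Z_ge by linarith
    qed (use size_env[OF k] covered_data_sizes[OF C k'] covered_data_sizes[OF D k'] Z_le_square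
        size_fits[OF fits_der[OF F z]] in \<open>simp_all add: sim_arg_def\<close>)
    with F show ?thesis unfolding runs_def by blast
  qed
qed

text \<open>One copy of \<open>\<theta> k\<close> is spent on the current step and the other is kept
  for the later ones; the step leaves one more \<open>\<theta> (Suc k)\<close>, contracted
  immediately. A step takes \<open>6 * U\<close> and the bookkeeping fits into the other
  \<open>2 * U\<close>. The last line is led back from its image by
  \<open>pull_sigma\<close>.\<close>

lemma lines_runs:
  assumes k: "k < m"
  shows "successively (inference_step bar SKS) (C # Ds) \<Longrightarrow> (\<forall>D\<in>set (C # Ds). covered D) \<Longrightarrow>
    (length Ds + 1) * (8 * U) \<le> Z \<Longrightarrow>
    runs f_lines (DCons (env k) (encode (C # Ds))) ((length Ds + 1) * (8 * U))
      (Or (lhs k C) (\<theta> (Suc k))) (Or (last (C # Ds)) (\<theta> (Suc k)))"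
proof (induction Ds arbitrary: C)
  case (Nil C)
  let ?C = "subst (\<sigma> k) C" and ?n = "\<theta> (Suc k)"
  have k': "k \<le> m" "Suc k \<le> m" using k by auto
  have C: "covered C" using Nil by simp
  have n: "fm_size ?n \<le> B" using theta_size[OF k'(2)] .
  obtain d where d: "calls f_drop (DCons (encode_fm (\<theta> k)) (encode_fm ?C)) (encode d) (20 * Z * (2 * G))"
    "der (2 * G) d (lhs k C) (And TT ?C)"
    using drop_runs[OF theta_size[OF k'(1)] covered_sizes(2)[OF C k'(1)]] unfolding runs_def lhs_def by blast
  obtain p where p: "calls f_pull (pull_arg k ?n C) (encode p) (20 * Z * U)" "der U p ?C (Or C ?n)"
    using pull_sigma[OF k C] unfolding runs_def by blast
  obtain g where g: "calls f_generic (DCons DNil (DCons (DCons DNil DNil) (encode_fm ?n))) (encode g) (20 * Z * G)"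
    "der G g (Or ?n ?n) ?n"
    using generic_small(2)[OF n] unfolding runs_def by blast
  have z: "2 * G + B \<le> Z" "U + B \<le> Z" "B + G \<le> Z" "U + B + (B + G) \<le> Z" "2 * G + B + (U + B + (B + G)) \<le> Z" "8 * U \<le> Z"
    using room' U_ge G_ge by linarith+
  note q1 = parOr_der[OF d(2) der_single[OF n] z(1)]
  note q2 = parOr_der[OF p(2) der_single[OF n] z(2)]
  note q3 = parOr_der[OF der_single[OF covered_sizes(1)[OF C k'(1)]] g(2) z(3)]
  have st: "step (Or (And TT ?C) ?n) (Or ?C ?n)" "step (Or (Or C ?n) ?n) (Or C (Or ?n ?n))"
    by (auto intro!: step_feq simp: feq_simps)
  note a1 = append_der[OF q2(2) q3(2) z(4) st(2)]
  note a2 = append_der[OF q1(2) a1(2) z(5) st(1)]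
  let ?L = "par False d [?n] @ par False p [?n] @ par False [C] g"
  have F: "der (8 * U) ?L (Or (lhs k C) ?n) (Or C ?n)"
    by (rule der_mono[OF a2(2)]) (use U_ge G_ge in linarith)
  let ?c = "20 * Z * (2 * G) + 20 * Z * U + 20 * Z * G + 20 * Z * B + 13 * Z"
  have "calls f_lines (DCons (env k) (encode [C])) (encode ?L) (20 * Z * (8 * U))"
    (is "calls _ ?u ?v _")
  proof (rule calls_if_yields[where c = ?c])
    show "yields f_lines ?u ?v ?c"
      using callsD[OF d(1)] callsD[OF p(1)] callsD[OF g(1)] callsD[OF q1(1)] callsD[OF q2(1)] callsD[OF q3(1)]
        callsD[OF a1(1)] callsD[OF a2(1)] callsD[OF subst_calls[OF k C]]
      by (simp add: yields_def b_lines_def Let_def env_def pull_arg_def)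
    have "2 * G + U + G + B < 8 * U" using U_ge G_ge B_pos by linarith
    from budget[OF this] show "?c < 20 * Z * (8 * U)"
      unfolding distrib_left using Z_ge by linarith
  qed (use size_env[OF k] covered_data_sizes[OF C k'(1)] Z_le_square size_fits[OF fits_der[OF F z(6)]] in simp_all)
  with F show ?case unfolding runs_def by auto
next
  case (Cons D Ds C)
  let ?C = "subst (\<sigma> k) C" and ?D = "subst (\<sigma> k) D" and ?t = "\<theta> k" and ?n = "\<theta> (Suc k)"
  define S where "S = (length Ds + 1) * (8 * U)"
  have S: "(length (D # Ds) + 1) * (8 * U) = 8 * U + S" by (simp add: S_def)
  have Z: "8 * U + S \<le> Z" using Cons.prems(3) unfolding S .
  have k': "k \<le> m" "Suc k \<le> m" using k by auto
  have C: "covered C" and D: "covered D" using Cons.prems by auto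
  have n: "fm_size ?n \<le> B" and t: "fm_size ?t \<le> B" using theta_size k' by auto
  have sC: "fm_size ?C \<le> B" and sD: "fm_size ?D \<le> B" using covered_sizes(2) C D k' by auto
  obtain r where r: "calls f_lines (DCons (env k) (encode (D # Ds))) (encode r) (20 * Z * S)"
    "der S r (Or (lhs k D) ?n) (Or (last (D # Ds)) ?n)"
    using Cons.IH[of D] Cons.prems Z unfolding runs_def S_def by auto
  obtain l where l: "calls f_sim_line (sim_arg k C D) (encode l) (20 * Z * (6 * U))" "der (6 * U) l (lhs k C) (rhs k D)"
    using sim_line_runs[OF k C D] Cons.prems(1) unfolding runs_def by auto
  obtain g where g: "calls f_generic (DCons DNil (DCons (DCons DNil DNil) (encode_fm ?n))) (encode g) (20 * Z * G)"
    "der G g (Or ?n ?n) ?n"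
    using generic_small(2)[OF n] unfolding runs_def by blast
  obtain h where h: "calls f_generic (DCons (DCons DNil DNil) (DCons (DCons DNil DNil) (encode_fm ?t))) (encode h) (20 * Z * G)"
    "der G h ?t (And ?t ?t)"
    using generic_small(4)[OF t] unfolding runs_def by blast
  have sl: "fm_size (lhs k D) \<le> 2 * B" using t sD by (simp add: lhs_def)
  have z: "G + B \<le> Z" "G + B + B \<le> Z" "B + 6 * U \<le> Z" "B + 6 * U + B \<le> Z" "2 * B + G \<le> Z" "2 * B + G + S \<le> Z"
    "B + 6 * U + B + (4 * B + (2 * B + G + S)) \<le> Z" "G + B + B + (B + 6 * U + B + (4 * B + (2 * B + G + S))) \<le> Z"
    using Z U_ge G_ge B_pos by linarith+
  note p1 = parAnd_der[OF h(2) der_single[OF sC] z(1)]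
  note p2 = parOr_der[OF p1(2) der_single[OF n] z(2)]
  note p3 = parAnd_der[OF der_single[OF t] l(2) z(3)]
  note p4 = parOr_der[OF p3(2) der_single[OF n] z(4)]
  note p5 = parOr_der[OF der_single[OF sl] g(2) z(5)]
  note a1 = append_der[OF p5(2) r(2) z(6) step_refl]
  let ?M = "Or (Or (And ?t ?D) ?n) ?n"
  have st1: "step ?M (Or (lhs k D) (Or ?n ?n))"
    by (auto intro!: step_feq simp: feq_simps lhs_def)
  have st2: "step (Or (And ?t (rhs k D)) ?n) ?M"
    unfolding rhs_def by (intro step_ctx step_rules)
  have st3: "step (Or (And (And ?t ?t) ?C) ?n) (Or (And ?t (lhs k C)) ?n)"
    by (auto intro!: step_feq simp: feq_simps lhs_def)
  have a2: "der (4 * B + (2 * B + G + S)) (?M # par False [lhs k D] g @ r) ?M (Or (last (D # Ds)) ?n)"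
    by (rule der_mono[OF der_Cons[OF a1(2) st1]]) (use t sD n in simp)
  note a3 = append_der[OF p4(2) a2 z(7) st2]
  note a4 = append_der[OF p2(2) a3(2) z(8) st3]
  let ?L = "par False (par True h [?C]) [?n] @ par False (par True [?t] l) [?n] @ ?M # par False [lhs k D] g @ r"
  have F: "der (8 * U + S) ?L (Or (lhs k C) ?n) (Or (last (C # D # Ds)) ?n)"
    using der_mono[OF a4(2), of "8 * U + S"] U_ge G_ge B_pos by (simp add: lhs_def)
  have len: "length (C # D # Ds) \<le> Z"
  proof -
    have "1 \<le> 8 * U" using U_ge G_pos by linarith
    then have "(length (D # Ds) + 1) * 1 \<le> (length (D # Ds) + 1) * (8 * U)" by (rule mult_le_mono2)
    then show ?thesis using Cons.prems(3) by simp
  qed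
  have szs: "data_size (encode (C # D # Ds)) \<le> 9 * Z2"
  proof (rule size_fits)
    show "fits (C # D # Ds)"
      using len Cons.prems(2) covered_sizes(1)[OF _ k'(1)] room' unfolding fits_def by (meson le_trans)
  qed
  let ?c = "20 * Z * (2 * G) + 20 * Z * (6 * U) + 20 * Z * (3 * B) + 20 * Z * S + 22 * Z"
  have "calls f_lines (DCons (env k) (encode (C # D # Ds))) (encode ?L) (20 * Z * (8 * U + S))"
    (is "calls _ ?u ?v _")
  proof (rule calls_if_yields[where c = ?c])
    show "yields f_lines ?u ?v ?c"
      using callsD[OF r(1)] callsD[OF l(1)] callsD[OF g(1)] callsD[OF h(1)] callsD[OF p1(1)] callsD[OF p2(1)] callsD[OF p3(1)]
        callsD[OF p4(1)] callsD[OF p5(1)] callsD[OF a1(1)] callsD[OF a3(1)] callsD[OF a4(1)]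
        callsD[OF subst_calls[OF k C]] callsD[OF subst_calls[OF k D]]
      by (simp add: yields_def b_lines_def Let_def env_def sim_arg_def lhs_def)
    have "2 * G + 6 * U + 3 * B + S + 1 < 8 * U + S" using U_ge G_ge B_pos by linarith
    from budget[OF this] show "?c < 20 * Z * (8 * U + S)"
      unfolding distrib_left using Z_ge by linarith
  qed (use size_env[OF k] szs Z_le_square size_fits[OF fits_der[OF F Z]] in simp_all)
  with F show ?case unfolding runs_def S by blast
qed

definition levels_arg :: "nat \<Rightarrow> nat \<Rightarrow> 'a fm list \<Rightarrow> 'a data" where
  "levels_arg k j As = DCons (encode_tree T) (DCons (num k) (DCons (num j) (DCons (encode_fm (last As)) (encode As))))"

text \<open>Each level trades \<open>\<theta> k\<close> for \<open>\<theta> (Suc k)\<close> at the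
  price of a second copy of the conclusion, which is contracted. The simulated proof starts from
  \<open>lhs k TT\<close>, and this equals \<open>\<theta> k\<close>.\<close>

lemma levels_runs:
  assumes pf: "is_proof bar SKS As \<alpha>" and cov: "\<forall>A\<in>set As. covered A" and top: "atom_leaves T < m"
    and As: "length As \<le> Z" and TT: "covered TT"
  shows "k + j = m \<Longrightarrow> (j + 1) * (length As * (9 * U)) \<le> Z \<Longrightarrow>
    runs f_levels (levels_arg k j As) ((j + 1) * (length As * (9 * U))) (Or \<alpha> (\<theta> k)) \<alpha>"
proof (induction j arbitrary: k)
  have As0: "As \<noteq> []" "last As = \<alpha>" "hd As = TT" "successively (inference_step bar SKS) As"
    using pf by (auto simp: is_proof_def derivation_def)
  have \<alpha>: "covered \<alpha>" using cov As0 by auto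
  have sA: "fm_size \<alpha> \<le> B" using covered_sizes(1)[OF \<alpha>, of 0] by simp
  have szA: "data_size (encode As) \<le> 9 * Z2"
  proof (rule size_fits)
    show "fits As" using As cov covered_sizes(1)[of _ 0] room' unfolding fits_def by (meson le0 le_trans)
  qed
  have len: "9 * U \<le> length As * (9 * U)" using As0(1) by (cases As) auto
  {
    case (0 k)
    then have k: "k = m" by simp
    let ?t = "\<theta> m"
    obtain d where d: "calls f_threshold (threshold_arg None T m) (encode d) (20 * Z * threshold_bound m h)"
      "der (threshold_bound m h) d ?t (all_true ?t)"
      using theta_run[of m] unfolding runs_def by blast
    \<comment> \<open>\<open>m\<close> exceeds the number of atom leaves, so the last threshold can
      be coweakened to a formula that equals \<open>FF\<close>.\<close>
    have "\<not> truth (all_true ?t)" using truth_threshold[of T m] top by (simp add: \<theta>_def)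
    then have "feq (all_true ?t) FF" using feq_truth[of ?t] by simp
    then have st: "step (Or \<alpha> (all_true ?t)) \<alpha>"
      by (intro step_feq) (simp add: feq_iff_class class_units)
    have z: "B + B \<le> Z" "B + B + B \<le> Z" "9 * U \<le> Z" using room' U_ge G_ge by linarith+
    note p = parOr_der[OF der_single[OF sA] der_mono[OF d(2) threshold_bound] z(1)]
    note q = append_der[OF p(2) der_single[OF sA] z(2) st]
    have F: "der ((0 + 1) * (length As * (9 * U))) (par False [\<alpha>] d @ [\<alpha>]) (Or \<alpha> ?t) \<alpha>"
    proof (rule der_mono[OF q(2)])
      have "B + B + B \<le> length As * (9 * U)" using len U_ge G_ge B_pos by linarith
      then show "B + B + B \<le> (0 + 1) * (length As * (9 * U))" by simp
    qed
    let ?c = "20 * Z * threshold_bound m h + 5 * Z"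
    have "calls f_levels (levels_arg m 0 As) (encode (par False [\<alpha>] d @ [\<alpha>])) (20 * Z * ((0 + 1) * (length As * (9 * U))))"
      (is "calls _ ?u ?v _")
    proof (rule calls_if_yields[where c = ?c])
      show "yields f_levels ?u ?v ?c"
        using callsD[OF d(1)] callsD[OF p(1)] callsD[OF q(1)] As0(2)
        by (simp add: yields_def b_levels_def Let_def levels_arg_def threshold_arg_def)
      have "threshold_bound m h < (0 + 1) * (length As * (9 * U))"
        unfolding add_0 mult_1 using threshold_bound len U_ge G_ge B_pos by linarith
      from budget[OF this] show "?c < 20 * Z * ((0 + 1) * (length As * (9 * U)))"
        using Z_ge by linarith
    qed (use size_tree[of T] size_level[of m] levels leaves room' szA small_fm[OF sA] As0(2) Z_le_square
        size_fits[OF fits_der[OF F 0(2)]] in \<open>simp_all add: levels_arg_def\<close>)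
    with F show ?case unfolding runs_def k by blast
  next
    case (Suc j k)
    then have k: "k < m" by simp
    have k': "k \<le> m" "Suc k \<le> m" using k by auto
    let ?t = "\<theta> k" and ?n = "\<theta> (Suc k)"
    have n: "fm_size ?n \<le> B" and t: "fm_size ?t \<le> B" using theta_size k' by auto
    define S where "S = (j + 1) * (length As * (9 * U))"
    define Lb where "Lb = length As * (8 * U)"
    have Lb: "length As * (9 * U) = Lb + length As * U" by (simp add: Lb_def algebra_simps)
    have U1: "U \<le> length As * U" using As0(1) by (cases As) auto
    have S: "(Suc j + 1) * (length As * (9 * U)) = Lb + length As * U + S" by (simp add: S_def Lb)
    have Z: "Lb + length As * U + S \<le> Z" using Suc.prems(2) unfolding S .
    obtain r where r: "calls f_levels (levels_arg (Suc k) j As) (encode r) (20 * Z * S)" "der S r (Or \<alpha> ?n) \<alpha>"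
      using Suc.IH[of "Suc k"] Suc.prems Z unfolding runs_def S_def by auto
    obtain As' where As': "As = TT # As'" using As0(1,3) by (cases As) auto
    have "runs f_lines (DCons (env k) (encode (TT # As'))) ((length As' + 1) * (8 * U))
      (Or (lhs k TT) ?n) (Or (last (TT # As')) ?n)"
      using As0(4) cov Z unfolding As' Lb_def by (intro lines_runs[OF k]) auto
    then obtain l where l: "calls f_lines (DCons (env k) (encode As)) (encode l) (20 * Z * Lb)"
      "der Lb l (Or (And ?t TT) ?n) (Or \<alpha> ?n)"
      using As0(2) unfolding runs_def Lb_def As' by (auto simp: lhs_def)
    obtain x where x: "calls f_threshold (threshold_arg None T k) (encode x) (20 * Z * threshold_bound m h)"
      "data_hd (encode x) = encode_fm ?t"
      using theta_run[OF k'(1)] threshold_bound room'(2) by (elim runsE) auto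
    obtain y where y: "calls f_threshold (threshold_arg None T (Suc k)) (encode y) (20 * Z * threshold_bound m h)"
      "data_hd (encode y) = encode_fm ?n"
      using theta_run[OF k'(2)] threshold_bound room'(2) by (elim runsE) auto
    obtain g where g: "calls f_generic (DCons DNil (DCons DNil (encode_fm ?n))) (encode g) (20 * Z * G)" "der G g FF ?n"
      using generic_small(1)[OF n] unfolding runs_def by blast
    obtain c where c: "calls f_generic (DCons DNil (DCons (DCons DNil DNil) (encode_fm \<alpha>))) (encode c) (20 * Z * G)"
      "der G c (Or \<alpha> \<alpha>) \<alpha>"
      using generic_small(2)[OF sA] unfolding runs_def by blast
    have tt: "fm_size (And ?t TT) \<le> B + 1" using t by simp
    have z: "B + 1 + G \<le> Z" "B + 1 + G + Lb \<le> Z" "B + (B + (B + 1 + G + Lb)) \<le> Z" "G + B \<le> Z" "G + B + S \<le> Z"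
      "B + (B + (B + 1 + G + Lb)) + (G + B + S) \<le> Z"
      using Z U1 U_ge G_ge B_pos by linarith+
    note p1 = parOr_der[OF der_single[OF tt] g(2) z(1)]
    note a1 = append_der[OF p1(2) l(2) z(2) step_refl]
    have st1: "step ?t (Or (And ?t TT) FF)" by (auto intro!: step_feq simp: feq_simps)
    have a1': "der (B + (B + 1 + G + Lb)) (?t # par False [And ?t TT] g @ l) ?t (Or \<alpha> ?n)"
      by (rule der_mono[OF der_Cons[OF a1(2) st1]]) (use t in simp)
    note p2 = parOr_der[OF der_single[OF sA] a1' z(3)]
    note p3 = parOr_der[OF c(2) der_single[OF n] z(4)]
    note a2 = append_der[OF p3(2) r(2) z(5) step_refl]
    have st2: "step (Or \<alpha> (Or \<alpha> ?n)) (Or (Or \<alpha> \<alpha>) ?n)" by (auto intro!: step_feq simp: feq_simps)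
    note a3 = append_der[OF p2(2) a2(2) z(6) st2]
    let ?L = "par False [\<alpha>] (?t # par False [And ?t TT] g @ l) @ par False c [?n] @ r"
    have F: "der (Lb + length As * U + S) ?L (Or \<alpha> ?t) \<alpha>"
      by (rule der_mono[OF a3(2)]) (use U1 U_ge G_ge B_pos in linarith)
    let ?c = "20 * Z * Lb + 20 * Z * S + 20 * Z * (2 * G) + 20 * Z * (2 * threshold_bound m h) + 15 * Z"
    have "calls f_levels (levels_arg k (Suc j) As) (encode ?L) (20 * Z * (Lb + length As * U + S))"
      (is "calls _ ?u ?v _")
    proof (rule calls_if_yields[where c = ?c])
      show "yields f_levels ?u ?v ?c"
        using callsD[OF r(1)] callsD[OF l(1)] callsD[OF x(1)] callsD[OF y(1)] x(2) y(2) callsD[OF g(1)] callsD[OF c(1)]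
          callsD[OF p1(1)] callsD[OF p2(1)] callsD[OF p3(1)] callsD[OF a1(1)] callsD[OF a2(1)] callsD[OF a3(1)] As0(2)
        unfolding As'
        by (simp add: yields_def b_levels_def Let_def levels_arg_def threshold_arg_def env_def del: last.simps)
      have "Lb + S + 2 * G + 2 * threshold_bound m h < Lb + length As * U + S"
        using threshold_bound U1 U_ge G_ge B_pos by linarith
      from budget[OF this]
      show "?c < 20 * Z * (Lb + length As * U + S)"
        unfolding distrib_left using Z_ge by linarith
    qed (use size_tree[of T] size_level[of k] size_level[of "Suc j"] Suc.prems(1) levels leaves room' szA small_fm[OF sA] As0(2) Z_le_square
        size_fits[OF fits_der[OF F Z]] in \<open>simp_all add: levels_arg_def\<close>)
    with F show ?case unfolding runs_def S by blast
  }
qed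

lemma main_calls:
  assumes pf: "is_proof bar SKS As \<alpha>" and cov: "\<forall>A\<in>set As. covered A"
    and T: "T = collect (encode As) (Leaf None)" and m: "m = leaves T"
    and Z: "(m + 2) * (length As * (9 * U)) \<le> Z"
  shows "\<exists>d. calls 0 (encode As) (encode d) (100 * Z * Z2) \<and> is_proof bar (SKS - {AiUp}) d \<alpha>"
proof -
  have As0: "As \<noteq> []" "last As = \<alpha>" "hd As = TT"
    using pf by (auto simp: is_proof_def derivation_def)
  have \<alpha>: "covered \<alpha>" and TT: "covered TT" using cov As0 hd_in_set[of As] by auto
  have sA: "fm_size \<alpha> \<le> B" using covered_sizes(1)[OF \<alpha>, of 0] by simp
  have t0: "fm_size (\<theta> 0) \<le> B" using theta_size[of 0] by simp
  define S where "S = (m + 1) * (length As * (9 * U))"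
  have S: "S + length As * (9 * U) \<le> Z" using Z unfolding S_def by (simp add: algebra_simps)
  have len: "length As * 1 \<le> length As * (9 * U)"
    using U_ge G_pos by (intro mult_le_mono2) linarith
  have U1: "9 * U \<le> length As * (9 * U)" using As0(1) by (cases As) auto
  have lA: "length As \<le> Z" using len S by linarith
  have szA: "data_size (encode As) \<le> 9 * Z2"
  proof (rule size_fits)
    show "fits As" using lA cov covered_sizes(1)[of _ 0] room' unfolding fits_def by (meson le0 le_trans)
  qed
  have fA: "fits As" using lA cov covered_sizes(1)[of _ 0] room' unfolding fits_def by (meson le0 le_trans)
  have top: "atom_leaves T < m" using collect_atom_leaves[of "Leaf None" "encode As"] unfolding m T by simp
  obtain r where r: "calls f_levels (levels_arg 0 m As) (encode r) (20 * Z * S)" "der S r (Or \<alpha> (\<theta> 0)) \<alpha>"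
    using levels_runs[OF pf cov top lA TT, of 0 m] S unfolding runs_def S_def by auto
  obtain x where x: "calls f_threshold (threshold_arg None T 0) (encode x) (20 * Z * threshold_bound m h)"
    "data_hd (encode x) = encode_fm (\<theta> 0)"
    using theta_run[OF le0] threshold_bound room'(2) by (elim runsE) auto
  obtain g where g: "calls f_generic (DCons DNil (DCons DNil (encode_fm \<alpha>))) (encode g) (20 * Z * G)" "der G g FF \<alpha>"
    using generic_small(1)[OF sA] unfolding runs_def by blast
  have z: "G + B \<le> Z" "G + B + S \<le> Z" "1 + (G + B + S) \<le> Z" using S U1 U_ge G_ge B_pos by linarith+
  note p = parOr_der[OF g(2) der_single[OF t0] z(1)]
  note a = append_der[OF p(2) r(2) z(2) step_refl]
  have st: "step TT (Or FF (\<theta> 0))"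
    using threshold_0[of T] by (intro step_feq) (simp add: feq_iff_class class_units \<theta>_def)
  have F: "der (1 + (G + B + S)) (TT # par False g [\<theta> 0] @ r) TT \<alpha>"
    using der_Cons[OF a(2) st] by simp
  have lc: "calls f_last (encode As) (encode_fm \<alpha>) (length As + 1)"
    using last_calls[OF As0(1) fA] As0(2) by simp
  have lvZ: "leaves T < Z" using m levels B_pos room'(1) G_ge U_ge by linarith
  have cc: "calls f_collect (DCons (encode As) (DCons (encode_tree (Leaf None)) (num (leaves (Leaf None :: 'a tree)))))
      (DCons (encode_tree T) (num m)) (10 * Z * (9 * Z2))"
  proof -
    have "calls f_collect (DCons (encode As) (DCons (encode_tree (Leaf None)) (num (leaves (Leaf None :: 'a tree)))))
      (DCons (encode_tree (collect (encode As) (Leaf None))) (num (leaves (collect (encode As) (Leaf None)))))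
      (10 * Z * data_size (encode As))"
      using lvZ szA T by (intro collect_calls) auto
    then show ?thesis unfolding T m by (rule calls_mono) (use szA in simp)
  qed
  have ZZ: "Z * 20 \<le> Z * Z2" "Z * Z \<le> Z * Z2" using Z_le_square by (auto intro!: mult_le_mono2)
  \<comment> \<open>Collecting the atoms dominates with \<open>90 * (Z * Z2)\<close> calls;
    everything else fits into the remaining \<open>10 * (Z * Z2)\<close>.\<close>
  let ?c = "10 * Z * (9 * Z2) + 20 * Z * (S + G + threshold_bound m h) + 10 * Z"
  have "calls 0 (encode As) (encode (TT # par False g [\<theta> 0] @ r)) (100 * Z * Z2)"
    (is "calls _ ?u ?v _")
  proof (rule calls_if_yields[where c = ?c])
    show "yields 0 ?u ?v ?c"
      using callsD[OF cc] callsD[OF lc] callsD[OF r(1)] callsD[OF x(1)] x(2) callsD[OF g(1)] callsD[OF p(1)] callsD[OF a(1)] lA Z_ge As0(2)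
      by (simp add: yields_def b_main_def Let_def levels_arg_def threshold_arg_def distrib_left del: last.simps)
    have "S + G + threshold_bound m h \<le> Z" using z(2) threshold_bound by simp
    then have "20 * Z * (S + G + threshold_bound m h) \<le> 20 * Z * Z" by (intro mult_le_mono2)
    moreover have "20 * Z * Z = 20 * Z2" by (simp add: Z2_def)
    moreover have eqs: "10 * Z * (9 * Z2) = 90 * (Z * Z2)" "100 * Z * Z2 = 100 * (Z * Z2)" by simp_all
    moreover have "10 * Z2 \<le> Z * Z2" using Z_ge by (intro mult_le_mono1)
    moreover have "100 * Z \<le> Z * Z2" using Z_le_square mult_le_mono2[of 100 Z2 Z] by simp
    moreover have "1 \<le> Z * Z2" using Z_ge Z_le_square by simp
    ultimately show "?c < 100 * Z * Z2"
      unfolding eqs by linarith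
  qed (use szA Z_le_square size_fits[OF fits_der[OF F z(3)]] in simp_all)
  moreover have "is_proof bar (SKS - {AiUp}) (TT # par False g [\<theta> 0] @ r) \<alpha>"
    using F unfolding der_def is_proof_def derivation_def step_def by blast
  ultimately show ?thesis by blast
qed

end

section \<open>The quasipolynomial bound\<close>

lemma threshold_bound_le:
  assumes "5 * (m + 2) \<le> y" shows "threshold_bound m h \<le> y ^ (h + 1)"
proof (induction h)
  case 0
  then show ?case using assms by simp
next
  case (Suc h)
  let ?t = "threshold_bound m h"
  have t: "2 \<le> ?t" by (rule threshold_bound_ge)
  have "(m + 1) * (2 * ?t + 2) + 2 \<le> (m + 1) * (2 * ?t + ?t) + ?t"
    using t by (intro add_mono mult_le_mono2) auto
  also have "\<dots> = (3 * m + 4) * ?t" by (simp add: algebra_simps)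
  also have "\<dots> \<le> y * y ^ (h + 1)" using assms by (intro mult_le_mono Suc) auto
  finally show ?case by simp
qed

text \<open>The exponent grows by three per level: one factor \<open>y\<close> is needed for the
  recursion, and the other two absorb the constants and the quadratic threshold term, whose exponent
  is only \<open>2 * h + 5\<close>.\<close>

lemma succ_bound_le:
  assumes "5 * (m + 2) \<le> y" shows "succ_bound m h \<le> y ^ (3 * h + 6)"
proof (induction h)
  case 0
  have "10 ^ 6 \<le> y ^ 6" using assms by (intro power_mono) auto
  then show ?case by simp
next
  case (Suc h)
  let ?t = "threshold_bound m (Suc h)" and ?s = "succ_bound m h"
  have t: "2 \<le> ?t" by (rule threshold_bound_ge)
  have tt: "2 * ?t \<le> ?t * ?t" using t by (rule mult_le_mono1)
  have "succ_bound m (Suc h) = (m + 1) * ?s + ((m + 1) * (8 * ?t + 13) + 20 + 4 * (?t * ?t) + 10 * ?t)"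
    by (simp add: succ_bound_conv_def algebra_simps del: threshold_bound.simps)
  also have "\<dots> \<le> (m + 1) * ?s + ((m + 1) * (8 * (?t * ?t)) + 14 * (?t * ?t))"
  proof -
    have "(m + 1) * (8 * ?t + 13) \<le> (m + 1) * (8 * (?t * ?t))"
      using t tt by (intro mult_le_mono2) linarith
    moreover have "20 + 4 * (?t * ?t) + 10 * ?t \<le> 14 * (?t * ?t)" using t tt by linarith
    ultimately show ?thesis by linarith
  qed
  also have "\<dots> = (m + 1) * ?s + (8 * m + 22) * (?t * ?t)" by (simp add: algebra_simps del: threshold_bound.simps)
  also have "\<dots> \<le> y * y ^ (3 * h + 6) + (3 * y) * (y ^ (h + 2) * y ^ (h + 2))"
    using assms threshold_bound_le[OF assms, of "Suc h"]
    by (intro add_mono mult_le_mono Suc) (auto simp del: threshold_bound.simps)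
  also have "\<dots> = y ^ (3 * h + 7) + 3 * y ^ (2 * h + 5)"
    by (simp add: power_add power2_eq_square power3_eq_cube numeral_eq_Suc algebra_simps)
  also have "\<dots> \<le> y ^ (3 * h + 8) + 3 * y ^ (3 * h + 8)"
    using assms by (intro add_mono mult_le_mono2 power_increasing) auto
  also have "\<dots> \<le> y * y ^ (3 * h + 8)"
    using assms mult_le_mono1[of 4 y "y ^ (3 * h + 8)"] by simp
  finally show ?case by (simp add: numeral_eq_Suc)
qed


lemma in_data_atoms: "a \<in> fm_atoms A \<Longrightarrow> a \<in> data_atoms (encode_fm A)"
  by (induction A) auto

lemma in_data_atoms_encode: "A \<in> set As \<Longrightarrow> a \<in> fm_atoms A \<Longrightarrow> a \<in> data_atoms (encode As)"
  by (induction As) (auto intro: in_data_atoms)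

text \<open>The program turns out to take at most \<open>time_unit cut_program\<close> times the
  power \<open>(3 * h + 8) * 49\<close> of \<open>5 * (n + 3)\<close>, with \<open>h\<close> at most
  the rounded logarithm. This explains \<open>147 = 3 * 49\<close>, and 400 is a round number above
  \<open>8 * 49\<close>.\<close>

definition time_bound :: "nat \<Rightarrow> nat" where
  "time_bound n = time_unit cut_program *
     (5 * (n + 3)) ^ (147 * nat \<lfloor>2 * log 2 (real n + 1)\<rfloor> + 400)"

lemma quasipolynomial_time_bound: "quasipolynomial time_bound"
proof -
  \<comment> \<open>The constant \<open>time_unit cut_program\<close> is replaced by
    \<open>n\<close>, which exceeds it eventually. The logarithm of the whole is quadratic in
    \<open>log n\<close>, so the third power dominates it.\<close>
  let ?f = "\<lambda>n. real n * (5 * (real n + 3)) powr (147 * (2 * log 2 (real n + 1)) + 400)"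
  have 1: "eventually (\<lambda>n. ?f n \<le> 2 powr (log 2 (real n) ^ 3)) at_top"
    by real_asymp
  have 2: "eventually (\<lambda>n. time_unit cut_program \<le> n) at_top"
    by (rule eventually_ge_at_top)
  have "eventually (\<lambda>n. real (time_bound n) \<le> 2 powr (log 2 (real n) ^ 3)) at_top"
    using 1 2
  proof eventually_elim
    case (elim n)
    let ?L = "2 * log 2 (real n + 1)" and ?y = "5 * (real n + 3)"
    have L: "0 \<le> ?L" by simp
    have "real (147 * nat \<lfloor>?L\<rfloor> + 400) \<le> 147 * ?L + 400"
      using of_nat_floor[OF L] by simp
    then have "?y ^ (147 * nat \<lfloor>?L\<rfloor> + 400) \<le> ?y powr (147 * ?L + 400)"
      by (subst powr_realpow[symmetric]) (auto intro: powr_mono)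
    then have "real (time_unit cut_program) * ?y ^ (147 * nat \<lfloor>?L\<rfloor> + 400) \<le> ?f n"
      using elim(2) by (intro mult_mono) auto
    also have "real (time_unit cut_program) * ?y ^ (147 * nat \<lfloor>?L\<rfloor> + 400) = real (time_bound n)"
      by (simp add: time_bound_def)
    finally show ?case using elim(1) by linarith
  qed
  then show ?thesis unfolding quasipolynomial_def by blast
qed

lemma height_bound:
  assumes "balanced T" "leaves T \<le> n + 1"
  shows "height T \<le> nat \<lfloor>2 * log 2 (real n + 1)\<rfloor>"
proof -
  have "2 ^ height T \<le> (n + 1) ^ 2"
    using balanced_height[OF assms(1)] power_mono[OF assms(2), of 2] by linarith
  then have "real (2 ^ height T) \<le> real ((n + 1) ^ 2)"
    by (rule of_nat_mono)
  then have "(2 :: real) ^ height T \<le> (real n + 1) ^ 2"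
    by (simp only: of_nat_power of_nat_add of_nat_numeral of_nat_1)
  then have "real (height T) \<le> log 2 ((real n + 1) ^ 2)"
    by (simp add: le_log_iff powr_realpow)
  also have "\<dots> = 2 * log 2 (real n + 1)"
    by (simp add: log_nat_power)
  finally show ?thesis by (simp add: le_nat_floor)
qed

lemma power5: "x ^ 5 = x * (x * (x * (x * x)))" for x :: nat
  by (simp add: numeral_eq_Suc)

lemma cut_elimination_in_time:
  fixes bar :: "'a \<Rightarrow> 'a"
  assumes bar: "\<And>a. bar (bar a) = a" "\<And>a. bar a \<noteq> a" and pf: "is_proof bar SKS As \<alpha>"
  shows "\<exists>As' t. is_proof bar (SKS - {AiUp}) As' \<alpha> \<and> computes bar cut_program (encode As) (encode As') t \<and>
    t \<le> time_bound (proof_size As)"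
proof -
  interpret cut_free bar by unfold_locales (rule bar)
  define T where "T = collect (encode As) (Leaf None)"
  define m h n where "m = leaves T" and "h = height T" and "n = proof_size As"
  define y where "y = 5 * (n + 3)"
  \<comment> \<open>The exponent allows for \<open>succ_bound_le\<close> and also for the product of
    a formula size below \<open>y\<close> with a threshold bound below
    \<open>y ^ (3 * h + 7)\<close>, as \<open>covered\<close> demands.\<close>
  define B where "B = y ^ (3 * h + 8)"
  \<comment> \<open>The room required is of degree at most five in \<open>B\<close>, with constants
    up to 4800; the factor \<open>B ^ 4\<close>, at least 10000, absorbs these constants.\<close>
  define Z where "Z = B ^ 9"
  have m: "m \<le> n + 1"
    using collect_leaves(2)[of "encode As" "Leaf None"] num_atoms_encode[of As] by (simp add: m_def T_def n_def)
  have y: "5 * (m + 2) \<le> y" "15 \<le> y" using m by (auto simp: y_def)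
  have S: "succ_bound m h \<le> y ^ (3 * h + 6)" using succ_bound_le[OF y(1)] .
  have t: "threshold_bound m h + 1 \<le> y ^ (3 * h + 7)"
  proof -
    have "threshold_bound m h + 1 \<le> y ^ (h + 1) + y ^ (h + 1)"
      using threshold_bound_le[OF y(1), of h] y(2) by (intro add_mono) auto
    also have "\<dots> = 2 * y ^ (h + 1)" by simp
    also have "\<dots> \<le> y * y ^ (h + 1)" using y(2) by (intro mult_le_mono1) simp
    also have "\<dots> = y ^ (h + 2)" by simp
    also have "\<dots> \<le> y ^ (3 * h + 7)" using y(2) by (intro power_increasing) auto
    finally show ?thesis .
  qed
  have By: "y * y ^ (3 * h + 7) = B" "y ^ (3 * h + 7) \<le> B" "y ^ (3 * h + 6) \<le> B" "y \<le> B"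
    using y(2) power_increasing[of 1 "3 * h + 8" y] by (auto simp: B_def numeral_eq_Suc intro!: power_increasing)
  have B15: "15 \<le> B" using By y(2) by linarith
  have len: "length As \<le> n"
  proof -
    have "length As \<le> proof_size As" for As :: "'a fm list"
    proof (induction As)
      case (Cons A As)
      then show ?case using fm_size_pos[of A] by (simp add: proof_size_def)
    qed simp
    then show ?thesis by (simp add: n_def)
  qed
  have size: "fm_size A \<le> n" if "A \<in> set As" for A
    unfolding n_def proof_size_def using that by (intro member_le_sum_list) auto
  have B4: "10000 \<le> B ^ 4" using power_mono[OF B15, of 4] by simp
  have ZB: "4800 * (B * (B * B)) \<le> Z" "B * (B * (1440 * (B * (B * B)))) \<le> Z"
  proof -
    have Z: "Z = B ^ 4 * B ^ 5" unfolding Z_def by (simp flip: power_add)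
    have "4800 * (B * (B * B)) = 4800 * B ^ 3" by (simp add: power3_eq_cube)
    also have "\<dots> \<le> B ^ 4 * B ^ 5" using B4 B15 by (intro mult_le_mono power_increasing) auto
    finally show "4800 * (B * (B * B)) \<le> Z" unfolding Z .
    have "B * (B * (1440 * (B * (B * B)))) = 1440 * B ^ 5" by (simp add: power5)
    also have "\<dots> \<le> B ^ 4 * B ^ 5" using B4 by (intro mult_le_mono1) simp
    finally show "B * (B * (1440 * (B * (B * B)))) \<le> Z" unfolding Z .
  qed
  have Z10: "10 \<le> Z" using B15 power_increasing[of 1 9 B] by (simp add: Z_def)
  have cons: "a \<in> atoms T \<Longrightarrow> bar a \<notin> atoms T" for a
    using collect_consistent[OF bar(2), of "Leaf None" "encode As"] by (simp add: T_def)
  have root: "T \<noteq> Leaf (Some a)" for a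
    using collect_atom_leaves[of "Leaf None" "encode As"] by (auto simp: T_def)
  interpret simulation bar Z T m h B
  proof
    show "10 \<le> Z" by (rule Z10)
    show "height T \<le> h" by (simp add: h_def)
    show "m \<le> B" using m By by (simp add: y_def)
    show "leaves T \<le> B" using m By by (simp add: y_def m_def)
    show "succ_bound m h \<le> B" using S By by linarith
    show "threshold_bound m h \<le> B" using t By by linarith
    show "30 * (40 * (B * (4 * (B * B)))) \<le> Z" using ZB by simp
  qed (use cons root in auto)
  have cov: "\<forall>A\<in>set As. covered A"
  proof
    fix A assume A: "A \<in> set As"
    have "fm_size A * (threshold_bound m h + 1) \<le> y * y ^ (3 * h + 7)"
      using size[OF A] t by (intro mult_le_mono) (auto simp: y_def)
    moreover have "a \<in> atoms T \<or> bar a \<in> atoms T" if "a \<in> fm_atoms A" for a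
      using collect_covers[OF in_data_atoms_encode[OF A that], of "Leaf None"] by (simp add: T_def)
    ultimately show "covered A" using By unfolding covered_def by auto
  qed
  have U: "9 * U = 1440 * (B * (B * B))" by (simp add: U_def G_def)
  have "(m + 2) * (length As * (9 * U)) \<le> B * (B * (9 * U))"
    using m len By by (intro mult_le_mono) (auto simp: y_def)
  then have room2: "(m + 2) * (length As * (9 * U)) \<le> Z" using ZB(2) unfolding U by linarith
  obtain d where d: "calls 0 (encode As) (encode d) (100 * Z * Z2)" "is_proof bar (SKS - {AiUp}) d \<alpha>"
    using main_calls[OF pf cov T_def m_def room2] by blast
  then obtain s where s: "s \<le> 100 * Z * Z2 * (time_unit cut_program * W)" "eval bar cut_program [encode As] (cut_program ! 0) (encode d) s"
    unfolding calls_def by blast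
  \<comment> \<open>\<open>100 * Z ^ 3\<close> calls, each charged
    \<open>time_unit cut_program * W\<close> with \<open>W = 100 * Z ^ 2\<close>.\<close>
  have "100 * Z * Z2 * (time_unit cut_program * W) = time_unit cut_program * (10000 * Z ^ 5)"
    by (simp add: W_def Z2_def power5)
  also have "\<dots> \<le> time_unit cut_program * y ^ (147 * nat \<lfloor>2 * log 2 (real n + 1)\<rfloor> + 400)"
  proof (rule mult_le_mono2)
    have "10000 * Z ^ 5 \<le> B ^ 4 * Z ^ 5" using B4 by (rule mult_le_mono1)
    also have "\<dots> = B ^ 49" unfolding Z_def by (simp flip: power_mult power_add)
    also have "\<dots> = y ^ ((3 * h + 8) * 49)" unfolding B_def by (rule power_mult[symmetric])
    also have "\<dots> \<le> y ^ (147 * nat \<lfloor>2 * log 2 (real n + 1)\<rfloor> + 400)"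
    proof (rule power_increasing)
      have "balanced T" unfolding T_def by (rule collect_balanced) simp
      then show "(3 * h + 8) * 49 \<le> 147 * nat \<lfloor>2 * log 2 (real n + 1)\<rfloor> + 400"
        using height_bound[of T n] m unfolding h_def m_def by simp
    qed (use y(2) in simp)
    finally show "10000 * Z ^ 5 \<le> y ^ (147 * nat \<lfloor>2 * log 2 (real n + 1)\<rfloor> + 400)" .
  qed
  finally have "s \<le> time_bound n"
    using s(1) unfolding time_bound_def y_def by linarith
  moreover have "computes bar cut_program (encode As) (encode d) s"
    using s(2) unfolding computes_def by (simp add: cut_program_def)
  ultimately show ?thesis using d(2) unfolding n_def by blast
qed

theorem theorem6p3:
  fixes bar :: "'a \<Rightarrow> 'a"
  assumes bar_involution: "\<And>a. bar (bar a) = a"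
    and bar_non_identical: "\<And>a. bar a \<noteq> a"
  shows "\<exists>(P :: program) (T :: nat \<Rightarrow> nat). quasipolynomial T \<and>
    (\<forall>(\<Pi> :: 'a fm list) (\<alpha> :: 'a fm). is_proof bar SKS \<Pi> \<alpha> \<longrightarrow>
      (\<exists>(\<Pi>' :: 'a fm list) (t :: nat).
        is_proof bar (SKS - {AiUp}) \<Pi>' \<alpha> \<and>
        computes bar P (encode \<Pi>) (encode \<Pi>') t \<and>
        t \<le> T (proof_size \<Pi>)))"
  using quasipolynomial_time_bound cut_elimination_in_time[OF bar_involution bar_non_identical] by blast

end
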